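(* Let $\alpha>-1$, let $\mu,\lambda\in\mathcal{B}_2$ and set $\nu=\mu^{1/2}\lambda^{-1/2}$. Let $b\in L^1_{loc}(\mathbb{R}_+^2,dA_\alpha)\cap H(\mathbb{R}_+^2)$. Then for each of the two operators $T=P_\alpha$ and $T=P_\alpha^+$, the commutator $[b,T]$ is bounded from $L^2_\alpha(\mathbb{R}_+^2,\mu)$ to $L^2_\alpha(\mathbb{R}_+^2,\lambda)$ if and only if $b\in \mathrm{BMOA}_\nu(\mathbb{R}_+^2)$. Moreover, $$\|[b,P_\alpha]\|_{L^2_\alpha(\mathbb{R}_+^2,\mu)\to L^2_\alpha(\mathbb{R}_+^2,\lambda)}\simeq \|b\|_{\mathrm{BMOA}_\nu(\mathbb{R}_+^2)},\qquad \|[b,P_\alpha^+]\|_{L^2_\alpha(\mathbb{R}_+^2,\mu)\to L^2_\alpha(\mathbb{R}_+^2,\lambda)}\simeq \|b\|_{\mathrm{BMOA}_\nu(\mathbb{R}_+^2)},$$ with implicit constants independent of $b$ (they may depend on $\alpha,\mu,\lambda$).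
   Context: $\mathbb{R}_+^2=\{z\in\mathbb{C}:\operatorname{Im}z>0\}$, $H(\mathbb{R}_+^2)$ is the space of holomorphic functions on it, $dA=dx\,dy$, and $dA_\alpha(z)=\frac1\pi(\alpha+1)(2\operatorname{Im}z)^\alpha dA(z)$, with $\alpha>-1$ fixed. A weight is a measurable a.e. positive function on $\mathbb{R}_+^2$; $L^2_\alpha(\mathbb{R}_+^2,\mu)$ is the space of measurable $f$ with $\int|f|^2\mu\,dA_\alpha<\infty$. Functions are complex valued. Operators: $P_\alpha f(z)=i^{2+\alpha}\int_{\mathbb{R}_+^2}\frac{f(w)}{(z-\overline w)^{2+\alpha}}dA_\alpha(w)$ (principal branch; $z-\overline w$ lies in the upper half plane) and $P_\alpha^+f(z)=\int_{\mathbb{R}_+^2}\frac{f(w)}{|z-\overline w|^{2+\alpha}}dA_\alpha(w)$. The commutator is $[b,T]f=b\,Tf-T(bf)$, initially defined for bounded compactly supported $f$; "bounded" means that it extends to a bounded operator between the indicated spaces. Carleson boxes: for an interval $I\subset\mathbb{R}$, $Q_I=\{x+iy: x\in I,\ y\in(0,|I|)\}$. $\mathcal{D}=\mathcal{D}^1\cup\mathcal{D}^2$, where $\mathcal{D}^1,\mathcal{D}^2$ are two fixed adjacent dyadic systems of intervals on $\mathbb{R}$, i.e. satisfying the $1/3$-trick: there is an absolute constant $C$ such that every bounded interval $I\subset\mathbb{R}$ is contained in some $J\in\mathcal{D}$ with $|J|\le C|I|$. $L^1_{loc}(\mathbb{R}_+^2,dA_\alpha)$: measurable functions integrable with respect to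 $dA_\alpha$ on every Carleson box. $b_{Q_I}$ denotes the average of $b$ on $Q_I$ with respect to $dA_\alpha$. $\mathcal{B}_2$: weights $\mu$ with $[\mu]_{\mathcal{B}_2}=\sup_{I\in\mathcal{D}}\Big(\frac1{A_\alpha(Q_I)}\int_{Q_I}\mu\,dA_\alpha\Big)\Big(\frac1{A_\alpha(Q_I)}\int_{Q_I}\mu^{-1}\,dA_\alpha\Big)<\infty$. For $\nu\in\mathcal{B}_2$, $\nu(E)=\int_E\nu\,dA_\alpha$, and $b\in L^1_{loc}(\mathbb{R}_+^2,dA_\alpha)$ is in $\mathrm{BMO}_\nu(\mathbb{R}_+^2)$ if $\|b\|_{\mathrm{BMO}_\nu}=\sup_{I\in\mathcal{D}}\frac1{\nu(Q_I)}\int_{Q_I}|b-b_{Q_I}|\,dA_\alpha<\infty$. $\mathrm{BMOA}_\nu=\mathrm{BMO}_\nu\cap H(\mathbb{R}_+^2)$, with the same norm. $a\simeq b$ means $a\le Cb$ and $b\le Ca$ for a constant $C$ as specified. *)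

theory Defs
  imports "HOL-Complex_Analysis.Complex_Analysis"
begin

section \<open>The upper half plane and the measures \<open>dA\<^sub>\<alpha>\<close>\<close>

definition upper_half :: "complex set" where
  "upper_half = {z. Im z > 0}"

text \<open>Measurability is Lebesgue measurability on the half plane; values of functions off
  the half plane play no role anywhere below.\<close>

definition dA :: "real \<Rightarrow> complex measure" where
  "dA \<alpha> = density (lebesgue_on upper_half)
            (\<lambda>z. ennreal (1 / pi * (\<alpha> + 1) * (2 * Im z) powr \<alpha>))"

section \<open>Dyadic systems and Carleson boxes\<close>

definition len :: "real set \<Rightarrow> real" where
  "len I = measure lborel I"

definition carleson :: "real set \<Rightarrow> complex set" where
  "carleson I = {z. Re z \<in> I \<and> 0 < Im z \<and> Im z < len I}"

definition dyadic_system :: "real set set \<Rightarrow> bool" where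
  "dyadic_system D \<longleftrightarrow>
     (\<forall>I\<in>D. \<exists>a. \<exists>j::int. I = {a..<a + 2 powi j}) \<and>
     (\<forall>j::int. \<forall>x. \<exists>!I. I \<in> D \<and> len I = 2 powi j \<and> x \<in> I) \<and>
     (\<forall>I\<in>D. \<forall>J\<in>D. I \<inter> J = {} \<or> I \<subseteq> J \<or> J \<subseteq> I)"

text \<open>Degenerate intervals (points) are excluded, as no interval \<open>J\<close> of positive length
  satisfies \<open>|J| \<le> C |I|\<close> when \<open>|I| = 0\<close>.\<close>

definition adjacent_dyadic :: "real set set \<Rightarrow> real set set \<Rightarrow> bool" where
  "adjacent_dyadic D1 D2 \<longleftrightarrow> dyadic_system D1 \<and> dyadic_system D2 \<and>
     (\<exists>C. \<forall>I. is_interval I \<and> bounded I \<and> len I > 0 \<longrightarrow>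
            (\<exists>J \<in> D1 \<union> D2. I \<subseteq> J \<and> len J \<le> C * len I))"

section \<open>Weights and function spaces\<close>

definition weight :: "(complex \<Rightarrow> real) \<Rightarrow> bool" where
  "weight \<mu> \<longleftrightarrow> \<mu> \<in> borel_measurable (lebesgue_on upper_half) \<and>
     (AE z in lebesgue_on upper_half. \<mu> z > 0)"

text \<open>The integrals are taken in \<open>[0, \<infinity>]\<close>. Both averages of a weight are positive, so the
  convention \<open>0 * \<infinity> = 0\<close> never matters.\<close>

definition B2_const :: "real \<Rightarrow> real set set \<Rightarrow> (complex \<Rightarrow> real) \<Rightarrow> ennreal" where
  "B2_const \<alpha> D \<mu> = (SUP I\<in>D.
      ((\<integral>\<^sup>+z\<in>carleson I. ennreal (\<mu> z) \<partial>dA \<alpha>) / emeasure (dA \<alpha>) (carleson I)) *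
      ((\<integral>\<^sup>+z\<in>carleson I. ennreal (inverse (\<mu> z)) \<partial>dA \<alpha>) / emeasure (dA \<alpha>) (carleson I)))"

definition B2 :: "real \<Rightarrow> real set set \<Rightarrow> (complex \<Rightarrow> real) set" where
  "B2 \<alpha> D = {\<mu>. weight \<mu> \<and> B2_const \<alpha> D \<mu> < \<infinity>}"

definition L1loc :: "real \<Rightarrow> (complex \<Rightarrow> complex) set" where
  "L1loc \<alpha> = {b. b \<in> borel_measurable (dA \<alpha>) \<and>
     (\<forall>I. is_interval I \<and> bounded I \<longrightarrow> set_integrable (dA \<alpha>) (carleson I) b)}"

definition L2 :: "real \<Rightarrow> (complex \<Rightarrow> real) \<Rightarrow> (complex \<Rightarrow> complex) set" where
  "L2 \<alpha> \<mu> = {f. f \<in> borel_measurable (dA \<alpha>) \<and>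
     integrable (dA \<alpha>) (\<lambda>z. (cmod (f z))\<^sup>2 * \<mu> z)}"

definition L2_norm :: "real \<Rightarrow> (complex \<Rightarrow> real) \<Rightarrow> (complex \<Rightarrow> complex) \<Rightarrow> real" where
  "L2_norm \<alpha> \<mu> f = sqrt (\<integral>z. (cmod (f z))\<^sup>2 * \<mu> z \<partial>dA \<alpha>)"

definition box_avg :: "real \<Rightarrow> (complex \<Rightarrow> complex) \<Rightarrow> real set \<Rightarrow> complex" where
  "box_avg \<alpha> b I = (LINT z:carleson I|dA \<alpha>. b z) / of_real (measure (dA \<alpha>) (carleson I))"

definition BMO_norm ::
    "real \<Rightarrow> real set set \<Rightarrow> (complex \<Rightarrow> real) \<Rightarrow> (complex \<Rightarrow> complex) \<Rightarrow> ennreal" where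
  "BMO_norm \<alpha> D \<nu> b = (SUP I\<in>D.
      (\<integral>\<^sup>+z\<in>carleson I. ennreal (cmod (b z - box_avg \<alpha> b I)) \<partial>dA \<alpha>) /
      (\<integral>\<^sup>+z\<in>carleson I. ennreal (\<nu> z) \<partial>dA \<alpha>))"

definition BMO :: "real \<Rightarrow> real set set \<Rightarrow> (complex \<Rightarrow> real) \<Rightarrow> (complex \<Rightarrow> complex) set" where
  "BMO \<alpha> D \<nu> = {b \<in> L1loc \<alpha>. BMO_norm \<alpha> D \<nu> b < \<infinity>}"

definition BMOA :: "real \<Rightarrow> real set set \<Rightarrow> (complex \<Rightarrow> real) \<Rightarrow> (complex \<Rightarrow> complex) set" where
  "BMOA \<alpha> D \<nu> = BMO \<alpha> D \<nu> \<inter> {b. b holomorphic_on upper_half}"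

section \<open>Operators\<close>

definition bergman :: "real \<Rightarrow> (complex \<Rightarrow> complex) \<Rightarrow> complex \<Rightarrow> complex" where
  "bergman \<alpha> f z = \<i> powr of_real (2 + \<alpha>) *
     (\<integral>w. f w / (z - cnj w) powr of_real (2 + \<alpha>) \<partial>dA \<alpha>)"

definition bergman_pos :: "real \<Rightarrow> (complex \<Rightarrow> complex) \<Rightarrow> complex \<Rightarrow> complex" where
  "bergman_pos \<alpha> f z = (\<integral>w. f w / of_real (cmod (z - cnj w) powr (2 + \<alpha>)) \<partial>dA \<alpha>)"

definition commutator ::
    "(complex \<Rightarrow> complex) \<Rightarrow> ((complex \<Rightarrow> complex) \<Rightarrow> complex \<Rightarrow> complex) \<Rightarrow>
     (complex \<Rightarrow> complex) \<Rightarrow> complex \<Rightarrow> complex" where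
  "commutator b T f = (\<lambda>z. b z * T f z - T (\<lambda>w. b w * f w) z)"

definition bdd_cpt_supp :: "(complex \<Rightarrow> complex) set" where
  "bdd_cpt_supp = {f. f \<in> borel_measurable (lebesgue_on upper_half) \<and>
     bounded (f ` upper_half) \<and>
     (\<exists>K. compact K \<and> K \<subseteq> upper_half \<and> (\<forall>z \<in> upper_half - K. f z = 0))}"

text \<open>\<open>S\<close> is a linear operator from \<open>L\<^sup>2\<^sub>\<alpha>(\<mu>)\<close> to \<open>L\<^sup>2\<^sub>\<alpha>(lam)\<close> with bound \<open>C\<close> that extends \<open>T\<close>.
  Elements of \<open>L\<^sup>2\<close> are represented by functions, so identities hold almost everywhere;
  that \<open>S\<close> respects almost everywhere equality follows from linearity and the bound.\<close>

definition bounded_extension ::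
    "real \<Rightarrow> (complex \<Rightarrow> real) \<Rightarrow> (complex \<Rightarrow> real) \<Rightarrow>
     ((complex \<Rightarrow> complex) \<Rightarrow> complex \<Rightarrow> complex) \<Rightarrow>
     ((complex \<Rightarrow> complex) \<Rightarrow> complex \<Rightarrow> complex) \<Rightarrow> real \<Rightarrow> bool" where
  "bounded_extension \<alpha> \<mu> lam T S C \<longleftrightarrow>
     (\<forall>f \<in> L2 \<alpha> \<mu>. S f \<in> L2 \<alpha> lam \<and> L2_norm \<alpha> lam (S f) \<le> C * L2_norm \<alpha> \<mu> f) \<and>
     (\<forall>f \<in> L2 \<alpha> \<mu>. \<forall>g \<in> L2 \<alpha> \<mu>. \<forall>c d.
        AE z in dA \<alpha>. S (\<lambda>w. c * f w + d * g w) z = c * S f z + d * S g z) \<and>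
     (\<forall>f \<in> bdd_cpt_supp. AE z in dA \<alpha>. S f z = T f z)"

definition bounded_L2 ::
    "real \<Rightarrow> (complex \<Rightarrow> real) \<Rightarrow> (complex \<Rightarrow> real) \<Rightarrow>
     ((complex \<Rightarrow> complex) \<Rightarrow> complex \<Rightarrow> complex) \<Rightarrow> bool" where
  "bounded_L2 \<alpha> \<mu> lam T \<longleftrightarrow> (\<exists>S C. bounded_extension \<alpha> \<mu> lam T S C)"

text \<open>The operator norm of the bounded extension, with value \<open>\<infinity>\<close> if there is none. For
  weights in \<open>B\<^sub>2\<close> the extension is unique, by density of \<^const>\<open>bdd_cpt_supp\<close>.\<close>

definition op_norm_L2 ::
    "real \<Rightarrow> (complex \<Rightarrow> real) \<Rightarrow> (complex \<Rightarrow> real) \<Rightarrow>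
     ((complex \<Rightarrow> complex) \<Rightarrow> complex \<Rightarrow> complex) \<Rightarrow> ennreal" where
  "op_norm_L2 \<alpha> \<mu> lam T = Inf {ennreal C | C. C \<ge> 0 \<and> (\<exists>S. bounded_extension \<alpha> \<mu> lam T S C)}"

end

theory Submission
  imports Defs
begin

text \<open>Write \<open>M = dA\<^sub>\<alpha>\<close>, \<open>d(z,w) = |z - cnj w|\<close> and \<open>k(z,w) = d(z,w)\<^bsup>-(2+\<alpha>)\<^esup>\<close>. The two Bergman
operators have kernels of modulus \<open>k\<close> which are nearly constant on boxes that are far apart compared with
their size. The proof rests on these two properties of a kernel and treats both operators at once. The
weight \<open>\<lambda>\<close> is called \<open>lam\<close> in the code.

\<^bold>\<open>From BMO to the commutator.\<close> The commutator has kernel of modulus \<open>|b(z) - b(w)| k(z,w)\<close>, and the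
crucial point is the pointwise bound (lemma \<open>oscillation_kernel\<close>)
\<open>|b(z) - b(w)| k(z,w) \<le> C B \<integral> k(z,v) \<nu>(v) k(v,w) dM(v)\<close>, where \<open>B\<close> is the BMO norm of \<open>b\<close>.
To see it, compare \<open>b(z)\<close> with the averages of \<open>b\<close> over a chain of boxes whose sides double from
\<open>Im z\<close> to \<open>d(z,w)\<close>. The first comparison is a sub-mean value property of holomorphic functions, the
others are the BMO condition; the averages of \<open>\<nu>\<close> which they produce add up, like a geometric series,
to a potential of \<open>\<nu>\<close> with kernel \<open>k(z,\<cdot>)\<close>. A chain starts from \<open>w\<close> as well, and both end in one box.

So \<open>|[b,T]f|\<close> is at most a multiple of \<open>P(\<nu> P|f|)\<close>, where \<open>P\<close> (in the code: \<open>posop\<close>) is the positive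
operator with kernel \<open>k\<close>. Since \<open>\<nu>\<^sup>2 \<lambda> = \<mu>\<close>, multiplication by \<open>\<nu>\<close> carries \<open>L\<^sup>2(\<mu>)\<close>
isometrically to \<open>L\<^sup>2(\<lambda>)\<close>. What remains is that \<open>P\<close> is bounded on \<open>L\<^sup>2(w)\<close> for every Bekolle weight \<open>w\<close>
(lemma \<open>posop_bounded\<close>). The kernel \<open>k\<close> is dominated by a sum over the dyadic boxes of
\<open>1\<^sub>Q(z) 1\<^sub>Q(w) / M(Q)\<close>. The upper halves of these boxes are disjoint and carry a fixed share of their
measure; hence the Bekolle condition and the Cauchy-Schwarz inequality reduce the dyadic form to sums
\<open>\<Sum> (average of f over Q)\<^sup>2 w(upper half of Q)\<close>, which a Carleson embedding (lemma \<open>dyadic_embedding\<close>)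
controls by \<open>4 \<integral> f\<^sup>2 w\<close>. The embedding follows by induction along the dyadic tree, the induction
statement carrying an additional term in the manner of Bellman functions.

\<^bold>\<open>From the commutator to BMO.\<close> Let \<open>Q\<close> be a box over \<open>I\<close> and \<open>F\<close> the upper half of its translate by
\<open>R |I|\<close>, with \<open>R\<close> large. On \<open>Q \<times> F\<close> the kernel of \<open>T\<close> differs little from a constant, so \<open>[b,T]1\<^sub>F\<close> is nearly
a multiple of \<open>b - b\<^sub>F\<close> on \<open>Q\<close>, with an error controlled by the oscillations of \<open>b\<close> on \<open>Q\<close> and \<open>F\<close>. The same
holds with \<open>Q\<close> and \<open>F\<close> exchanged, and for a large \<open>R\<close> the errors can be absorbed. The norm of the
commutator then bounds \<open>\<integral>\<^sub>Q |b - b\<^sub>F| dM\<close> by a multiple of \<open>\<mu>(Q\<^sup>*)\<^bsup>1/2\<^esup> \<lambda>\<^bsup>-1\<^esup>(Q\<^sup>*)\<^bsup>1/2\<^esup>\<close> with a box \<open>Q\<^sup>*\<close> around both,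
and the Bekolle conditions turn this into a multiple of \<open>\<nu>(Q)\<close> (lemma \<open>two_weight_box\<close>).\<close>

section \<open>The measure of boxes\<close>

lemma space_dA [simp]: "space (dA \<alpha>) = upper_half"
  by (simp add: dA_def)

lemma sets_dA [measurable_cong]: "sets (dA \<alpha>) = sets (lebesgue_on upper_half)"
  by (simp add: dA_def)

lemma upper_half_borel [measurable]: "upper_half \<in> sets borel"
  unfolding upper_half_def by measurable

lemma measurable_ident_dA: "(\<lambda>z. z) \<in> dA \<alpha> \<rightarrow>\<^sub>M borel"
proof -
  have "(\<lambda>z. z) \<in> lebesgue_on upper_half \<rightarrow>\<^sub>M borel"
    by (intro measurable_restrict_space1) (auto intro: measurableI)
  then show ?thesis
    using measurable_cong_sets[OF sets_dA refl] by blast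
qed

lemma borel_sets_dA: "A \<in> sets borel \<Longrightarrow> A \<subseteq> upper_half \<Longrightarrow> A \<in> sets (dA \<alpha>)"
  using measurable_sets[OF measurable_ident_dA, of A \<alpha>]
  by (simp add: Int_absorb2 vimage_def Int_def) (metis Collect_mem_eq Int_absorb2 Int_commute Int_def)

lemma measurable_Complex:
  "(\<lambda>p. Complex (fst p) (snd p)) \<in> borel_measurable (lborel \<Otimes>\<^sub>M lborel)"
proof -
  have "continuous_on UNIV (\<lambda>p. Complex (fst p) (snd p))"
    by (simp add: Complex_eq, intro continuous_intros)
  then show ?thesis
    using borel_measurable_continuous_onI by (simp add: lborel_prod)
qed

text \<open>Identifies area measure with product measure, so that slabs can be measured by iterated integrals.\<close>

lemma lborel_complex_eq:
  "(lborel :: complex measure) = distr (lborel \<Otimes>\<^sub>M lborel) borel (\<lambda>p. Complex (fst p) (snd p))"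
proof (rule lborel_eqI)
  have m: "(\<lambda>p. Complex (fst p) (snd p)) \<in> borel_measurable (lborel \<Otimes>\<^sub>M lborel)"
    by (rule measurable_Complex)
  fix l u :: complex
  assume lu: "\<And>b. b \<in> Basis \<Longrightarrow> l \<bullet> b \<le> u \<bullet> b"
  have le: "Re l \<le> Re u" "Im l \<le> Im u"
    using lu[of 1] lu[of \<i>] by (auto simp: Basis_complex_def inner_complex_def)
  have "(\<lambda>p. Complex (fst p) (snd p)) -` box l u \<inter> space (lborel \<Otimes>\<^sub>M lborel)
       = {Re l <..< Re u} \<times> {Im l <..< Im u}"
    by (auto simp: box_def Basis_complex_def inner_complex_def space_pair_measure)
  then show "emeasure (distr (lborel \<Otimes>\<^sub>M lborel) borel (\<lambda>p. Complex (fst p) (snd p))) (box l u)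
      = ennreal (\<Prod>b\<in>Basis. (u - l) \<bullet> b)"
    using le by (simp add: emeasure_distr[OF m] lborel.emeasure_pair_measure_Times
        ennreal_mult Basis_complex_def inner_complex_def)
qed simp

lemma emeasure_dA:
  assumes "A \<in> sets borel" "A \<subseteq> upper_half"
  shows "emeasure (dA \<alpha>) A = (\<integral>\<^sup>+z. ennreal (1 / pi * (\<alpha> + 1) * (2 * Im z) powr \<alpha>) * indicator A z \<partial>lborel)"
proof -
  have "(\<lambda>z. ennreal (1 / pi * (\<alpha> + 1) * (2 * Im z) powr \<alpha>)) \<in> borel_measurable (lebesgue_on upper_half)"
    by (intro measurable_restrict_space1 measurable_completion) simp
  moreover have "A \<in> sets (lebesgue_on upper_half)"
    using borel_sets_dA[OF assms] sets_dA by blast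
  ultimately have "emeasure (dA \<alpha>) A
    = (\<integral>\<^sup>+z. ennreal (1 / pi * (\<alpha> + 1) * (2 * Im z) powr \<alpha>) * indicator A z \<partial>lebesgue_on upper_half)"
    unfolding dA_def by (rule emeasure_density)
  also have "\<dots> = (\<integral>\<^sup>+z. ennreal (1 / pi * (\<alpha> + 1) * (2 * Im z) powr \<alpha>) * indicator A z * indicator upper_half z \<partial>lebesgue)"
    by (rule nn_integral_restrict_space) simp
  also have "\<dots> = (\<integral>\<^sup>+z. ennreal (1 / pi * (\<alpha> + 1) * (2 * Im z) powr \<alpha>) * indicator A z * indicator upper_half z \<partial>lborel)"
    by (rule nn_integral_completion)
  also have "\<dots> = (\<integral>\<^sup>+z. ennreal (1 / pi * (\<alpha> + 1) * (2 * Im z) powr \<alpha>) * indicator A z \<partial>lborel)"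
    using assms(2) by (intro nn_integral_cong) (auto simp: indicator_def)
  finally show ?thesis .
qed

lemma nn_integral_powr_slab:
  assumes "\<alpha> > -1" "0 \<le> s" "s \<le> t"
  shows "(\<integral>\<^sup>+y. ennreal (1 / pi * (\<alpha> + 1) * (2 * y) powr \<alpha>) * indicator ({s..<t} \<inter> {0<..}) y \<partial>lborel)
       = ennreal (2 powr \<alpha> / pi * (t powr (1+\<alpha>) - s powr (1+\<alpha>)))"
proof -
  have "((\<lambda>y. (1+\<alpha>) * y powr \<alpha>) has_integral (t powr (1+\<alpha>) - s powr (1+\<alpha>))) {s..t}"
  proof (rule fundamental_theorem_of_calculus_interior)
    show "continuous_on {s..t} (\<lambda>y. y powr (1+\<alpha>))"
      using assms by (intro continuous_on_powr') (auto intro: continuous_intros)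
    show "((\<lambda>y. y powr (1+\<alpha>)) has_vector_derivative (1+\<alpha>) * y powr \<alpha>) (at y)" if "y \<in> {s<..<t}" for y
      unfolding has_real_derivative_iff_has_vector_derivative[symmetric]
      using that assms by (auto intro!: derivative_eq_intros)
  qed (use assms in auto)
  then have "((\<lambda>y. 2 powr \<alpha> / pi * ((1+\<alpha>) * y powr \<alpha>)) has_integral 2 powr \<alpha> / pi * (t powr (1+\<alpha>) - s powr (1+\<alpha>))) {s..t}"
    by (rule has_integral_mult_right)
  then have "((\<lambda>y. 1 / pi * (\<alpha> + 1) * (2 * y) powr \<alpha>) has_integral 2 powr \<alpha> / pi * (t powr (1+\<alpha>) - s powr (1+\<alpha>))) {s..t}"
    by (rule has_integral_eq[rotated]) (use assms in \<open>auto simp: powr_mult field_simps\<close>)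
  then have "(\<integral>\<^sup>+y. ennreal (indicator {s..t} y * (1 / pi * (\<alpha> + 1) * (2 * y) powr \<alpha>)) \<partial>lborel)
       = ennreal (2 powr \<alpha> / pi * (t powr (1+\<alpha>) - s powr (1+\<alpha>)))"
    using assms by (intro nn_integral_has_integral_lebesgue) (auto intro!: mult_nonneg_nonneg)
  also have "(\<integral>\<^sup>+y. ennreal (indicator {s..t} y * (1 / pi * (\<alpha> + 1) * (2 * y) powr \<alpha>)) \<partial>lborel)
     = (\<integral>\<^sup>+y. ennreal (1 / pi * (\<alpha> + 1) * (2 * y) powr \<alpha>) * indicator ({s..<t} \<inter> {0<..}) y \<partial>lborel)"
  proof (rule nn_integral_cong_AE)
    show "AE y in lborel. ennreal (indicator {s..t} y * (1 / pi * (\<alpha> + 1) * (2 * y) powr \<alpha>))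
       = ennreal (1 / pi * (\<alpha> + 1) * (2 * y) powr \<alpha>) * indicator ({s..<t} \<inter> {0<..}) y"
      using AE_lborel_singleton[of s] AE_lborel_singleton[of t] AE_lborel_singleton[of 0]
      by eventually_elim (use assms in \<open>auto simp: indicator_def\<close>)
  qed
  finally show ?thesis .
qed

definition slab :: "real \<Rightarrow> real \<Rightarrow> real \<Rightarrow> real \<Rightarrow> complex set" where
  "slab a b s t = {z. a \<le> Re z \<and> Re z < b \<and> s \<le> Im z \<and> Im z < t \<and> 0 < Im z}"

lemma slab_borel [measurable]: "slab a b s t \<in> sets borel"
  unfolding slab_def by measurable

lemma slab_subset: "slab a b s t \<subseteq> upper_half"
  by (auto simp: slab_def upper_half_def)

lemma slab_sets_dA [measurable]: "slab a b s t \<in> sets (dA \<alpha>)"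
  by (intro borel_sets_dA slab_borel slab_subset)

lemma emeasure_slab:
  assumes "\<alpha> > -1" "0 \<le> s" "s \<le> t" "a \<le> b"
  shows "emeasure (dA \<alpha>) (slab a b s t)
     = ennreal (2 powr \<alpha> / pi * (b - a) * (t powr (1+\<alpha>) - s powr (1+\<alpha>)))"
proof -
  let ?w = "\<lambda>y. ennreal (1 / pi * (\<alpha> + 1) * (2 * y) powr \<alpha>)"
  have m: "(\<lambda>p. Complex (fst p) (snd p)) \<in> borel_measurable (lborel \<Otimes>\<^sub>M lborel)"
    by (rule measurable_Complex)
  have "emeasure (dA \<alpha>) (slab a b s t) = (\<integral>\<^sup>+z. ?w (Im z) * indicator (slab a b s t) z \<partial>lborel)"
    by (rule emeasure_dA[OF slab_borel slab_subset])
  also have "\<dots> = (\<integral>\<^sup>+p. ?w (snd p) * indicator (slab a b s t) (Complex (fst p) (snd p)) \<partial>(lborel \<Otimes>\<^sub>M lborel))"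
    by (subst lborel_complex_eq, subst nn_integral_distr[OF m]) auto
  also have "\<dots> = (\<integral>\<^sup>+p. indicator {a..<b} (fst p) * (?w (snd p) * indicator ({s..<t} \<inter> {0<..}) (snd p)) \<partial>(lborel \<Otimes>\<^sub>M lborel))"
    by (intro nn_integral_cong) (auto simp: slab_def indicator_def)
  also have "\<dots> = (\<integral>\<^sup>+x. \<integral>\<^sup>+y. indicator {a..<b} x * (?w y * indicator ({s..<t} \<inter> {0<..}) y) \<partial>lborel \<partial>lborel)"
    by (subst lborel.nn_integral_fst[symmetric]) (auto)
  also have "\<dots> = (\<integral>\<^sup>+x. indicator {a..<b} x \<partial>lborel) * (\<integral>\<^sup>+y. (?w y * indicator ({s..<t} \<inter> {0<..}) y) \<partial>lborel)"
    by (subst nn_integral_cmult) (auto simp: nn_integral_multc)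
  also have "\<dots> = ennreal (b - a) * ennreal (2 powr \<alpha> / pi * (t powr (1+\<alpha>) - s powr (1+\<alpha>)))"
    using assms by (simp only: nn_integral_powr_slab[OF assms(1-3)]) simp
  also have "\<dots> = ennreal (2 powr \<alpha> / pi * (b - a) * (t powr (1+\<alpha>) - s powr (1+\<alpha>)))"
    using assms by (subst ennreal_mult[symmetric]) (auto intro!: mult_nonneg_nonneg divide_nonneg_pos powr_mono2 simp: mult_ac)
  finally show ?thesis .
qed

lemma len_atLeastLessThan: "a \<le> b \<Longrightarrow> len {a..<b} = b - a"
  by (simp add: len_def)

lemma carleson_eq_slab: "a \<le> b \<Longrightarrow> carleson {a..<b} = slab a b 0 (b - a)"
  by (auto simp: carleson_def slab_def len_atLeastLessThan)

lemma emeasure_carleson: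
  assumes "\<alpha> > -1" "a \<le> b"
  shows "emeasure (dA \<alpha>) (carleson {a..<b}) = ennreal (2 powr \<alpha> / pi * (b - a) powr (2 + \<alpha>))"
proof -
  have "(b - a) powr (2 + \<alpha>) = (b - a) * (b - a) powr (1 + \<alpha>)"
    using powr_add[of "b - a" 1 "1 + \<alpha>"] assms by (cases "a = b") (auto simp: add_ac)
  then show ?thesis
    using assms emeasure_slab[of \<alpha> 0 "b-a" a b] by (simp add: carleson_eq_slab mult_ac)
qed

text \<open>An exhaustion of the half plane by sets of finite measure that stay away from the boundary.\<close>

definition cutoff :: "nat \<Rightarrow> complex set" where
  "cutoff n = slab (- real n) (real n) (1 / (real n + 1)) (real n + 1)"

lemma cutoff_sets [measurable]: "cutoff n \<in> sets (dA \<alpha>)" "cutoff n \<in> sets borel"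
  by (auto simp: cutoff_def)

lemma cutoff_subset: "cutoff n \<subseteq> upper_half"
  by (simp add: cutoff_def slab_subset)

lemma emeasure_cutoff_finite: "\<alpha> > -1 \<Longrightarrow> emeasure (dA \<alpha>) (cutoff n) < \<infinity>"
  unfolding cutoff_def by (subst emeasure_slab) (auto simp: field_simps)

lemma incseq_cutoff: "incseq cutoff"
proof (intro monoI subsetI)
  fix m n :: nat and z assume mn: "m \<le> n" and z: "z \<in> cutoff m"
  have "1 / (real n + 1) \<le> 1 / (real m + 1)"
    using mn by (intro divide_left_mono) auto
  then show "z \<in> cutoff n" using z mn
    by (auto simp: cutoff_def slab_def)
qed

lemma UN_cutoff: "(\<Union>n. cutoff n) = upper_half"
proof
  show "(\<Union>n. cutoff n) \<subseteq> upper_half" using cutoff_subset by auto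
  show "upper_half \<subseteq> (\<Union>n. cutoff n)"
  proof
    fix z assume "z \<in> upper_half"
    then have y: "Im z > 0" by (simp add: upper_half_def)
    obtain n where n: "real n > max (\<bar>Re z\<bar>) (max (Im z) (1 / Im z))"
      using reals_Archimedean2 by blast
    then have "1 / Im z < real n + 1" by simp
    then have "1 / (real n + 1) \<le> Im z" using y by (simp add: field_simps)
    then have "z \<in> cutoff n" using n y by (auto simp: cutoff_def slab_def)
    then show "z \<in> (\<Union>n. cutoff n)" by blast
  qed
qed

lemma sigma_finite_dA: "\<alpha> > -1 \<Longrightarrow> sigma_finite_measure (dA \<alpha>)"
  by (rule sigma_finite_measure.intro, rule exI[of _ "range cutoff"])
     (use emeasure_cutoff_finite UN_cutoff in \<open>auto simp: less_top[symmetric]\<close>)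

section \<open>Geometry of the half plane\<close>

text \<open>The distance from \<open>z\<close> to the mirror image of \<open>w\<close>. It is comparable to the side of the smallest
Carleson box containing both points and satisfies the triangle inequality, although \<open>d(z,z) > 0\<close>.\<close>

definition hdist :: "complex \<Rightarrow> complex \<Rightarrow> real" where
  "hdist z w = cmod (z - cnj w)"

lemma hdist_commute: "hdist z w = hdist w z"
proof -
  have "cmod (z - cnj w) = cmod (cnj (z - cnj w))" by (simp only: complex_mod_cnj)
  also have "\<dots> = cmod (cnj z - w)" by simp
  finally show ?thesis by (simp add: hdist_def norm_minus_commute)
qed

text \<open>Reflecting one of two points of the half plane in its boundary can only move it further away.\<close>

lemma dist_le_hdist:
  assumes "z \<in> upper_half" "w \<in> upper_half"
  shows "cmod (z - w) \<le> hdist z w"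
proof -
  have "(Im z - Im w)\<^sup>2 \<le> (Im z + Im w)\<^sup>2"
    using assms unfolding upper_half_def by (intro power2_le_iff_abs_le[THEN iffD2]) auto
  then show ?thesis
    unfolding hdist_def cmod_def by (intro real_sqrt_le_mono) simp
qed

lemma hdist_triangle:
  assumes "v \<in> upper_half" "w \<in> upper_half"
  shows "hdist z w \<le> hdist z v + hdist v w"
proof -
  have "hdist z w \<le> cmod (z - cnj v) + cmod (cnj (v - w))"
    using norm_triangle_ineq[of "z - cnj v" "cnj (v - w)"] by (simp add: hdist_def)
  then show ?thesis using dist_le_hdist[OF assms] by (simp only: complex_mod_cnj hdist_def)
qed

lemma Im_le_hdist: "Im z + Im w \<le> hdist z w"
  using abs_Im_le_cmod[of "z - cnj w"] by (simp add: hdist_def)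

lemma Re_le_hdist: "\<bar>Re z - Re w\<bar> \<le> hdist z w"
  using abs_Re_le_cmod[of "z - cnj w"] by (simp add: hdist_def)

lemma hdist_le: "hdist z w \<le> \<bar>Re z - Re w\<bar> + \<bar>Im z + Im w\<bar>"
  using cmod_le[of "z - cnj w"] by (simp add: hdist_def)

lemma hdist_pos: "z \<in> upper_half \<Longrightarrow> w \<in> upper_half \<Longrightarrow> hdist z w > 0"
  using Im_le_hdist[of z w] by (simp add: upper_half_def)

section \<open>Dyadic systems\<close>

lemma dyadic_systemD:
  assumes "dyadic_system D"
  shows "\<forall>I\<in>D. \<exists>a. \<exists>j::int. I = {a..<a + 2 powi j}"
    and "\<forall>j::int. \<forall>x. \<exists>!I. I \<in> D \<and> len I = 2 powi j \<and> x \<in> I"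
    and "\<forall>I\<in>D. \<forall>J\<in>D. I \<inter> J = {} \<or> I \<subseteq> J \<or> J \<subseteq> I"
  by (rule assms[unfolded dyadic_system_def, THEN conjunct1]
           assms[unfolded dyadic_system_def, THEN conjunct2, THEN conjunct1]
           assms[unfolded dyadic_system_def, THEN conjunct2, THEN conjunct2])+

lemma dyadicE:
  assumes "dyadic_system D" "I \<in> D"
  obtains a b j where "I = {a..<b}" "a < b" "b - a = 2 powi j" "len I = 2 powi j"
proof -
  obtain a and j::int where I: "I = {a..<a + 2 powi j}"
    using dyadic_systemD(1)[OF assms(1)] assms(2) by blast
  have "(2::real) powi j > 0" by simp
  then show ?thesis
    using that[of a "a + 2 powi j" j] by (simp add: I len_atLeastLessThan)
qed

lemma dyadicE':
  assumes "dyadic_system D" "I \<in> D"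
  obtains a b where "I = {a..<b}" "a < b"
  using dyadicE[OF assms] by metis

lemma dyadic_ex1:
  assumes "dyadic_system D"
  shows "\<exists>!I. I \<in> D \<and> len I = 2 powi j \<and> x \<in> I"
  using dyadic_systemD(2)[OF assms] by (elim allE)

lemma dyadic_nest:
  assumes D: "dyadic_system D" and "I \<in> D" "J \<in> D" "x \<in> I" "x \<in> J" "len I \<le> len J"
  shows "I \<subseteq> J"
proof -
  have "I \<inter> J = {} \<or> I \<subseteq> J \<or> J \<subseteq> I"
    using dyadic_systemD(3)[OF D] assms(2,3) by metis
  moreover have "I = J" if "J \<subseteq> I"
  proof -
    obtain a b j where I: "I = {a..<b}" "a < b" "b - a = 2 powi j" "len I = 2 powi j"
      using dyadicE[OF D assms(2)] .
    obtain c d k where J: "J = {c..<d}" "c < d" "d - c = 2 powi k" "len J = 2 powi k"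
      using dyadicE[OF D assms(3)] .
    have "a \<le> c" "d \<le> b" using that I J by auto
    then have "len J = len I" using I J assms(6) by linarith
    then have "len J = 2 powi j" using I by simp
    then show ?thesis
      using dyadic_ex1[OF D, of j x] assms(2-5) I(4) by (elim ex1E) metis
  qed
  ultimately show ?thesis using assms by blast
qed

lemma dyadic_eq_or_disjoint:
  assumes D: "dyadic_system D" and "I \<in> D" "J \<in> D" "len I = len J" "x \<in> I" "x \<in> J"
  shows "I = J"
  using dyadic_nest[OF D assms(2,3) assms(5,6)] dyadic_nest[OF D assms(3,2) assms(6,5)] assms(4) by auto

text \<open>The definition of a dyadic system asks for nestedness and for one interval per scale and point. The interval of
the next finer scale around the left end point lies in \<open>[a,b)\<close>, so it begins at \<open>a\<close>; the one around
the midpoint cannot begin earlier, as it would then meet and hence equal the first one.\<close>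

lemma dyadic_halves:
  assumes D: "dyadic_system D" and I: "{a..<b} \<in> D" and ab: "a < b"
  shows "{a..<(a+b)/2} \<in> D" "{(a+b)/2..<b} \<in> D"
proof -
  let ?m = "(a+b)/2"
  obtain a' b' j where ab': "{a..<b} = {a'..<b'}" "a' < b'" "b' - a' = 2 powi j"
    using dyadicE[OF D I] by metis
  have "a = a'" "b = b'" using ab' ab by (auto simp: Ico_eq_Ico)
  then have j: "b - a = 2 powi j" using ab' by simp
  have "(2::real) powi j = 2 * 2 powi (j - 1)"
    by (simp add: power_int_diff)
  then have half: "2 powi (j - 1) = (b - a) / 2" using j by simp
  have child: "\<exists>c. {c..<c+(b-a)/2} \<in> D \<and> x \<in> {c..<c+(b-a)/2} \<and> {c..<c+(b-a)/2} \<subseteq> {a..<b}"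
    if x: "x \<in> {a..<b}" for x
  proof -
    obtain K where K: "K \<in> D" "len K = 2 powi (j-1)" "x \<in> K"
      using dyadic_ex1[OF D, of "j-1" x] by blast
    obtain c d i where cd: "K = {c..<d}" "c < d" "d - c = 2 powi i" "len K = 2 powi i"
      using dyadicE[OF D K(1)] .
    then have "d - c = (b-a)/2" using K(2) half by linarith
    then have "d = c + (b-a)/2" by linarith
    moreover have "K \<subseteq> {a..<b}"
      by (rule dyadic_nest[OF D K(1) I K(3) x]) (use K half ab in \<open>simp add: len_atLeastLessThan\<close>)
    ultimately show ?thesis using K cd by blast
  qed
  obtain c where c: "{c..<c+(b-a)/2} \<in> D" "a \<in> {c..<c+(b-a)/2}" "{c..<c+(b-a)/2} \<subseteq> {a..<b}"
    using child[of a] ab by auto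
  have "c = a" using c ab by auto
  have mid: "a + (b-a)/2 = ?m" by (simp add: field_simps)
  show left: "{a..<?m} \<in> D" using c(1) unfolding \<open>c = a\<close> mid .
  obtain e where e: "{e..<e+(b-a)/2} \<in> D" "?m \<in> {e..<e+(b-a)/2}" "{e..<e+(b-a)/2} \<subseteq> {a..<b}"
    using child[of ?m] ab by auto
  have "e = ?m"
  proof (rule ccontr)
    assume "e \<noteq> ?m"
    then have "a \<le> e" "e < ?m" using e ab by auto
    then have "{a..<?m} = {e..<e+(b-a)/2}"
      using mid ab by (intro dyadic_eq_or_disjoint[OF D left e(1), of e]) (auto simp: len_atLeastLessThan field_simps)
    moreover have "?m \<notin> {a..<?m}" by simp
    ultimately show False using e(2) by simp
  qed
  have right: "?m + (b-a)/2 = b" by (simp add: field_simps)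
  show "{?m..<b} \<in> D" using e(1) unfolding \<open>e = ?m\<close> right .
qed

text \<open>An interval inside \<open>[a,b)\<close> longer than its half begins at \<open>a\<close> and then swallows the right half too.\<close>

lemma dyadic_proper_subset:
  assumes D: "dyadic_system D" and I: "{a..<b} \<in> D" and ab: "a < b"
    and J: "J \<in> D" "J \<subseteq> {a..<b}" "J \<noteq> {a..<b}"
  shows "J \<subseteq> {a..<(a+b)/2} \<or> J \<subseteq> {(a+b)/2..<b}"
proof -
  let ?m = "(a+b)/2"
  obtain c d where cd: "J = {c..<d}" "c < d"
    using dyadicE'[OF D J(1)] .
  have c: "a \<le> c" "d \<le> b" using cd J by auto
  have l: "len J = d - c" "len {a..<?m} = (b-a)/2" "len {?m..<b} = (b-a)/2"
    using ab cd by (simp_all add: len_atLeastLessThan field_simps)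
  note halves = dyadic_halves[OF D I ab]
  show ?thesis
  proof (cases "?m \<le> c")
    case True
    then have "J \<subseteq> {?m..<b}" using c cd by auto
    then show ?thesis ..
  next
    case False
    show ?thesis
    proof (cases "len J \<le> len {a..<?m}")
      case True
      have "J \<subseteq> {a..<?m}"
        using cd c False by (intro dyadic_nest[OF D J(1) halves(1) _ _ True, of c]) auto
      then show ?thesis ..
    next
      case long: False
      have "{a..<?m} \<subseteq> J"
        using cd c False long by (intro dyadic_nest[OF D halves(1) J(1), of c]) auto
      then have "c = a" using c cd ab by (simp add: atLeastLessThan_subset_iff)
      have "?m < d" using long l \<open>c = a\<close> by (simp add: field_simps)
      then have "{?m..<b} \<subseteq> J"
        using cd c False long l ab by (intro dyadic_nest[OF D halves(2) J(1), of ?m]) auto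
      then have "b \<le> d" using cd ab by (simp add: atLeastLessThan_subset_iff)
      then have "J = {a..<b}" using \<open>c = a\<close> cd c by simp
      then show ?thesis using J by simp
    qed
  qed
qed

text \<open>An interval of the system is determined by its scale and a rational point that it contains.\<close>

lemma countable_dyadic:
  assumes D: "dyadic_system D"
  shows "countable D"
proof -
  define f where "f = (\<lambda>p. THE I. I \<in> D \<and> len I = 2 powi fst p \<and> real_of_rat (snd p) \<in> I)"
  have "D \<subseteq> range f"
  proof
    fix I assume I: "I \<in> D"
    obtain a b j where ab: "I = {a..<b}" "a < b" "b - a = 2 powi j" "len I = 2 powi j"
      using dyadicE[OF D I] .
    obtain q where q: "a < of_rat q" "of_rat q < b" using ab(2) of_rat_dense by blast
    have "I \<in> D \<and> len I = 2 powi j \<and> real_of_rat q \<in> I"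
      by (intro conjI I ab(4)) (simp add: ab(1) q less_imp_le)
    then have "f (j, q) = I"
      unfolding f_def fst_conv snd_conv by (rule the1_equality[OF dyadic_ex1[OF D]])
    then show "I \<in> range f" by (metis rangeI)
  qed
  then show ?thesis by (rule countable_subset) simp
qed

lemma infinite_dyadic:
  assumes D: "dyadic_system D"
  shows "infinite D"
proof
  assume fin: "finite D"
  have "2 ^ n \<in> len ` D" for n :: nat
  proof -
    obtain I where "I \<in> D" "len I = 2 powi int n"
      using ex1_implies_ex[OF dyadic_ex1[OF D, of "int n" 0]] by (elim exE conjE)
    then show ?thesis by (simp add: rev_image_eqI)
  qed
  then have "range (\<lambda>n::nat. (2::real) ^ n) \<subseteq> len ` D" by (intro image_subsetI)
  then have "finite (range (\<lambda>n::nat. (2::real) ^ n))" using fin finite_surj by blast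
  moreover have "inj (\<lambda>n::nat. (2::real) ^ n)" by (intro injI) simp
  ultimately show False using finite_imageD infinite_UNIV_nat by blast
qed

section \<open>A Carleson embedding on dyadic trees\<close>

text \<open>The first \<open>n\<close> generations below \<open>I\<close>, expressed through lengths.\<close>

definition descendants :: "real set set \<Rightarrow> real set \<Rightarrow> nat \<Rightarrow> real set set" where
  "descendants D I n = {J \<in> D. J \<subseteq> I \<and> len I \<le> 2 ^ n * len J}"

lemma descendants_0:
  assumes D: "dyadic_system D" and I: "I \<in> D"
  shows "descendants D I 0 = {I}"
proof -
  obtain a b where ab: "I = {a..<b}" "a < b"
    using dyadicE'[OF D I] .
  have "J = I" if J: "J \<in> D" "J \<subseteq> I" "len I \<le> len J" for J
  proof -
    obtain c d where cd: "J = {c..<d}" "c < d"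
      using dyadicE'[OF D J(1)] .
    then show ?thesis using J ab by (auto simp: len_atLeastLessThan)
  qed
  then show ?thesis using I by (auto simp: descendants_def)
qed

lemma descendants_Suc:
  assumes D: "dyadic_system D" and I: "{a..<b} \<in> D" and ab: "a < b"
  shows "descendants D {a..<b} (Suc n) = insert {a..<b} (descendants D {a..<(a+b)/2} n \<union> descendants D {(a+b)/2..<b} n)"
proof -
  have l: "len {a..<b} = b - a" "len {a..<(a+b)/2} = (b-a)/2" "len {(a+b)/2..<b} = (b-a)/2"
    using ab by (auto simp: len_atLeastLessThan field_simps)
  have sub: "{a..<(a+b)/2} \<subseteq> {a..<b}" "{(a+b)/2..<b} \<subseteq> {a..<b}" using ab by auto
  have *: "J \<in> descendants D {a..<b} (Suc n)" if "J \<in> descendants D H n" "H = {a..<(a+b)/2} \<or> H = {(a+b)/2..<b}" for J H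
    using that sub l by (auto simp: descendants_def field_simps)
  have "(1::real) \<le> 2 ^ Suc n" by (rule one_le_power) simp
  then have "1 * (b - a) \<le> 2 ^ Suc n * (b - a)" using ab by (intro mult_right_mono) auto
  then have "{a..<b} \<in> descendants D {a..<b} (Suc n)" using I l by (simp add: descendants_def)
  moreover have "J \<in> descendants D {a..<(a+b)/2} n \<union> descendants D {(a+b)/2..<b} n"
    if "J \<in> descendants D {a..<b} (Suc n)" "J \<noteq> {a..<b}" for J
    using dyadic_proper_subset[OF D I ab, of J] that l by (auto simp: descendants_def field_simps)
  ultimately show ?thesis using * by blast
qed

lemma finite_descendants:
  assumes D: "dyadic_system D" and I: "I \<in> D"
  shows "finite (descendants D I n)"
  using I
proof (induction n arbitrary: I)
  case 0 then show ?case by (simp add: descendants_0[OF D])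
next
  case (Suc n)
  obtain a b where ab: "I = {a..<b}" "a < b"
    using dyadicE'[OF D Suc(2)] .
  then show ?case
    using Suc dyadic_halves[OF D, of a b] descendants_Suc[OF D, of a b n] by auto
qed

text \<open>Convexity of \<open>(x, a) \<mapsto> x\<^sup>2 / a\<close>, in the form known as Titu's or Sedrakyan's inequality.\<close>

lemma sq_divide_add_le:
  fixes x y a b :: real
  assumes "a > 0" "b > 0"
  shows "(x + y)\<^sup>2 / (a + b) \<le> x\<^sup>2 / a + y\<^sup>2 / b"
proof -
  have "x\<^sup>2 / a + y\<^sup>2 / b - (x + y)\<^sup>2 / (a + b) = (b * x - a * y)\<^sup>2 / (a * b * (a + b))"
    using assms by (simp add: divide_simps add_pos_pos less_imp_neq[symmetric]) (simp add: algebra_simps power2_eq_square)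
  also have "\<dots> \<ge> 0" using assms by simp
  finally show ?thesis by simp
qed

text \<open>The inequality that lets the induction over generations close. The two children contribute their
induction hypotheses, the upper half of the box contributes \<open>F0\<^sup>2 \<le> G0 m\<close>. Convexity is applied
with \<open>m/2\<close> in place of \<open>m\<close>: this leaves the denominator \<open>S - m/2\<close>, and
\<open>1/(S - m/2) \<ge> 1/S + m/(2 S\<^sup>2)\<close> produces exactly the new summand \<open>(F/S)\<^sup>2 m\<close>.\<close>

lemma bellman_step:
  fixes F0 F1 F2 m S1 S2 G0 G1 G2 :: real
  assumes "m > 0" "S1 > 0" "S2 > 0" and F0: "F0\<^sup>2 \<le> G0 * m"
  defines "F \<equiv> F0 + F1 + F2" and "S \<equiv> m + S1 + S2"
  shows "(F / S)\<^sup>2 * m + (4 * G1 - 2 * F1\<^sup>2 / S1) + (4 * G2 - 2 * F2\<^sup>2 / S2)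
       \<le> 4 * (G0 + G1 + G2) - 2 * F\<^sup>2 / S"
proof -
  have S: "S > 0" "S - m / 2 > 0" using assms by (auto simp: S_def)
  have "F\<^sup>2 / (S - m/2) = (F0 + (F1 + F2))\<^sup>2 / (m / 2 + (S1 + S2))"
    by (simp add: F_def S_def add_ac)
  also have "\<dots> \<le> F0\<^sup>2 / (m/2) + (F1 + F2)\<^sup>2 / (S1 + S2)"
    using assms by (intro sq_divide_add_le) auto
  also have "\<dots> \<le> F0\<^sup>2 / (m/2) + (F1\<^sup>2 / S1 + F2\<^sup>2 / S2)"
    using assms by (intro add_left_mono sq_divide_add_le) auto
  finally have 1: "F\<^sup>2 / (S - m/2) \<le> F0\<^sup>2 / (m/2) + F1\<^sup>2 / S1 + F2\<^sup>2 / S2" by simp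
  have "1 / S + m / (2 * S\<^sup>2) \<le> 1 / (S - m/2)"
  proof -
    have "(S + m/2) * (S - m/2) \<le> S\<^sup>2" by (simp add: algebra_simps power2_eq_square)
    then have "(S + m/2) / S\<^sup>2 \<le> 1 / (S - m/2)" using S by (simp add: field_simps)
    moreover have "(S + m/2) / S\<^sup>2 = 1 / S + m / (2 * S\<^sup>2)"
      using S by (simp add: field_simps power2_eq_square)
    ultimately show ?thesis by simp
  qed
  then have "F\<^sup>2 * (1 / S + m / (2 * S\<^sup>2)) \<le> F\<^sup>2 * (1 / (S - m/2))"
    by (intro mult_left_mono) auto
  then have 2: "F\<^sup>2 / S + (F/S)\<^sup>2 * m / 2 \<le> F\<^sup>2 / (S - m/2)"
    by (simp add: field_simps power_divide)
  have 3: "F0\<^sup>2 / (m/2) \<le> 2 * G0" using F0 assms by (simp add: field_simps)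
  have 4: "2 * F1\<^sup>2 / S1 = 2 * (F1\<^sup>2 / S1)" "2 * F2\<^sup>2 / S2 = 2 * (F2\<^sup>2 / S2)" "2 * F\<^sup>2 / S = 2 * (F\<^sup>2 / S)"
    by simp_all
  from 1 2 3 show ?thesis unfolding 4 distrib_left by linarith
qed

text \<open>Without the term \<open>- 2 (F I)\<^sup>2 / S I\<close> the bound would not be inductive. The letters stand for
\<open>F = \<integral> f w\<close>, \<open>S = \<integral> w\<close>, \<open>G = \<integral> f\<^sup>2 w\<close> over the box above an interval, and \<open>m\<close> for the \<open>w\<close>-mass
of the upper half of that box.\<close>

lemma tree_embedding:
  fixes F G S m :: "real set \<Rightarrow> real"
  assumes D: "dyadic_system D"
    and S: "\<And>I. I \<in> D \<Longrightarrow> S I > 0"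
    and m: "\<And>I. I \<in> D \<Longrightarrow> m I > 0"
    and cs: "\<And>I. I \<in> D \<Longrightarrow> (F I)\<^sup>2 \<le> G I * S I"
    and split: "\<And>a b. {a..<b} \<in> D \<Longrightarrow> a < b \<Longrightarrow> \<exists>F0 G0. F0\<^sup>2 \<le> G0 * m {a..<b} \<and>
        F {a..<b} = F0 + F {a..<(a+b)/2} + F {(a+b)/2..<b} \<and>
        G {a..<b} = G0 + G {a..<(a+b)/2} + G {(a+b)/2..<b} \<and>
        S {a..<b} = m {a..<b} + S {a..<(a+b)/2} + S {(a+b)/2..<b}"
    and I: "I \<in> D"
  shows "(\<Sum>J\<in>descendants D I n. (F J / S J)\<^sup>2 * m J) \<le> 4 * G I - 2 * (F I)\<^sup>2 / S I"
  using I
proof (induction n arbitrary: I)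
  case 0
  obtain a b where ab: "I = {a..<b}" "a < b"
    using dyadicE'[OF D 0] .
  have "m I \<le> S I"
    using split[of a b] 0 ab S[OF dyadic_halves(1)[OF D, of a b]] S[OF dyadic_halves(2)[OF D, of a b]] by force
  then have "(F I / S I)\<^sup>2 * m I \<le> (F I / S I)\<^sup>2 * S I" by (intro mult_left_mono) auto
  also have "\<dots> = (F I)\<^sup>2 / S I" using S[OF 0] by (simp add: field_simps power2_eq_square)
  finally have "(F I / S I)\<^sup>2 * m I \<le> (F I)\<^sup>2 / S I" .
  moreover have "(F I)\<^sup>2 / S I \<le> G I" using cs[OF 0] S[OF 0] by (simp add: field_simps)
  moreover have "(F I)\<^sup>2 / S I \<ge> 0" using S[OF 0] by simp
  ultimately show ?case by (simp add: descendants_0[OF D 0])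
next
  case (Suc n)
  obtain a b where ab: "I = {a..<b}" "a < b"
    using dyadicE'[OF D Suc(2)] .
  let ?l = "{a..<(a+b)/2}" and ?r = "{(a+b)/2..<b}"
  have lr: "?l \<in> D" "?r \<in> D" using dyadic_halves[OF D, of a b] Suc(2) ab by auto
  obtain F0 G0 where 0: "F0\<^sup>2 \<le> G0 * m I" "F I = F0 + F ?l + F ?r"
    "G I = G0 + G ?l + G ?r" "S I = m I + S ?l + S ?r"
    using split[of a b] Suc(2) ab by auto
  have ne: "I \<notin> descendants D ?l n \<union> descendants D ?r n" using ab by (auto simp: descendants_def)
  have disj: "descendants D ?l n \<inter> descendants D ?r n = {}"
  proof -
    have "J \<noteq> {}" if "J \<in> D" for J
      by (rule dyadicE'[OF D that]) simp
    moreover have "?l \<inter> ?r = {}" by auto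
    ultimately show ?thesis unfolding descendants_def by blast
  qed
  have "(\<Sum>J\<in>descendants D I (Suc n). (F J / S J)\<^sup>2 * m J) = (F I / S I)\<^sup>2 * m I
      + (\<Sum>J\<in>descendants D ?l n. (F J / S J)\<^sup>2 * m J) + (\<Sum>J\<in>descendants D ?r n. (F J / S J)\<^sup>2 * m J)"
    using ne disj lr ab descendants_Suc[OF D, of a b n] Suc(2) finite_descendants[OF D]
    by (simp add: sum.union_disjoint)
  also have "\<dots> \<le> (F I / S I)\<^sup>2 * m I + (4 * G ?l - 2 * (F ?l)\<^sup>2 / S ?l) + (4 * G ?r - 2 * (F ?r)\<^sup>2 / S ?r)"
    using Suc.IH[OF lr(1)] Suc.IH[OF lr(2)] by simp
  also have "\<dots> \<le> 4 * G I - 2 * (F I)\<^sup>2 / S I"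
    unfolding 0(2-4) using bellman_step[of "m I" "S ?l" "S ?r" F0 G0 "F ?l" "F ?r" "G ?l" "G ?r"] S m lr Suc(2) 0(1) by simp
  finally show ?case .
qed

text \<open>A finite family is covered by trees below its ancestors of one common scale; these ancestors are
disjoint, so that the bounds for the single trees add up.\<close>

lemma dyadic_embedding:
  fixes F G S m :: "real set \<Rightarrow> real"
  assumes D: "dyadic_system D"
    and S: "\<And>I. I \<in> D \<Longrightarrow> S I > 0"
    and m: "\<And>I. I \<in> D \<Longrightarrow> m I > 0"
    and cs: "\<And>I. I \<in> D \<Longrightarrow> (F I)\<^sup>2 \<le> G I * S I"
    and split: "\<And>a b. {a..<b} \<in> D \<Longrightarrow> a < b \<Longrightarrow> \<exists>F0 G0. F0\<^sup>2 \<le> G0 * m {a..<b} \<and>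
        F {a..<b} = F0 + F {a..<(a+b)/2} + F {(a+b)/2..<b} \<and>
        G {a..<b} = G0 + G {a..<(a+b)/2} + G {(a+b)/2..<b} \<and>
        S {a..<b} = m {a..<b} + S {a..<(a+b)/2} + S {(a+b)/2..<b}"
    and tot: "\<And>R. finite R \<Longrightarrow> R \<subseteq> D \<Longrightarrow> disjoint R \<Longrightarrow> (\<Sum>I\<in>R. G I) \<le> T"
    and A: "finite A" "A \<subseteq> D"
  shows "(\<Sum>I\<in>A. (F I / S I)\<^sup>2 * m I) \<le> 4 * T"
proof -
  have "\<forall>I\<in>A. \<exists>j. len I = 2 powi j" using dyadicE[OF D] A by (metis subsetD)
  then obtain lev where lev: "\<And>I. I \<in> A \<Longrightarrow> len I = 2 powi lev I" by metis
  define N where "N = Max (insert 0 (lev ` A))"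
  define n where "n = nat (N - Min (insert 0 (lev ` A)))"
  have N: "lev I \<le> N" "N - int n \<le> lev I" if "I \<in> A" for I
  proof -
    show "lev I \<le> N" using that A by (auto simp: N_def)
    have "Min (insert 0 (lev ` A)) \<le> lev I" using that A by auto
    then show "N - int n \<le> lev I" unfolding n_def by linarith
  qed
  have "\<exists>R\<in>D. len R = 2 powi N \<and> I \<subseteq> R" if I: "I \<in> A" for I
  proof -
    have ID: "I \<in> D" using I A by auto
    obtain x where x: "x \<in> I"
      by (rule dyadicE'[OF D ID]) (metis atLeastLessThan_iff order_refl)
    obtain R where R: "R \<in> D" "len R = 2 powi N" "x \<in> R" using dyadic_ex1[OF D] by blast
    have "I \<subseteq> R" using lev[OF I] R N(1)[OF I]
      by (intro dyadic_nest[OF D ID R(1) x R(3)]) (auto intro: power_int_increasing)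
    then show ?thesis using R by blast
  qed
  then obtain anc where anc: "\<And>I. I \<in> A \<Longrightarrow> anc I \<in> D \<and> len (anc I) = 2 powi N \<and> I \<subseteq> anc I" by metis
  have sub: "{I \<in> A. anc I = R} \<subseteq> descendants D R n" for R
  proof
    fix I assume "I \<in> {I \<in> A. anc I = R}"
    then have I: "I \<in> A" "anc I = R" by auto
    have "(2::real) powi N \<le> 2 powi (int n + lev I)"
      using N(2)[OF I(1)] by (intro power_int_increasing) auto
    also have "\<dots> = 2 ^ n * len I" using lev[OF I(1)] by (simp add: power_int_add)
    finally show "I \<in> descendants D R n" using anc[OF I(1)] I A by (auto simp: descendants_def)
  qed
  have disj: "disjoint (anc ` A)"
    unfolding disjoint_def using dyadic_eq_or_disjoint[OF D] anc by (metis disjoint_iff imageE)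
  have RD: "anc ` A \<subseteq> D" using anc by auto
  have pos: "(F J / S J)\<^sup>2 * m J \<ge> 0" if "J \<in> D" for J using m[OF that] by simp
  have "(\<Sum>I\<in>A. (F I / S I)\<^sup>2 * m I) = (\<Sum>R\<in>anc ` A. \<Sum>I | I \<in> A \<and> anc I = R. (F I / S I)\<^sup>2 * m I)"
    by (rule sum.image_gen[OF A(1)])
  also have "\<dots> \<le> (\<Sum>R\<in>anc ` A. \<Sum>I\<in>descendants D R n. (F I / S I)\<^sup>2 * m I)"
  proof (intro sum_mono sum_mono2)
    fix R assume "R \<in> anc ` A"
    then show "finite (descendants D R n)" using finite_descendants[OF D] RD by auto
  qed (use sub pos in \<open>auto simp: descendants_def\<close>)
  also have "\<dots> \<le> (\<Sum>R\<in>anc ` A. 4 * G R)"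
  proof (intro sum_mono)
    fix R assume "R \<in> anc ` A"
    then have R: "R \<in> D" using RD by auto
    have "(\<Sum>I\<in>descendants D R n. (F I / S I)\<^sup>2 * m I) \<le> 4 * G R - 2 * (F R)\<^sup>2 / S R"
      by (rule tree_embedding[OF D S m cs split R])
    also have "\<dots> \<le> 4 * G R" using S[OF R] by simp
    finally show "(\<Sum>I\<in>descendants D R n. (F I / S I)\<^sup>2 * m I) \<le> 4 * G R" .
  qed
  also have "\<dots> = 4 * (\<Sum>R\<in>anc ` A. G R)" by (simp add: sum_distrib_left)
  also have "\<dots> \<le> 4 * T" using tot[of "anc ` A"] A RD disj by auto
  finally show ?thesis .
qed

section \<open>Bekolle weights\<close>

definition kern :: "real \<Rightarrow> complex \<Rightarrow> complex \<Rightarrow> real" where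
  "kern \<alpha> z w = hdist z w powr (- (2 + \<alpha>))"

definition posop :: "real \<Rightarrow> (complex \<Rightarrow> ennreal) \<Rightarrow> complex \<Rightarrow> ennreal" where
  "posop \<alpha> \<phi> z = (\<integral>\<^sup>+w. ennreal (kern \<alpha> z w) * \<phi> w \<partial>dA \<alpha>)"

definition tophalf :: "real set \<Rightarrow> complex set" where
  "tophalf I = {z \<in> carleson I. len I / 2 \<le> Im z}"

lemma measurable_fst_dA [measurable]: "fst \<in> borel_measurable (dA \<alpha> \<Otimes>\<^sub>M N)"
  using measurable_compose[OF measurable_fst measurable_ident_dA] .

lemma measurable_snd_dA [measurable]: "snd \<in> borel_measurable (N \<Otimes>\<^sub>M dA \<alpha>)"
  using measurable_compose[OF measurable_snd measurable_ident_dA] .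

lemma measurable_cnj [measurable (raw)]:
  "f \<in> borel_measurable N \<Longrightarrow> (\<lambda>x. cnj (f x)) \<in> borel_measurable N"
  by (rule measurable_compose[OF _ borel_measurable_continuous_onI[OF continuous_on_cnj[OF continuous_on_id]]])

lemma measurable_hdist [measurable (raw)]:
  "f \<in> borel_measurable N \<Longrightarrow> g \<in> borel_measurable N \<Longrightarrow> (\<lambda>x. hdist (f x) (g x)) \<in> borel_measurable N"
proof -
  assume [measurable]: "f \<in> borel_measurable N" "g \<in> borel_measurable N"
  have [measurable]: "(\<lambda>x. cnj (g x)) \<in> borel_measurable N" by (rule measurable_cnj) fact
  show "(\<lambda>x. hdist (f x) (g x)) \<in> borel_measurable N" unfolding hdist_def by measurable
qed

lemma measurable_kern [measurable (raw)]:
  "f \<in> borel_measurable N \<Longrightarrow> g \<in> borel_measurable N \<Longrightarrow> (\<lambda>x. kern \<alpha> (f x) (g x)) \<in> borel_measurable N"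
  unfolding kern_def by measurable

lemma measurable_kern_section [measurable]: "kern \<alpha> z \<in> borel_measurable (dA \<beta>)"
  by (rule measurable_kern[OF measurable_const measurable_ident_dA]) simp

lemma kern_nonneg [simp]: "kern \<alpha> z w \<ge> 0"
  by (simp add: kern_def)

lemma kern_commute: "kern \<alpha> z w = kern \<alpha> w z"
  by (simp add: kern_def hdist_commute)

lemma carleson_half_open: "a < b \<Longrightarrow> carleson {a..<b} = slab a b 0 (b - a)"
  by (simp add: carleson_eq_slab)

lemma tophalf_half_open: "a < b \<Longrightarrow> tophalf {a..<b} = slab a b ((b - a) / 2) (b - a)"
  by (auto simp: tophalf_def carleson_half_open slab_def len_atLeastLessThan)

text \<open>The tree structure of boxes: the lower half of a box is the union of the boxes over the two halves of
its base.\<close>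

lemma carleson_split:
  assumes "a < b"
  shows "carleson {a..<b} = tophalf {a..<b} \<union> (carleson {a..<(a+b)/2} \<union> carleson {(a+b)/2..<b})"
    and "tophalf {a..<b} \<inter> (carleson {a..<(a+b)/2} \<union> carleson {(a+b)/2..<b}) = {}"
    and "carleson {a..<(a+b)/2} \<inter> carleson {(a+b)/2..<b} = {}"
proof -
  have m: "a < (a+b)/2" "(a+b)/2 < b" "(a+b)/2 - a = (b-a)/2" "b - (a+b)/2 = (b-a)/2"
    using assms by (auto simp: field_simps)
  note c = carleson_half_open[OF m(1)] carleson_half_open[OF m(2)] carleson_half_open[OF assms]
    tophalf_half_open[OF assms]
  show "carleson {a..<b} = tophalf {a..<b} \<union> (carleson {a..<(a+b)/2} \<union> carleson {(a+b)/2..<b})"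
    unfolding c m(3,4) using m(1,2) by (auto simp: slab_def)
  show "tophalf {a..<b} \<inter> (carleson {a..<(a+b)/2} \<union> carleson {(a+b)/2..<b}) = {}"
    unfolding c m(3,4) by (auto simp: slab_def)
  show "carleson {a..<(a+b)/2} \<inter> carleson {(a+b)/2..<b} = {}"
    unfolding c m(3,4) by (auto simp: slab_def)
qed

text \<open>The Cauchy-Schwarz inequality for the measure \<open>w dN\<close>. Integrating against \<open>w\<close> on both
sides keeps quotients by weights out of the applications.\<close>

lemma weighted_Cauchy_Schwarz:
  assumes [measurable]: "f \<in> borel_measurable N" "w \<in> borel_measurable N" "E \<in> sets N"
    and w: "\<And>x. x \<in> space N \<Longrightarrow> w x \<ge> (0::real)"
  shows "(\<integral>\<^sup>+x. f x * ennreal (w x) * indicator E x \<partial>N)\<^sup>2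
    \<le> (\<integral>\<^sup>+x. (f x)\<^sup>2 * ennreal (w x) * indicator E x \<partial>N) * (\<integral>\<^sup>+x. ennreal (w x) * indicator E x \<partial>N)"
proof -
  have sq: "ennreal (sqrt (w x)) * ennreal (sqrt (w x)) = ennreal (w x)" if "x \<in> space N" for x
    using w[OF that] by (simp add: ennreal_mult[symmetric])
  have "(\<integral>\<^sup>+x. f x * ennreal (w x) * indicator E x \<partial>N)
      = (\<integral>\<^sup>+x. (f x * ennreal (sqrt (w x)) * indicator E x) * (ennreal (sqrt (w x)) * indicator E x) \<partial>N)"
    by (intro nn_integral_cong) (simp add: sq[symmetric] indicator_def mult_ac)
  also have "\<dots>\<^sup>2 \<le> (\<integral>\<^sup>+x. (f x * ennreal (sqrt (w x)) * indicator E x)\<^sup>2 \<partial>N) * (\<integral>\<^sup>+x. (ennreal (sqrt (w x)) * indicator E x)\<^sup>2 \<partial>N)"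
    by (rule Cauchy_Schwarz_nn_integral) measurable
  also have "(\<integral>\<^sup>+x. (f x * ennreal (sqrt (w x)) * indicator E x)\<^sup>2 \<partial>N) = (\<integral>\<^sup>+x. (f x)\<^sup>2 * ennreal (w x) * indicator E x \<partial>N)"
    by (intro nn_integral_cong) (simp add: sq[symmetric] indicator_def power2_eq_square mult_ac)
  also have "(\<integral>\<^sup>+x. (ennreal (sqrt (w x)) * indicator E x)\<^sup>2 \<partial>N) = (\<integral>\<^sup>+x. ennreal (w x) * indicator E x \<partial>N)"
    by (intro nn_integral_cong) (simp add: sq[symmetric] indicator_def power2_eq_square mult_ac)
  finally show ?thesis .
qed

text \<open>The last assumption is the one-third trick for closed intervals. As \<open>C0\<close> may be enlarged, \<open>C0 \<ge> 1\<close> is no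
restriction; it keeps the derived constants positive.\<close>

locale half_plane =
  fixes \<alpha> :: real and D1 D2 :: "real set set" and C0 :: real
  assumes alpha: "\<alpha> > -1"
    and dyadic1: "dyadic_system D1" and dyadic2: "dyadic_system D2"
    and C0: "C0 \<ge> 1"
    and cover: "\<And>a b. a < b \<Longrightarrow> \<exists>J\<in>D1 \<union> D2. {a..b} \<subseteq> J \<and> len J \<le> C0 * (b - a)"
begin

abbreviation M :: "complex measure" where "M \<equiv> dA \<alpha>"

sublocale sigma_finite_measure M
  using sigma_finite_dA[OF alpha] .

sublocale pair_sigma_finite M M ..

abbreviation mass :: "(complex \<Rightarrow> real) \<Rightarrow> complex set \<Rightarrow> ennreal" where
  "mass w E \<equiv> \<integral>\<^sup>+z. ennreal (w z) * indicator E z \<partial>M"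

abbreviation energy :: "(complex \<Rightarrow> ennreal) \<Rightarrow> (complex \<Rightarrow> real) \<Rightarrow> ennreal" where
  "energy f w \<equiv> \<integral>\<^sup>+z. (f z)\<^sup>2 * ennreal (w z) \<partial>M"

abbreviation deviation :: "(complex \<Rightarrow> complex) \<Rightarrow> complex \<Rightarrow> complex set \<Rightarrow> ennreal" where
  "deviation b c E \<equiv> \<integral>\<^sup>+z. ennreal (cmod (b z - c)) * indicator E z \<partial>M"

definition box_const :: real where "box_const = 2 powr \<alpha> / pi"

lemma box_const_pos: "box_const > 0" by (simp add: box_const_def)

lemma carleson_measure: "a \<le> b \<Longrightarrow> emeasure M (carleson {a..<b}) = ennreal (box_const * (b - a) powr (2 + \<alpha>))"
  using emeasure_carleson[OF alpha] by (simp add: box_const_def)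

lemma half_open:
  assumes "I \<in> D1 \<union> D2"
  obtains a b where "I = {a..<b}" "a < b"
  using assms dyadicE'[OF dyadic1] dyadicE'[OF dyadic2] by (metis Un_iff)

lemma len_pos: "I \<in> D1 \<union> D2 \<Longrightarrow> len I > 0"
  using half_open[of I] by (metis len_atLeastLessThan diff_gt_0_iff_gt less_imp_le)

lemma carleson_measure_D: "I \<in> D1 \<union> D2 \<Longrightarrow> emeasure M (carleson I) = ennreal (box_const * len I powr (2 + \<alpha>))"
  using half_open[of I] by (metis carleson_measure len_atLeastLessThan less_imp_le)

lemma carleson_sets_D [measurable]: "I \<in> D1 \<union> D2 \<Longrightarrow> carleson I \<in> sets M"
  using half_open[of I] by (metis carleson_half_open slab_sets_dA)

lemma tophalf_sets_D: "I \<in> D1 \<union> D2 \<Longrightarrow> tophalf I \<in> sets M"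
  using half_open[of I] by (metis tophalf_half_open slab_sets_dA)

text \<open>The factor by which the measure of a box exceeds that of its upper half.\<close>

definition \<theta> :: real where "\<theta> = 1 / (1 - (1/2) powr (1 + \<alpha>))"

lemma theta_pos: "\<theta> > 0" and one_minus_half_powr_pos: "1 - (1/2) powr (1 + \<alpha>) > 0"
proof -
  have "(1/2::real) powr (1 + \<alpha>) < 1 powr (1 + \<alpha>)"
    using alpha by (intro powr_less_mono2) auto
  then show "1 - (1/2::real) powr (1 + \<alpha>) > 0" by simp
  then show "\<theta> > 0" by (simp add: \<theta>_def)
qed

lemma tophalf_measure:
  assumes "I \<in> D1 \<union> D2"
  shows "emeasure M (tophalf I) = ennreal (box_const * len I powr (2 + \<alpha>) / \<theta>)"
proof -
  obtain a b where ab: "I = {a..<b}" "a < b" using half_open[OF assms] .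
  have l: "len I = b - a" using ab by (simp add: len_atLeastLessThan)
  have p: "(b - a) powr (2 + \<alpha>) = (b - a) * (b - a) powr (1 + \<alpha>)"
    using powr_add[of "b - a" 1 "1 + \<alpha>"] ab by (auto simp: add_ac)
  have h: "((b - a) / 2) powr (1 + \<alpha>) = (b - a) powr (1 + \<alpha>) * (1/2) powr (1 + \<alpha>)"
    using ab powr_mult[of "b - a" "1/2" "1 + \<alpha>"] by simp
  have "emeasure M (tophalf I) = ennreal (2 powr \<alpha> / pi * (b - a) * ((b - a) powr (1 + \<alpha>) - ((b - a) / 2) powr (1 + \<alpha>)))"
    unfolding ab(1) tophalf_half_open[OF ab(2)] using alpha ab by (intro emeasure_slab) auto
  also have "2 powr \<alpha> / pi * (b - a) * ((b - a) powr (1 + \<alpha>) - ((b - a) / 2) powr (1 + \<alpha>))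
      = box_const * len I powr (2 + \<alpha>) / \<theta>"
    unfolding l p h box_const_def \<theta>_def by (simp add: algebra_simps diff_divide_distrib)
  finally show ?thesis .
qed

text \<open>An interval of half-length \<open>d(z,w)\<close> around \<open>Re z\<close> is long enough for its box to reach above both points.\<close>

lemma box_containing:
  assumes "z \<in> upper_half" "w \<in> upper_half"
  obtains J where "J \<in> D1 \<union> D2" "z \<in> carleson J" "w \<in> carleson J" "len J \<le> 2 * C0 * hdist z w"
proof -
  let ?h = "hdist z w"
  have h: "?h > 0" using hdist_pos[OF assms] .
  obtain J where J: "J \<in> D1 \<union> D2" "{Re z - ?h..Re z + ?h} \<subseteq> J" "len J \<le> C0 * (Re z + ?h - (Re z - ?h))"
    using cover[of "Re z - ?h" "Re z + ?h"] h by auto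
  obtain a b where ab: "J = {a..<b}" "a < b" using half_open[OF J(1)] .
  have "a \<le> Re z - ?h" "Re z + ?h < b" using J(2) h unfolding ab
    by (auto simp: atLeastAtMost_subseteq_atLeastLessThan_iff)
  then have l: "2 * ?h < len J" using ab by (simp add: len_atLeastLessThan)
  have "Re w \<in> {Re z - ?h..Re z + ?h}" "Re z \<in> {Re z - ?h..Re z + ?h}"
    using Re_le_hdist[of z w] h by auto
  then have "z \<in> carleson J" "w \<in> carleson J"
    using J(2) l Im_le_hdist[of z w] assms h by (auto simp: carleson_def upper_half_def)
  then show ?thesis using that J by (simp add: mult_ac)
qed

text \<open>The \<open>B\<^sub>2\<close> condition in multiplied form, for weights positive at every point, so that passing to the
inverse weight is a symmetry.\<close>

definition bekolle :: "(complex \<Rightarrow> real) \<Rightarrow> real \<Rightarrow> bool" where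
  "bekolle \<mu> K \<longleftrightarrow> \<mu> \<in> borel_measurable M \<and> (\<forall>z\<in>upper_half. \<mu> z > 0) \<and> K \<ge> 0 \<and>
     (\<forall>I\<in>D1 \<union> D2. (mass \<mu> (carleson I)) *
        (mass (\<lambda>z. inverse (\<mu> z)) (carleson I)) \<le> ennreal K * (emeasure M (carleson I))\<^sup>2)"

lemma weight_integral_pos:
  assumes [measurable]: "\<mu> \<in> borel_measurable M" "E \<in> sets M" and pos: "\<And>z. z \<in> upper_half \<Longrightarrow> \<mu> z > 0"
    and E: "emeasure M E > 0"
  shows "(mass \<mu> E) > 0"
proof (rule ccontr)
  assume "\<not> ?thesis"
  then have "mass \<mu> E = 0" by simp
  then have "AE z in M. ennreal (\<mu> z) * indicator E z = 0"
    by (subst (asm) nn_integral_0_iff_AE) auto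
  then have "AE z in M. z \<notin> E"
    using AE_space by eventually_elim (use pos in \<open>force simp: indicator_def split: if_splits\<close>)
  then have "emeasure M E = 0" using assms(2) by (simp add: AE_iff_null_sets[symmetric] null_setsD1)
  then show False using E by simp
qed

lemma bekolle_inverse:
  assumes "bekolle \<mu> K"
  shows "bekolle (\<lambda>z. inverse (\<mu> z)) K"
  using assms unfolding bekolle_def by (auto simp: mult.commute)

text \<open>Both masses are positive and their product is finite.\<close>

lemma bekolle_finite:
  assumes "bekolle \<mu> K" "I \<in> D1 \<union> D2"
  shows "mass \<mu> (carleson I) < \<infinity>"
proof -
  have [measurable]: "\<mu> \<in> borel_measurable M" "carleson I \<in> sets M"
    using assms carleson_sets_D by (auto simp: bekolle_def)
  have "emeasure M (carleson I) > 0"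
    using carleson_measure_D[OF assms(2)] len_pos[OF assms(2)] box_const_pos by simp
  then have "(mass (\<lambda>z. inverse (\<mu> z)) (carleson I)) > 0"
    using assms by (intro weight_integral_pos) (auto simp: bekolle_def)
  moreover have "mass \<mu> (carleson I) *
        (mass (\<lambda>z. inverse (\<mu> z)) (carleson I)) < \<infinity>"
  proof (rule order_le_less_trans)
    show "ennreal K * (emeasure M (carleson I))\<^sup>2 < \<infinity>"
      unfolding carleson_measure_D[OF assms(2)]
      by (simp add: ennreal_mult_less_top power2_eq_square)
  qed (use assms in \<open>auto simp: bekolle_def\<close>)
  ultimately show ?thesis
    by (auto simp: ennreal_mult_less_top)
qed

text \<open>The tree inequality for the set functions \<open>\<integral> f w\<close>, \<open>\<integral> w\<close> and \<open>\<integral> f\<^sup>2 w\<close>: they are additive when a box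
is split into its upper half and its two children, and the Cauchy-Schwarz inequality holds on each part.\<close>

lemma weighted_embedding:
  fixes f :: "complex \<Rightarrow> ennreal" and w :: "complex \<Rightarrow> real"
  assumes D: "dyadic_system D" "D \<subseteq> D1 \<union> D2"
    and [measurable]: "f \<in> borel_measurable M" "w \<in> borel_measurable M"
    and w_pos: "\<forall>z\<in>upper_half. w z > 0"
    and w_fin: "\<forall>I\<in>D. (mass w (carleson I)) < \<infinity>"
    and T: "energy f w < \<infinity>"
    and A: "finite A" "A \<subseteq> D"
  defines "F \<equiv> (\<lambda>I. measure (density M (\<lambda>z. f z * ennreal (w z))) (carleson I))"
    and "S \<equiv> (\<lambda>I. measure (density M (\<lambda>z. ennreal (w z))) (carleson I))"
    and "m \<equiv> (\<lambda>I. measure (density M (\<lambda>z. ennreal (w z))) (tophalf I))"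
  shows "(\<Sum>I\<in>A. (F I / S I)\<^sup>2 * m I) \<le> 4 * enn2real (energy f w)"
    and "\<And>I. I \<in> D \<Longrightarrow> emeasure (density M (\<lambda>z. f z * ennreal (w z))) (carleson I) < \<infinity>"
    and "\<And>I. I \<in> D \<Longrightarrow> S I > 0"
    and "\<And>I. I \<in> D \<Longrightarrow> m I > 0"
proof -
  have w: "w z > 0" if "z \<in> upper_half" for z using w_pos that by blast
  have fin: "mass w (carleson I) < \<infinity>" if "I \<in> D" for I
    using w_fin that by blast
  define NF where "NF = density M (\<lambda>z. f z * ennreal (w z))"
  define NS where "NS = density M (\<lambda>z. ennreal (w z))"
  define NG where "NG = density M (\<lambda>z. (f z)\<^sup>2 * ennreal (w z))"
  have sets: "sets NF = sets M" "sets NS = sets M" "sets NG = sets M"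
    by (simp_all add: NF_def NS_def NG_def)
  have spc: "space NG = space M" by (simp add: NG_def)
  have e: "emeasure NF E = (\<integral>\<^sup>+z. f z * ennreal (w z) * indicator E z \<partial>M)"
          "emeasure NS E = (mass w E)"
          "emeasure NG E = (\<integral>\<^sup>+z. (f z)\<^sup>2 * ennreal (w z) * indicator E z \<partial>M)" if "E \<in> sets M" for E
    using that by (simp_all add: NF_def NS_def NG_def emeasure_density)
  have spG: "emeasure NG (space M) = (energy f w)"
    unfolding e(3)[OF sets.top] by (intro nn_integral_cong) simp
  interpret NG: finite_measure NG
    using T spG spc by (intro finite_measureI) simp
  have cs: "(emeasure NF E)\<^sup>2 \<le> emeasure NG E * emeasure NS E" if "E \<in> sets M" for E
    unfolding e[OF that] by (rule weighted_Cauchy_Schwarz) (use that w in \<open>auto simp: less_imp_le\<close>)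
  have Sfin: "emeasure NS (carleson I) < \<infinity>" if "I \<in> D" for I
    using fin[OF that] e(2) carleson_sets_D that D by auto
  have Ffin: "emeasure NF E < \<infinity>" and cs': "(measure NF E)\<^sup>2 \<le> measure NG E * measure NS E"
    if "E \<in> sets M" "emeasure NS E < \<infinity>" for E
  proof -
    have G: "emeasure NG E < \<infinity>" using NG.emeasure_finite[of E] by (simp add: less_top[symmetric])
    then have fin: "emeasure NG E * emeasure NS E < \<infinity>" using that by (simp add: ennreal_mult_less_top)
    then have "(emeasure NF E)\<^sup>2 < \<infinity>" using cs[OF that(1)] by (rule order_le_less_trans[rotated])
    then show "emeasure NF E < \<infinity>" by (auto simp: power2_eq_square ennreal_mult_less_top)
    have "enn2real ((emeasure NF E)\<^sup>2) \<le> enn2real (emeasure NG E * emeasure NS E)"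
      using cs[OF that(1)] fin by (intro enn2real_mono) auto
    then show "(measure NF E)\<^sup>2 \<le> measure NG E * measure NS E"
      by (simp add: measure_def enn2real_mult power2_eq_square)
  qed
  have cst: "carleson I \<in> sets M" "tophalf I \<in> sets M" "tophalf I \<subseteq> carleson I" if "I \<in> D" for I
    using carleson_sets_D tophalf_sets_D that D by (auto simp: tophalf_def)
  have mfin: "emeasure NS (tophalf I) < \<infinity>" if "I \<in> D" for I
    using order_le_less_trans[OF emeasure_mono Sfin[OF that]] cst[OF that] sets by blast
  have spos: "emeasure NS E > 0" if "E \<in> sets M" "emeasure M E > 0" for E
    unfolding e(2)[OF that(1)] by (rule weight_integral_pos) (use that w in auto)
  have FF: "F = (\<lambda>I. measure NF (carleson I))" and SS: "S = (\<lambda>I. measure NS (carleson I))"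
    and mm: "m = (\<lambda>I. measure NS (tophalf I))"
    by (simp_all add: F_def S_def m_def NF_def NS_def)
  show F_fin: "emeasure (density M (\<lambda>z. f z * ennreal (w z))) (carleson I) < \<infinity>" if "I \<in> D" for I
    using Ffin[OF cst(1)[OF that] Sfin[OF that]] by (simp add: NF_def)
  show S: "S I > 0" if I: "I \<in> D" for I
  proof -
    have "emeasure M (carleson I) > 0"
      using carleson_measure_D[of I] len_pos[of I] I D box_const_pos by auto
    then show ?thesis unfolding SS measure_def
      using spos[OF cst(1)[OF I]] Sfin[OF I] by (simp add: enn2real_positive_iff)
  qed
  show m: "m I > 0" if I: "I \<in> D" for I
  proof -
    have "emeasure M (tophalf I) > 0"
      using tophalf_measure[of I] len_pos[of I] I D box_const_pos theta_pos by auto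
    then show ?thesis unfolding mm measure_def
      using spos[OF cst(2)[OF I]] mfin[OF I] by (simp add: enn2real_positive_iff)
  qed
  have "(\<Sum>I\<in>A. (F I / S I)\<^sup>2 * m I) \<le> 4 * measure NG (space NG)"
  proof (rule dyadic_embedding[OF D(1) S m, where G = "\<lambda>I. measure NG (carleson I)"])
    fix I assume I: "I \<in> D"
    show "(F I)\<^sup>2 \<le> measure NG (carleson I) * S I"
      unfolding FF SS by (rule cs'[OF cst(1)[OF I] Sfin[OF I]])
  next
    fix a b :: real assume ab: "{a..<b} \<in> D" "a < b"
    let ?t = "tophalf {a..<b}" and ?c = "carleson {a..<b}"
      and ?l = "carleson {a..<(a+b)/2}" and ?r = "carleson {(a+b)/2..<b}"
    note sp = carleson_split[OF ab(2)]
    have lr: "{a..<(a+b)/2} \<in> D" "{(a+b)/2..<b} \<in> D" using dyadic_halves[OF D(1) ab] by auto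
    note st = cst[OF ab(1)] cst(1)[OF lr(1)] cst(1)[OF lr(2)]
    have add: "measure N ?c = measure N ?t + measure N ?l + measure N ?r"
      if N: "sets N = sets M" "emeasure N ?c < \<infinity>" for N
    proof -
      have sub: "?t \<subseteq> ?c" "?l \<subseteq> ?c" "?r \<subseteq> ?c" using sp(1) by auto
      have fm: "X \<in> fmeasurable N" if "X \<in> sets M" "X \<subseteq> ?c" for X
        using that N st by (intro fmeasurableI) (auto intro: order_le_less_trans[OF emeasure_mono])
      have "measure N ?c = measure N ?t + measure N (?l \<union> ?r)"
        unfolding sp(1) by (rule measure_Un3[THEN trans]) (use fm sub st sp(2) in auto)
      also have "measure N (?l \<union> ?r) = measure N ?l + measure N ?r"
        by (rule measure_Un3[THEN trans]) (use fm sub st sp(3) in auto)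
      finally show ?thesis by simp
    qed
    show "\<exists>F0 G0. F0\<^sup>2 \<le> G0 * m {a..<b} \<and>
        F {a..<b} = F0 + F {a..<(a+b)/2} + F {(a+b)/2..<b} \<and>
        measure NG ?c = G0 + measure NG ?l + measure NG ?r \<and>
        S {a..<b} = m {a..<b} + S {a..<(a+b)/2} + S {(a+b)/2..<b}"
    proof -
      have "emeasure NG ?c < \<infinity>" using NG.emeasure_finite[of ?c] by (simp add: less_top[symmetric])
      note G = add[OF sets(3) this]
      have "emeasure NF ?c < \<infinity>" using F_fin[OF ab(1)] by (simp add: NF_def)
      note F = add[OF sets(1) this]
      note S = add[OF sets(2) Sfin[OF ab(1)]]
      note cs0 = cs'[OF st(2) mfin[OF ab(1)]]
      show ?thesis unfolding FF SS mm using F G S cs0 by blast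
    qed
  next
    fix R assume R: "finite R" "R \<subseteq> D" "disjoint R"
    have disj: "disjoint_family_on carleson R"
    proof (unfold disjoint_family_on_def, intro ballI impI)
      fix I J assume "I \<in> R" "J \<in> R" "I \<noteq> J"
      then have "I \<inter> J = {}" using R(3) by (auto simp: disjoint_def)
      then show "carleson I \<inter> carleson J = {}" by (auto simp: carleson_def)
    qed
    have "(\<Sum>I\<in>R. measure NG (carleson I)) = measure NG (\<Union>I\<in>R. carleson I)"
      by (rule NG.finite_measure_finite_Union[symmetric]) (use R disj cst sets in auto)
    also have "\<dots> \<le> measure NG (space NG)" by (rule NG.bounded_measure)
    finally show "(\<Sum>I\<in>R. measure NG (carleson I)) \<le> measure NG (space NG)" .
  qed (use A in auto)
  then show "(\<Sum>I\<in>A. (F I / S I)\<^sup>2 * m I) \<le> 4 * enn2real (energy f w)"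
    unfolding measure_def spc spG .
qed

end

section \<open>The positive operator on weighted spaces\<close>

context half_plane begin

text \<open>Cauchy-Schwarz for \<open>1 = \<mu>\<^bsup>-1/2\<^esup> \<mu>\<^bsup>1/2\<^esup>\<close>.\<close>

lemma weight_dual_ge:
  assumes [measurable]: "\<mu> \<in> borel_measurable M" "E \<in> sets M" and pos: "\<And>z. z \<in> upper_half \<Longrightarrow> \<mu> z > 0"
  shows "(emeasure M E)\<^sup>2 \<le> (mass (\<lambda>z. inverse (\<mu> z)) E) * (mass \<mu> E)"
proof -
  have *: "ennreal (inverse (\<mu> z)) * ennreal (\<mu> z) = 1" if "z \<in> upper_half" for z
    using pos[OF that] by (simp add: ennreal_mult[symmetric])
  have "emeasure M E = (\<integral>\<^sup>+z. ennreal (inverse (\<mu> z)) * ennreal (\<mu> z) * indicator E z \<partial>M)"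
    by (subst nn_integral_indicator[symmetric, OF assms(2)]) (intro nn_integral_cong, simp add: *)
  moreover have "(\<integral>\<^sup>+z. ennreal (inverse (\<mu> z)) * ennreal (\<mu> z) * indicator E z \<partial>M)\<^sup>2
    \<le> (\<integral>\<^sup>+z. (ennreal (inverse (\<mu> z)))\<^sup>2 * ennreal (\<mu> z) * indicator E z \<partial>M) * (mass \<mu> E)"
    by (rule weighted_Cauchy_Schwarz) (use pos in \<open>auto simp: less_imp_le\<close>)
  moreover have "(\<integral>\<^sup>+z. (ennreal (inverse (\<mu> z)))\<^sup>2 * ennreal (\<mu> z) * indicator E z \<partial>M)
     = (mass (\<lambda>z. inverse (\<mu> z)) E)"
    by (intro nn_integral_cong) (simp add: * power2_eq_square mult.assoc)
  ultimately show ?thesis by simp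
qed

text \<open>With \<open>\<sigma> = \<mu>\<^bsup>-1\<^esup>\<close> one term of the sum is the product of the \<open>\<sigma>\<close>-average of \<open>f\<close>, the \<open>\<mu>\<close>-average of \<open>g\<close> and
\<open>\<sigma>(Q) \<mu>(Q) / M(Q)\<close>. The last factor is at most \<open>K M(Q)\<close> by the Bekolle condition, hence at most
\<open>K \<theta>\<close> times the measure of the upper half of \<open>Q\<close>, which by duality is at most the geometric mean of its
\<open>\<sigma>\<close>- and \<open>\<mu>\<close>-mass. The sum splits into two that the embedding controls.\<close>

lemma bilinear_sum:
  fixes f g :: "complex \<Rightarrow> ennreal"
  assumes \<mu>: "bekolle \<mu> K" and D: "dyadic_system D" "D \<subseteq> D1 \<union> D2"
    and [measurable]: "f \<in> borel_measurable M" "g \<in> borel_measurable M"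
    and T1: "(\<integral>\<^sup>+z. (f z)\<^sup>2 * ennreal (inverse (\<mu> z)) \<partial>M) = ennreal t1"
    and T2: "energy g \<mu> = ennreal t2"
    and t: "t1 \<ge> 0" "t2 \<ge> 0"
    and A: "finite A" "A \<subseteq> D"
  defines "F \<equiv> (\<lambda>I. \<integral>\<^sup>+z. f z * ennreal (inverse (\<mu> z)) * indicator (carleson I) z \<partial>M)"
    and "G \<equiv> (\<lambda>I. \<integral>\<^sup>+z. g z * ennreal (\<mu> z) * indicator (carleson I) z \<partial>M)"
  shows "(\<Sum>I\<in>A. F I * G I * ennreal (1 / (box_const * len I powr (2 + \<alpha>)))) \<le> ennreal (4 * K * \<theta> * sqrt (t1 * t2))"
proof -
  have [measurable]: "\<mu> \<in> borel_measurable M" and pos: "\<And>z. z \<in> upper_half \<Longrightarrow> \<mu> z > 0" and K: "K \<ge> 0"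
    using \<mu> by (auto simp: bekolle_def)
  let ?\<sigma> = "\<lambda>z. inverse (\<mu> z)"
  define Ff where "Ff = (\<lambda>I. measure (density M (\<lambda>z. f z * ennreal (?\<sigma> z))) (carleson I))"
  define Gf where "Gf = (\<lambda>I. measure (density M (\<lambda>z. g z * ennreal (\<mu> z))) (carleson I))"
  define S where "S = (\<lambda>I. measure (density M (\<lambda>z. ennreal (?\<sigma> z))) (carleson I))"
  define U where "U = (\<lambda>I. measure (density M (\<lambda>z. ennreal (\<mu> z))) (carleson I))"
  define m where "m = (\<lambda>I. measure (density M (\<lambda>z. ennreal (?\<sigma> z))) (tophalf I))"
  define n where "n = (\<lambda>I. measure (density M (\<lambda>z. ennreal (\<mu> z))) (tophalf I))"
  have app: "measure (density M (\<lambda>z. f z * ennreal (?\<sigma> z))) (carleson I) = Ff I"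
     "measure (density M (\<lambda>z. g z * ennreal (\<mu> z))) (carleson I) = Gf I"
     "measure (density M (\<lambda>z. ennreal (?\<sigma> z))) (carleson I) = S I"
     "measure (density M (\<lambda>z. ennreal (\<mu> z))) (carleson I) = U I"
     "measure (density M (\<lambda>z. ennreal (?\<sigma> z))) (tophalf I) = m I"
     "measure (density M (\<lambda>z. ennreal (\<mu> z))) (tophalf I) = n I" for I
    by (simp_all add: Ff_def Gf_def S_def U_def m_def n_def)
  have fin1: "\<forall>I\<in>D. (mass ?\<sigma> (carleson I)) < \<infinity>"
    using bekolle_finite[OF bekolle_inverse[OF \<mu>]] D(2) by blast
  have fin2: "\<forall>I\<in>D. (mass \<mu> (carleson I)) < \<infinity>"
    using bekolle_finite[OF \<mu>] D(2) by blast
  have mes: "?\<sigma> \<in> borel_measurable M" by measurable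
  have pos': "\<forall>z\<in>upper_half. ?\<sigma> z > 0" "\<forall>z\<in>upper_half. \<mu> z > 0" using pos by simp_all
  have Tf: "(energy f ?\<sigma>) < \<infinity>" "energy g \<mu> < \<infinity>"
    using T1 T2 by auto
  note e1 = weighted_embedding[OF D assms(4) mes pos'(1) fin1 Tf(1) A, unfolded app]
  note e2 = weighted_embedding[OF D assms(5) \<open>\<mu> \<in> borel_measurable M\<close> pos'(2) fin2 Tf(2) A, unfolded app]
  have s1: "(\<Sum>I\<in>A. (Ff I / S I)\<^sup>2 * m I) \<le> 4 * t1" using e1(1) T1 t by simp
  have s2: "(\<Sum>I\<in>A. (Gf I / U I)\<^sup>2 * n I) \<le> 4 * t2" using e2(1) T2 t by simp
  define a where "a = (\<lambda>I. box_const * len I powr (2 + \<alpha>))"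
  have a_pos: "a I > 0" if "I \<in> D" for I
    using len_pos[of I] box_const_pos that D by (auto simp: a_def)
  have cs: "carleson I \<in> sets M" "tophalf I \<in> sets M" if "I \<in> D" for I
    using carleson_sets_D tophalf_sets_D that D by auto
  have SU: "S I * U I \<le> K * (a I)\<^sup>2" if I: "I \<in> D" for I
  proof -
    have "emeasure (density M (\<lambda>z. ennreal (\<mu> z))) (carleson I) * emeasure (density M (\<lambda>z. ennreal (?\<sigma> z))) (carleson I)
       \<le> ennreal K * (emeasure M (carleson I))\<^sup>2"
      using \<mu> I D cs[OF I] by (auto simp: bekolle_def emeasure_density)
    also have "\<dots> = ennreal (K * (a I)\<^sup>2)"
      using a_pos[OF I] K unfolding carleson_measure_D[OF subsetD[OF D(2) I]] a_def
      by (simp add: ennreal_power ennreal_mult)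
    finally have "enn2real (emeasure (density M (\<lambda>z. ennreal (\<mu> z))) (carleson I) * emeasure (density M (\<lambda>z. ennreal (?\<sigma> z))) (carleson I))
       \<le> enn2real (ennreal (K * (a I)\<^sup>2))" by (intro enn2real_mono) auto
    then show ?thesis using K by (simp add: S_def U_def measure_def enn2real_mult mult.commute)
  qed
  have mn: "a I / \<theta> \<le> sqrt (m I) * sqrt (n I)" if I: "I \<in> D" for I
  proof -
    let ?eS = "emeasure (density M (\<lambda>z. ennreal (?\<sigma> z))) (tophalf I)" and ?eU = "emeasure (density M (\<lambda>z. ennreal (\<mu> z))) (tophalf I)"
    have "(emeasure M (tophalf I))\<^sup>2 \<le> ?eS * ?eU"
      using weight_dual_ge[OF _ cs(2)[OF I] pos] cs(2)[OF I] by (simp add: emeasure_density)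
    moreover have "?eS \<noteq> top" "?eU \<noteq> top"
      using e1(4)[OF I] e2(4)[OF I] by (auto simp: m_def n_def measure_def)
    then have "?eS = ennreal (m I)" "?eU = ennreal (n I)"
      by (simp_all add: m_def n_def emeasure_eq_ennreal_measure)
    moreover have "emeasure M (tophalf I) = ennreal (a I / \<theta>)"
      using tophalf_measure[of I] I D by (auto simp: a_def)
    ultimately have "ennreal ((a I / \<theta>)\<^sup>2) \<le> ennreal (m I * n I)"
      using a_pos[OF I] theta_pos e1(4)[OF I] e2(4)[OF I] by (simp add: ennreal_power ennreal_mult)
    then have "(a I / \<theta>)\<^sup>2 \<le> m I * n I"
      using e1(4)[OF I] e2(4)[OF I] by (simp add: ennreal_le_iff)
    then have "a I / \<theta> \<le> sqrt (m I * n I)" by (rule real_le_rsqrt)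
    then show ?thesis by (simp add: real_sqrt_mult)
  qed
  have term_le: "Ff I * Gf I * (1 / a I) \<le> (K * \<theta>) * ((Ff I / S I * sqrt (m I)) * (Gf I / U I * sqrt (n I)))" if I: "I \<in> D" for I
  proof -
    have S: "S I > 0" and U: "U I > 0" using e1(3)[OF I] e2(3)[OF I] by auto
    have nn: "Ff I / S I \<ge> 0" "Gf I / U I \<ge> 0" using S U by (auto simp: Ff_def Gf_def)
    have "Ff I * Gf I * (1 / a I) = (Ff I / S I) * (Gf I / U I) * ((S I * U I) / a I)"
      using S U by simp
    also have "\<dots> \<le> (Ff I / S I) * (Gf I / U I) * ((K * (a I)\<^sup>2) / a I)"
      by (rule mult_left_mono[OF divide_right_mono[OF SU[OF I] less_imp_le[OF a_pos[OF I]]] mult_nonneg_nonneg[OF nn]])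
    also have "(K * (a I)\<^sup>2) / a I = (K * \<theta>) * (a I / \<theta>)"
      using a_pos[OF I] theta_pos by (simp add: power2_eq_square)
    also have "(Ff I / S I) * (Gf I / U I) * ((K * \<theta>) * (a I / \<theta>)) \<le> (Ff I / S I) * (Gf I / U I) * ((K * \<theta>) * (sqrt (m I) * sqrt (n I)))"
      using K theta_pos
      by (intro mult_left_mono[OF mult_left_mono[OF mn[OF I]] mult_nonneg_nonneg[OF nn]]) simp
    finally show ?thesis by (simp add: mult_ac)
  qed
  have nn0: "m I \<ge> 0" "n I \<ge> 0" for I by (simp_all add: m_def n_def)
  have "(\<Sum>I\<in>A. (Ff I / S I * sqrt (m I)) * (Gf I / U I * sqrt (n I)))\<^sup>2
      \<le> (\<Sum>I\<in>A. (Ff I / S I * sqrt (m I))\<^sup>2) * (\<Sum>I\<in>A. (Gf I / U I * sqrt (n I))\<^sup>2)"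
    by (rule Cauchy_Schwarz_ineq_sum)
  also have "(\<Sum>I\<in>A. (Ff I / S I * sqrt (m I))\<^sup>2) = (\<Sum>I\<in>A. (Ff I / S I)\<^sup>2 * m I)"
    by (intro sum.cong refl) (simp only: power_mult_distrib real_sqrt_pow2[OF nn0(1)])
  also have "(\<Sum>I\<in>A. (Gf I / U I * sqrt (n I))\<^sup>2) = (\<Sum>I\<in>A. (Gf I / U I)\<^sup>2 * n I)"
    by (intro sum.cong refl) (simp only: power_mult_distrib real_sqrt_pow2[OF nn0(2)])
  also have "(\<Sum>I\<in>A. (Ff I / S I)\<^sup>2 * m I) * (\<Sum>I\<in>A. (Gf I / U I)\<^sup>2 * n I) \<le> (4 * t1) * (4 * t2)"
    using s1 s2 t by (intro mult_mono) (auto intro!: sum_nonneg simp: m_def n_def)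
  finally have "(\<Sum>I\<in>A. (Ff I / S I * sqrt (m I)) * (Gf I / U I * sqrt (n I))) \<le> sqrt ((4 * t1) * (4 * t2))"
    by (rule real_le_rsqrt)
  also have "\<dots> = 4 * sqrt (t1 * t2)"
  proof -
    have "(4 * t1) * (4 * t2) = 4\<^sup>2 * (t1 * t2)" by simp
    then show ?thesis by (simp only: real_sqrt_mult real_sqrt_abs)
  qed
  finally have sum_le: "(\<Sum>I\<in>A. (Ff I / S I * sqrt (m I)) * (Gf I / U I * sqrt (n I))) \<le> 4 * sqrt (t1 * t2)" .
  have FG: "F I * G I * ennreal (1 / (box_const * len I powr (2 + \<alpha>))) = ennreal (Ff I * Gf I * (1 / a I))" if "I \<in> A" for I
  proof -
    have I: "I \<in> D" using that A by auto
    have "F I = emeasure (density M (\<lambda>z. f z * ennreal (?\<sigma> z))) (carleson I)"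
      using cs[OF I] by (simp add: F_def emeasure_density)
    also have "\<dots> = ennreal (Ff I)" using e1(2)[OF I] by (simp add: Ff_def emeasure_eq_ennreal_measure)
    finally have 1: "F I = ennreal (Ff I)" .
    have "G I = emeasure (density M (\<lambda>z. g z * ennreal (\<mu> z))) (carleson I)"
      using cs[OF I] by (simp add: G_def emeasure_density)
    also have "\<dots> = ennreal (Gf I)" using e2(2)[OF I] by (simp add: Gf_def emeasure_eq_ennreal_measure)
    finally have 2: "G I = ennreal (Gf I)" .
    show ?thesis unfolding 1 2 a_def[symmetric]
      using a_pos[OF I] by (simp add: ennreal_mult[symmetric] Ff_def Gf_def a_def)
  qed
  have "(\<Sum>I\<in>A. F I * G I * ennreal (1 / (box_const * len I powr (2 + \<alpha>)))) = (\<Sum>I\<in>A. ennreal (Ff I * Gf I * (1 / a I)))"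
    by (intro sum.cong FG refl)
  also have "\<dots> = ennreal (\<Sum>I\<in>A. Ff I * Gf I * (1 / a I))"
    using a_pos A by (intro sum_ennreal) (auto simp: Ff_def Gf_def subset_iff less_imp_le)
  also have "\<dots> \<le> ennreal (4 * K * \<theta> * sqrt (t1 * t2))"
  proof (rule ennreal_leI)
    have "(\<Sum>I\<in>A. Ff I * Gf I * (1 / a I)) \<le> (\<Sum>I\<in>A. (K * \<theta>) * ((Ff I / S I * sqrt (m I)) * (Gf I / U I * sqrt (n I))))"
      using term_le A by (intro sum_mono) auto
    also have "\<dots> = (K * \<theta>) * (\<Sum>I\<in>A. (Ff I / S I * sqrt (m I)) * (Gf I / U I * sqrt (n I)))"
      by (rule sum_distrib_left[symmetric])
    also have "\<dots> \<le> (K * \<theta>) * (4 * sqrt (t1 * t2))"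
      using sum_le K theta_pos by (intro mult_left_mono) auto
    finally show "(\<Sum>I\<in>A. Ff I * Gf I * (1 / a I)) \<le> 4 * K * \<theta> * sqrt (t1 * t2)" by (simp add: mult_ac)
  qed
  finally show ?thesis .
qed

text \<open>The dyadic model of the kernel.\<close>

definition box_sum :: "real set set \<Rightarrow> complex \<Rightarrow> complex \<Rightarrow> ennreal" where
  "box_sum D z w = (\<Sum>n. let I = from_nat_into D n in
     indicator (carleson I) z * (indicator (carleson I) w * ennreal (1 / (box_const * len I powr (2 + \<alpha>)))))"

definition kern_const :: real where "kern_const = box_const * (2 * C0) powr (2 + \<alpha>)"

lemma kern_const_pos: "kern_const > 0" using box_const_pos C0 by (simp add: kern_const_def)

lemma box_sum_ge:
  assumes D: "dyadic_system D" and J: "J \<in> D" and zw: "z \<in> carleson J" "w \<in> carleson J"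
  shows "ennreal (1 / (box_const * len J powr (2 + \<alpha>))) \<le> box_sum D z w"
proof -
  let ?t = "\<lambda>n. let I = from_nat_into D n in
     indicator (carleson I) z * (indicator (carleson I) w * ennreal (1 / (box_const * len I powr (2 + \<alpha>))))"
  obtain n where n: "from_nat_into D n = J"
    using from_nat_into_surj[OF countable_dyadic[OF D] J] by blast
  have "?t n = ennreal (1 / (box_const * len J powr (2 + \<alpha>)))" using zw by (simp add: n)
  moreover have "sum ?t {n} \<le> (\<Sum>n. ?t n)" by (rule sum_le_suminf) auto
  ultimately show ?thesis unfolding box_sum_def by simp
qed

text \<open>A single summand suffices, the one of a box of side comparable to \<open>d(z,w)\<close> around both points; it may
belong to either of the two systems.\<close>

lemma kern_le_box_sum:
  assumes "z \<in> upper_half" "w \<in> upper_half"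
  shows "ennreal (kern \<alpha> z w) \<le> ennreal kern_const * (box_sum D1 z w + box_sum D2 z w)"
proof -
  obtain J where J: "J \<in> D1 \<union> D2" "z \<in> carleson J" "w \<in> carleson J" "len J \<le> 2 * C0 * hdist z w"
    using box_containing[OF assms] .
  have h: "hdist z w > 0" using hdist_pos[OF assms] .
  have l: "len J > 0" using len_pos[OF J(1)] .
  have "len J powr (2 + \<alpha>) \<le> (2 * C0 * hdist z w) powr (2 + \<alpha>)"
    using J(4) l alpha by (intro powr_mono2) auto
  also have "\<dots> = (2 * C0) powr (2 + \<alpha>) * hdist z w powr (2 + \<alpha>)"
    using h C0 by (intro powr_mult)
  finally have le: "len J powr (2 + \<alpha>) \<le> (2 * C0) powr (2 + \<alpha>) * hdist z w powr (2 + \<alpha>)" .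
  have "kern \<alpha> z w = 1 / hdist z w powr (2 + \<alpha>)"
    by (simp only: kern_def powr_minus_divide)
  also have "\<dots> \<le> kern_const * (1 / (box_const * len J powr (2 + \<alpha>)))"
    using le h l box_const_pos by (simp add: kern_const_def field_simps)
  finally have "ennreal (kern \<alpha> z w) \<le> ennreal kern_const * ennreal (1 / (box_const * len J powr (2 + \<alpha>)))"
    using kern_const_pos by (subst ennreal_mult'[symmetric]) (auto intro: ennreal_leI)
  also have "ennreal (1 / (box_const * len J powr (2 + \<alpha>))) \<le> box_sum D1 z w + box_sum D2 z w"
    using J(1) box_sum_ge[OF dyadic1 _ J(2,3)] box_sum_ge[OF dyadic2 _ J(2,3)]
    by (auto intro: add_increasing add_increasing2)
  finally show ?thesis by (simp add: mult_left_mono)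
qed

lemma measurable_box_sum [measurable]:
  assumes D: "dyadic_system D" "D \<subseteq> D1 \<union> D2"
  shows "(\<lambda>(z, w). box_sum D z w) \<in> borel_measurable (M \<Otimes>\<^sub>M M)"
proof -
  have ne: "D \<noteq> {}" using infinite_dyadic[OF D(1)] by auto
  have [measurable]: "carleson (from_nat_into D n) \<in> sets M" for n
    using carleson_sets_D from_nat_into[OF ne, of n] D(2) by auto
  show ?thesis unfolding box_sum_def Let_def by measurable
qed

lemma box_form_le:
  fixes f g :: "complex \<Rightarrow> ennreal"
  assumes \<mu>: "bekolle \<mu> K" and D: "dyadic_system D" "D \<subseteq> D1 \<union> D2"
    and [measurable]: "f \<in> borel_measurable M" "g \<in> borel_measurable M"
    and T1: "(\<integral>\<^sup>+z. (f z)\<^sup>2 * ennreal (inverse (\<mu> z)) \<partial>M) = ennreal t1"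
    and T2: "energy g \<mu> = ennreal t2"
    and t: "t1 \<ge> 0" "t2 \<ge> 0"
  shows "(\<integral>\<^sup>+z. (\<integral>\<^sup>+w. g z * ennreal (\<mu> z) * (box_sum D z w * (f w * ennreal (inverse (\<mu> w)))) \<partial>M) \<partial>M)
    \<le> ennreal (4 * K * \<theta> * sqrt (t1 * t2))"
proof -
  have [measurable]: "\<mu> \<in> borel_measurable M" using \<mu> by (auto simp: bekolle_def)
  have inf: "infinite D" using infinite_dyadic[OF D(1)] .
  then have ne: "D \<noteq> {}" by auto
  define e where "e = from_nat_into D"
  have eD: "e n \<in> D" for n using from_nat_into[OF ne] by (simp add: e_def)
  have inj: "inj e" using bij_betw_from_nat_into[OF countable_dyadic[OF D(1)] inf] by (simp add: e_def bij_betw_def)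
  have [measurable]: "carleson (e n) \<in> sets M" for n
    using carleson_sets_D[of "e n"] eD[of n] D(2) by blast
  let ?F = "\<lambda>I. \<integral>\<^sup>+z. f z * ennreal (inverse (\<mu> z)) * indicator (carleson I) z \<partial>M"
  let ?G = "\<lambda>I. \<integral>\<^sup>+z. g z * ennreal (\<mu> z) * indicator (carleson I) z \<partial>M"
  let ?c = "\<lambda>I. ennreal (1 / (box_const * len I powr (2 + \<alpha>)))"
  have "(\<integral>\<^sup>+z. (\<integral>\<^sup>+w. g z * ennreal (\<mu> z) * (box_sum D z w * (f w * ennreal (inverse (\<mu> w)))) \<partial>M) \<partial>M)
     = (\<integral>\<^sup>+z. (\<integral>\<^sup>+w. (\<Sum>n. (g z * ennreal (\<mu> z) * indicator (carleson (e n)) z * ?c (e n)) * (f w * ennreal (inverse (\<mu> w)) * indicator (carleson (e n)) w)) \<partial>M) \<partial>M)"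
  proof (intro nn_integral_cong)
    fix z w
    let ?b = "\<lambda>n. indicator (carleson (e n)) z * (indicator (carleson (e n)) w * ?c (e n))"
    have "g z * ennreal (\<mu> z) * (box_sum D z w * (f w * ennreal (inverse (\<mu> w))))
       = (\<Sum>n. g z * ennreal (\<mu> z) * (?b n * (f w * ennreal (inverse (\<mu> w)))))"
      unfolding ennreal_suminf_cmult ennreal_suminf_multc by (simp only: box_sum_def Let_def e_def)
    also have "\<dots> = (\<Sum>n. (g z * ennreal (\<mu> z) * indicator (carleson (e n)) z * ?c (e n)) * (f w * ennreal (inverse (\<mu> w)) * indicator (carleson (e n)) w))"
      by (intro suminf_cong) (simp add: mult_ac)
    finally show "g z * ennreal (\<mu> z) * (box_sum D z w * (f w * ennreal (inverse (\<mu> w))))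
      = (\<Sum>n. (g z * ennreal (\<mu> z) * indicator (carleson (e n)) z * ?c (e n)) * (f w * ennreal (inverse (\<mu> w)) * indicator (carleson (e n)) w))" .
  qed
  also have "\<dots> = (\<integral>\<^sup>+z. (\<Sum>n. (g z * ennreal (\<mu> z) * indicator (carleson (e n)) z * ?c (e n)) * ?F (e n)) \<partial>M)"
    by (intro nn_integral_cong) (simp add: nn_integral_suminf nn_integral_cmult del: ennreal_suminf_cmult ennreal_suminf_multc)
  also have "\<dots> = (\<Sum>n. ?G (e n) * ?c (e n) * ?F (e n))"
    by (simp add: nn_integral_suminf nn_integral_multc del: ennreal_suminf_cmult ennreal_suminf_multc)
  also have "\<dots> = (\<Sum>n. ?F (e n) * ?G (e n) * ?c (e n))"
    by (intro suminf_cong) (simp add: mult_ac)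
  also have "\<dots> \<le> ennreal (4 * K * \<theta> * sqrt (t1 * t2))"
  proof (rule suminf_le_const[OF summableI])
    fix N
    have "(\<Sum>n<N. ?F (e n) * ?G (e n) * ?c (e n)) = (\<Sum>I\<in>e ` {..<N}. ?F I * ?G I * ?c I)"
      using inj by (subst sum.reindex) (auto intro: inj_on_subset)
    also have "\<dots> \<le> ennreal (4 * K * \<theta> * sqrt (t1 * t2))"
      by (rule bilinear_sum[OF \<mu> D assms(4,5) T1 T2 t]) (use eD in auto)
    finally show "(\<Sum>n<N. ?F (e n) * ?G (e n) * ?c (e n)) \<le> ennreal (4 * K * \<theta> * sqrt (t1 * t2))" .
  qed
  finally show ?thesis .
qed

text \<open>The summand \<open>1\<close> makes the constant positive, also for \<open>K = 0\<close>.\<close>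

definition posop_const :: "real \<Rightarrow> real" where "posop_const K = 1 + 8 * kern_const * K * \<theta>"

lemma measurable_nn_integral_param:
  assumes "(\<lambda>p. F (fst p) (snd p)) \<in> borel_measurable (M \<Otimes>\<^sub>M M)"
  shows "(\<lambda>z. \<integral>\<^sup>+w. F z w \<partial>M) \<in> borel_measurable M"
  using sigma_finite_measure.borel_measurable_nn_integral_fst[OF sigma_finite_dA[OF alpha] assms] by simp

lemma measurable_posop [measurable]:
  assumes [measurable]: "\<phi> \<in> borel_measurable M"
  shows "posop \<alpha> \<phi> \<in> borel_measurable M"
proof -
  have "(\<lambda>z. \<integral>\<^sup>+w. ennreal (kern \<alpha> z w) * \<phi> w \<partial>M) \<in> borel_measurable M"
    by (rule measurable_nn_integral_param) measurable
  then show ?thesis unfolding posop_def[abs_def] .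
qed

lemma kernel_form_le:
  fixes \<phi> g :: "complex \<Rightarrow> ennreal"
  assumes \<mu>: "bekolle \<mu> K"
    and [measurable]: "\<phi> \<in> borel_measurable M" "g \<in> borel_measurable M"
    and T1: "energy \<phi> \<mu> = ennreal t1"
    and T2: "energy g \<mu> = ennreal t2"
    and t: "t1 \<ge> 0" "t2 \<ge> 0"
  shows "(\<integral>\<^sup>+z. g z * posop \<alpha> \<phi> z * ennreal (\<mu> z) \<partial>M) \<le> ennreal (posop_const K * sqrt (t1 * t2))"
proof -
  have [measurable]: "\<mu> \<in> borel_measurable M" and K: "K \<ge> 0" using \<mu> by (auto simp: bekolle_def)
  define f where "f = (\<lambda>w. \<phi> w * ennreal (\<mu> w))"
  have [measurable]: "f \<in> borel_measurable M" by (simp add: f_def)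
  have inv: "ennreal (\<mu> z) * ennreal (inverse (\<mu> z)) = 1" if "z \<in> upper_half" for z
  proof -
    have "\<mu> z > 0" using \<mu> that by (simp add: bekolle_def)
    then show ?thesis by (subst ennreal_mult[symmetric]) auto
  qed
  have f\<sigma>: "f z * ennreal (inverse (\<mu> z)) = \<phi> z" if "z \<in> upper_half" for z
    using inv[OF that] by (simp add: f_def mult.assoc)
  have T1': "(\<integral>\<^sup>+z. (f z)\<^sup>2 * ennreal (inverse (\<mu> z)) \<partial>M) = ennreal t1"
    unfolding T1[symmetric]
    by (intro nn_integral_cong) (simp add: power2_eq_square mult.assoc f\<sigma>, simp add: f_def mult_ac)
  have [measurable]: "(\<lambda>p. box_sum D1 (fst p) (snd p)) \<in> borel_measurable (M \<Otimes>\<^sub>M M)"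
     "(\<lambda>p. box_sum D2 (fst p) (snd p)) \<in> borel_measurable (M \<Otimes>\<^sub>M M)"
    using measurable_box_sum[OF dyadic1] measurable_box_sum[OF dyadic2] by (simp_all add: split_beta')
  have [measurable]: "box_sum D1 z \<in> borel_measurable M" "box_sum D2 z \<in> borel_measurable M" if "z \<in> upper_half" for z
    using measurable_compose_Pair1[OF _ measurable_box_sum[OF dyadic1], of z]
      measurable_compose_Pair1[OF _ measurable_box_sum[OF dyadic2], of z] that by simp_all
  let ?B = "\<lambda>D z. \<integral>\<^sup>+w. g z * ennreal (\<mu> z) * (box_sum D z w * (f w * ennreal (inverse (\<mu> w)))) \<partial>M"
  have mB [measurable]: "?B D1 \<in> borel_measurable M" "?B D2 \<in> borel_measurable M"
    by (rule measurable_nn_integral_param, measurable)+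
  have "(\<integral>\<^sup>+z. g z * posop \<alpha> \<phi> z * ennreal (\<mu> z) \<partial>M)
     \<le> (\<integral>\<^sup>+z. ennreal kern_const * (?B D1 z + ?B D2 z) \<partial>M)"
  proof (rule nn_integral_mono)
    fix z assume "z \<in> space M"
    then have z [simp]: "z \<in> upper_half" by simp
    have "g z * posop \<alpha> \<phi> z * ennreal (\<mu> z) = (\<integral>\<^sup>+w. g z * ennreal (\<mu> z) * (ennreal (kern \<alpha> z w) * \<phi> w) \<partial>M)"
      unfolding posop_def by (subst nn_integral_cmult) (auto simp: mult_ac)
    also have "\<dots> \<le> (\<integral>\<^sup>+w. ennreal kern_const * (g z * ennreal (\<mu> z) * (box_sum D1 z w * (f w * ennreal (inverse (\<mu> w))))
        + g z * ennreal (\<mu> z) * (box_sum D2 z w * (f w * ennreal (inverse (\<mu> w))))) \<partial>M)"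
    proof (rule nn_integral_mono)
      fix w assume "w \<in> space M"
      then have w: "w \<in> upper_half" by simp
      have "g z * ennreal (\<mu> z) * (ennreal (kern \<alpha> z w) * \<phi> w)
        \<le> g z * ennreal (\<mu> z) * ((ennreal kern_const * (box_sum D1 z w + box_sum D2 z w)) * \<phi> w)"
        by (intro mult_left_mono mult_right_mono kern_le_box_sum z w) auto
      then show "g z * ennreal (\<mu> z) * (ennreal (kern \<alpha> z w) * \<phi> w) \<le> ennreal kern_const * (g z * ennreal (\<mu> z) * (box_sum D1 z w * (f w * ennreal (inverse (\<mu> w))))
        + g z * ennreal (\<mu> z) * (box_sum D2 z w * (f w * ennreal (inverse (\<mu> w)))))"
        unfolding f\<sigma>[OF w] by (simp add: distrib_left distrib_right mult_ac)
    qed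
    also have "\<dots> = ennreal kern_const * (?B D1 z + ?B D2 z)"
      by (subst nn_integral_cmult) (auto simp: nn_integral_add)
    finally show "g z * posop \<alpha> \<phi> z * ennreal (\<mu> z) \<le> ennreal kern_const * (?B D1 z + ?B D2 z)" .
  qed
  also have "\<dots> = ennreal kern_const * ((\<integral>\<^sup>+z. ?B D1 z \<partial>M) + (\<integral>\<^sup>+z. ?B D2 z \<partial>M))"
    by (subst nn_integral_cmult) (auto simp: nn_integral_add)
  also have "\<dots> \<le> ennreal kern_const * (ennreal (4 * K * \<theta> * sqrt (t1 * t2)) + ennreal (4 * K * \<theta> * sqrt (t1 * t2)))"
    using box_form_le[OF \<mu> dyadic1 _ _ _ T1' T2 t] box_form_le[OF \<mu> dyadic2 _ _ _ T1' T2 t]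
    by (intro mult_left_mono add_mono) auto
  also have "\<dots> = ennreal (8 * kern_const * K * \<theta> * sqrt (t1 * t2))"
  proof -
    define X where "X = 4 * K * \<theta> * sqrt (t1 * t2)"
    have "X \<ge> 0" using K theta_pos t by (simp add: X_def)
    then have "ennreal kern_const * (ennreal X + ennreal X) = ennreal (kern_const * (X + X))"
      using kern_const_pos by (subst ennreal_plus[symmetric], simp, simp, subst ennreal_mult, simp_all)
    also have "kern_const * (X + X) = 8 * kern_const * K * \<theta> * sqrt (t1 * t2)" by (simp add: X_def)
    finally show ?thesis by (simp only: X_def)
  qed
  also have "\<dots> \<le> ennreal (posop_const K * sqrt (t1 * t2))"
    using t by (intro ennreal_leI mult_right_mono) (auto simp: posop_const_def)
  finally show ?thesis .
qed

lemma posop_const_pos: "K \<ge> 0 \<Longrightarrow> posop_const K > 0"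
  using kern_const_pos theta_pos by (simp add: posop_const_def add_pos_nonneg)

lemma cutoff_subset_box: "\<exists>J\<in>D1 \<union> D2. cutoff n \<subseteq> carleson J"
proof -
  obtain J where J: "J \<in> D1 \<union> D2" "{- real n - 1..real n + 1} \<subseteq> J"
    using cover[of "- real n - 1" "real n + 1"] by auto
  obtain a b where ab: "J = {a..<b}" "a < b" using half_open[OF J(1)] .
  have "a \<le> - real n - 1" "real n + 1 < b"
    using J(2) unfolding ab by (auto simp: atLeastAtMost_subseteq_atLeastLessThan_iff)
  then have "cutoff n \<subseteq> carleson J"
    using ab by (auto simp: carleson_half_open cutoff_def slab_def)
  then show ?thesis using J by blast
qed

lemma weight_cutoff_finite:
  assumes "bekolle \<mu> K"
  shows "mass \<mu> (cutoff n) < \<infinity>"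
proof -
  obtain J where J: "J \<in> D1 \<union> D2" "cutoff n \<subseteq> carleson J" using cutoff_subset_box by blast
  have "mass \<mu> (cutoff n) \<le> (mass \<mu> (carleson J))"
    using J(2) by (intro nn_integral_mono mult_left_mono) (auto simp: indicator_def)
  then show ?thesis using bekolle_finite[OF assms J(1)] by (rule order_le_less_trans)
qed

text \<open>Duality: the form bound is applied with \<open>g = P \<phi>\<close> itself, and one factor \<open>(\<integral> g\<^sup>2 \<mu>)\<^bsup>1/2\<^esup>\<close> is divided out.
As it must be finite for that, \<open>g\<close> is first restricted to sets where it is bounded and which have
finite mass. These exhaust the half plane up to a null set because \<open>P \<phi>\<close> is finite almost everywhere,
by the form bound for indicators.\<close>

lemma posop_bounded:
  fixes \<phi> :: "complex \<Rightarrow> ennreal"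
  assumes \<mu>: "bekolle \<mu> K" and [measurable]: "\<phi> \<in> borel_measurable M"
  shows "(\<integral>\<^sup>+z. (posop \<alpha> \<phi> z)\<^sup>2 * ennreal (\<mu> z) \<partial>M) \<le> ennreal ((posop_const K)\<^sup>2) * (energy \<phi> \<mu>)"
proof (cases "energy \<phi> \<mu> = \<infinity>")
  case True
  have "posop_const K > 0" using \<mu> posop_const_pos by (auto simp: bekolle_def)
  then show ?thesis unfolding True by (simp add: ennreal_mult_top)
next
  case False
  have [measurable]: "\<mu> \<in> borel_measurable M" and K: "K \<ge> 0" using \<mu> by (auto simp: bekolle_def)
  have C: "posop_const K > 0" using posop_const_pos[OF K] .
  obtain t1 where t1: "t1 \<ge> 0" "energy \<phi> \<mu> = ennreal t1"
    using False by (cases "\<integral>\<^sup>+z. (\<phi> z)\<^sup>2 * ennreal (\<mu> z) \<partial>M") auto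
  define h where "h = posop \<alpha> \<phi>"
  have [measurable]: "h \<in> borel_measurable M" by (simp add: h_def)
  have fin: "AE z in M. h z < \<infinity>"
  proof -
    have "AE z in M. z \<in> cutoff n \<longrightarrow> h z < \<infinity>" for n
    proof -
      let ?g = "indicator (cutoff n) :: complex \<Rightarrow> ennreal"
      have sq: "?g z * ?g z = ?g z" for z by (auto simp: indicator_def)
      obtain t2 where t2: "t2 \<ge> 0" "(\<integral>\<^sup>+z. (?g z)\<^sup>2 * ennreal (\<mu> z) \<partial>M) = ennreal t2"
        using weight_cutoff_finite[OF \<mu>, of n]
        by (cases "\<integral>\<^sup>+z. ennreal (\<mu> z) * indicator (cutoff n) z \<partial>M") (auto simp: power2_eq_square sq mult.commute)
      have "(\<integral>\<^sup>+z. ?g z * h z * ennreal (\<mu> z) \<partial>M) \<le> ennreal (posop_const K * sqrt (t1 * t2))"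
        unfolding h_def by (rule kernel_form_le[OF \<mu> _ _ t1(2) t2(2) t1(1) t2(1)]) measurable
      then have "(\<integral>\<^sup>+z. ?g z * h z * ennreal (\<mu> z) \<partial>M) \<noteq> \<infinity>" by (auto simp: top_unique)
      then have "AE z in M. ?g z * h z * ennreal (\<mu> z) \<noteq> \<infinity>"
        by (intro nn_integral_PInf_AE) auto
      then show ?thesis using AE_space
        by eventually_elim
          (use \<mu> in \<open>auto simp: bekolle_def ennreal_mult_eq_top_iff less_top indicator_def split: if_splits\<close>)
    qed
    then have "AE z in M. \<forall>n. z \<in> cutoff n \<longrightarrow> h z < \<infinity>"
      unfolding AE_all_countable by blast
    then show ?thesis using AE_space by eventually_elim (use UN_cutoff in auto)
  qed
  define N where "N = density M (\<lambda>z. (h z)\<^sup>2 * ennreal (\<mu> z))"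
  \<comment> \<open>The truncation makes the energy of \<open>h\<close> finite.\<close>
  define E where "E = (\<lambda>n::nat. {z \<in> cutoff n. h z \<le> of_nat n})"
  have E_sets [measurable]: "E n \<in> sets M" for n
  proof -
    have "E n = cutoff n \<inter> {z \<in> space M. h z \<le> of_nat n}"
      using cutoff_subset by (auto simp: E_def)
    also have "\<dots> \<in> sets M" by (intro sets.Int cutoff_sets) measurable
    finally show ?thesis .
  qed
  have E_le: "emeasure N (E n) \<le> ennreal ((posop_const K)\<^sup>2 * t1)" for n
  proof -
    let ?g = "\<lambda>z. h z * indicator (E n) z"
    have eN: "emeasure N (E n) = (\<integral>\<^sup>+z. (?g z)\<^sup>2 * ennreal (\<mu> z) \<partial>M)"
      unfolding N_def by (subst emeasure_density) (auto intro!: nn_integral_cong simp: indicator_def)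
    have "(\<integral>\<^sup>+z. (?g z)\<^sup>2 * ennreal (\<mu> z) \<partial>M) \<le> (\<integral>\<^sup>+z. (of_nat n)\<^sup>2 * (ennreal (\<mu> z) * indicator (cutoff n) z) \<partial>M)"
    proof (rule nn_integral_mono)
      fix z
      show "(?g z)\<^sup>2 * ennreal (\<mu> z) \<le> (of_nat n)\<^sup>2 * (ennreal (\<mu> z) * indicator (cutoff n) z)"
        by (auto simp: E_def indicator_def intro!: mult_right_mono power_mono)
    qed
    also have "\<dots> = (of_nat n)\<^sup>2 * (mass \<mu> (cutoff n))"
      by (rule nn_integral_cmult) measurable
    also have "\<dots> < \<infinity>" using weight_cutoff_finite[OF \<mu>, of n]
      by (simp add: ennreal_mult_less_top power2_eq_square ennreal_of_nat_eq_real_of_nat)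
    finally obtain t2 where t2: "t2 \<ge> 0" "(\<integral>\<^sup>+z. (?g z)\<^sup>2 * ennreal (\<mu> z) \<partial>M) = ennreal t2"
      by (cases "\<integral>\<^sup>+z. (?g z)\<^sup>2 * ennreal (\<mu> z) \<partial>M") auto
    have "ennreal t2 = (\<integral>\<^sup>+z. ?g z * h z * ennreal (\<mu> z) \<partial>M)"
      unfolding t2(2)[symmetric] by (intro nn_integral_cong) (auto simp: indicator_def power2_eq_square)
    also have "\<dots> \<le> ennreal (posop_const K * sqrt (t1 * t2))"
      unfolding h_def by (rule kernel_form_le[OF \<mu> _ _ t1(2) t2(2)[unfolded h_def] t1(1) t2(1)]) (simp_all add: h_def[symmetric])
    finally have "t2 \<le> posop_const K * sqrt (t1 * t2)"
      using C t1 t2 by (simp add: ennreal_le_iff)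
    then have "t2\<^sup>2 \<le> (posop_const K * sqrt (t1 * t2))\<^sup>2" using t2 by (intro power_mono) auto
    also have "\<dots> = (posop_const K)\<^sup>2 * t1 * t2" using t1 t2 by (simp add: power_mult_distrib)
    finally have "t2 \<le> (posop_const K)\<^sup>2 * t1"
      using t1 t2 by (cases "t2 = 0") (auto simp: power2_eq_square)
    then show ?thesis unfolding eN t2(2) by (rule ennreal_leI)
  qed
  have inc: "incseq E"
  proof (intro monoI subsetI)
    fix m n :: nat and z assume "m \<le> n" "z \<in> E m"
    then show "z \<in> E n" using incseq_cutoff[THEN monoD, of m n]
      by (auto simp: E_def intro: order_trans)
  qed
  have UN: "(\<Union>n. E n) = {z \<in> space M. h z < \<infinity>}"
  proof (intro equalityI subsetI)
    fix z assume "z \<in> (\<Union>n. E n)"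
    then show "z \<in> {z \<in> space M. h z < \<infinity>}"
      using cutoff_subset le_less_trans[OF _ ennreal_less_top]
      by (fastforce simp: E_def ennreal_of_nat_eq_real_of_nat)
  next
    fix z assume "z \<in> {z \<in> space M. h z < \<infinity>}"
    then have z: "z \<in> upper_half" "h z < \<infinity>" by auto
    obtain m where m: "z \<in> cutoff m" using z UN_cutoff by auto
    obtain r where r: "h z = ennreal r" "r \<ge> 0" using z(2) by (cases "h z") auto
    obtain k :: nat where k: "r \<le> real k" using real_arch_simple by blast
    have "z \<in> E (max m k)"
      using m k r incseq_cutoff[THEN monoD, of m "max m k"]
      by (auto simp: E_def ennreal_of_nat_eq_real_of_nat intro!: ennreal_leI)
    then show "z \<in> (\<Union>n. E n)" by blast
  qed
  have "energy h \<mu> = (\<integral>\<^sup>+z. (h z)\<^sup>2 * ennreal (\<mu> z) * indicator (\<Union>n. E n) z \<partial>M)"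
    by (rule nn_integral_cong_AE, use fin AE_space in eventually_elim) (simp add: UN)
  also have "\<dots> = emeasure N (\<Union>n. E n)"
    unfolding N_def by (subst emeasure_density) auto
  also have "\<dots> = (SUP n. emeasure N (E n))"
    by (rule SUP_emeasure_incseq[symmetric]) (use inc in \<open>auto simp: N_def\<close>)
  also have "\<dots> \<le> ennreal ((posop_const K)\<^sup>2 * t1)" by (intro SUP_least E_le)
  also have "\<dots> = ennreal ((posop_const K)\<^sup>2) * ennreal t1" using t1 by (simp add: ennreal_mult)
  finally show ?thesis unfolding h_def t1(2) .
qed

end

section \<open>Oscillation of holomorphic functions\<close>

text \<open>Lower bound for the height integral of the density over a small interval at height comparable to \<open>y\<close>;
the factor \<open>2\<^bsup>-|\<alpha>|\<^esup>\<close> covers both signs of \<open>\<alpha>\<close>.\<close>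

lemma powr_increment_ge:
  fixes \<alpha> y s \<rho> :: real
  assumes \<alpha>: "\<alpha> > -1" and y: "y > 0" and s: "y / 2 \<le> s" "s + \<rho> \<le> 2 * y" and \<rho>: "\<rho> > 0"
  shows "(1 + \<alpha>) * 2 powr (- \<bar>\<alpha>\<bar>) * y powr \<alpha> * \<rho> \<le> (s + \<rho>) powr (1 + \<alpha>) - s powr (1 + \<alpha>)"
proof -
  have "\<exists>\<xi>. s < \<xi> \<and> \<xi> < s + \<rho> \<and> (s + \<rho>) powr (1 + \<alpha>) - s powr (1 + \<alpha>) = (s + \<rho> - s) * ((1 + \<alpha>) * \<xi> powr \<alpha>)"
  proof (rule MVT2)
    fix x assume "s \<le> x" "x \<le> s + \<rho>"
    then have "x > 0" using y s by simp
    then show "((\<lambda>x. x powr (1 + \<alpha>)) has_real_derivative (1 + \<alpha>) * x powr \<alpha>) (at x)"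
      by (auto intro!: derivative_eq_intros)
  qed (use \<rho> in simp)
  then obtain \<xi> where \<xi>: "s < \<xi>" "\<xi> < s + \<rho>"
    "(s + \<rho>) powr (1 + \<alpha>) - s powr (1 + \<alpha>) = \<rho> * ((1 + \<alpha>) * \<xi> powr \<alpha>)" by auto
  have \<xi>0: "\<xi> > 0" using \<xi>(1) s y by simp
  have "2 powr (- \<bar>\<alpha>\<bar>) * y powr \<alpha> \<le> \<xi> powr \<alpha>"
  proof (cases "\<alpha> \<ge> 0")
    case True
    have "2 powr (- \<bar>\<alpha>\<bar>) * y powr \<alpha> = (y / 2) powr \<alpha>"
      using y True by (simp add: powr_divide powr_minus_divide)
    also have "\<dots> \<le> \<xi> powr \<alpha>" using True y \<xi> s by (intro powr_mono2) auto
    finally show ?thesis .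
  next
    case False
    have "2 powr (- \<bar>\<alpha>\<bar>) * y powr \<alpha> = (2 * y) powr \<alpha>"
      using y False by (simp add: powr_mult)
    also have "\<dots> \<le> \<xi> powr \<alpha>" using False \<xi> \<xi>0 s by (intro powr_mono2') auto
    finally show ?thesis .
  qed
  then have "\<rho> * (1 + \<alpha>) * (2 powr (- \<bar>\<alpha>\<bar>) * y powr \<alpha>) \<le> \<rho> * (1 + \<alpha>) * \<xi> powr \<alpha>"
    using \<rho> \<alpha> by (intro mult_left_mono) auto
  then show ?thesis using \<xi>(3) by (simp add: mult_ac)
qed

text \<open>A disc on which \<open>|f|\<close> is comparable to its value at the centre, and which is large enough in terms of
\<open>f z\<close>. The point \<open>u\<close> maximises \<open>(r - |u - z|)\<^sup>2 |f u|\<close>; with \<open>\<delta>\<close> half the distance of \<open>u\<close> from the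
circle, maximality gives \<open>|f| \<le> 4 |f u|\<close> within \<open>\<delta>\<close> of \<open>u\<close>, and Cauchy's estimate bounds the derivative
nearby by \<open>10 |f u| / \<delta>\<close>.\<close>

lemma holomorphic_local_max:
  fixes f :: "complex \<Rightarrow> complex"
  assumes r: "r > 0" and hol: "f holomorphic_on S" and S: "open S" "cball z r \<subseteq> S" and nz: "f z \<noteq> 0"
  obtains u \<delta> where "\<delta> > 0" "ball u (2 * \<delta>) \<subseteq> ball z r" "r\<^sup>2 * cmod (f z) \<le> 4 * \<delta>\<^sup>2 * cmod (f u)"
    "\<And>v. v \<in> cball u (\<delta> / 20) \<Longrightarrow> cmod (f u) \<le> 2 * cmod (f v)"
proof -
  let ?\<phi> = "\<lambda>u. (r - dist u z)\<^sup>2 * cmod (f u)"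
  have cont: "continuous_on (cball z r) f"
    using holomorphic_on_imp_continuous_on[OF hol] S(2) continuous_on_subset by blast
  have "continuous_on (cball z r) ?\<phi>" by (intro continuous_intros cont)
  then obtain u where u: "u \<in> cball z r" "\<And>v. v \<in> cball z r \<Longrightarrow> ?\<phi> v \<le> ?\<phi> u"
    using continuous_attains_sup[of "cball z r" ?\<phi>] r by (auto simp: compact_cball)
  have z: "r\<^sup>2 * cmod (f z) \<le> ?\<phi> u" using u(2)[of z] r by simp
  moreover have "r\<^sup>2 * cmod (f z) > 0" using r nz by simp
  ultimately have "?\<phi> u > 0" by linarith
  then have fu: "f u \<noteq> 0" and "r - dist u z \<noteq> 0" by auto
  define \<delta> where "\<delta> = (r - dist u z) / 2"
  have \<delta>: "\<delta> > 0" using u(1) \<open>r - dist u z \<noteq> 0\<close> by (auto simp: \<delta>_def dist_commute)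
  have r\<delta>: "r = dist u z + 2 * \<delta>" by (simp add: \<delta>_def field_simps)
  have sub: "ball u (2 * \<delta>) \<subseteq> ball z r"
  proof
    fix v assume "v \<in> ball u (2 * \<delta>)"
    then have "dist z v < r" unfolding r\<delta> using dist_triangle[of z v u] by (simp add: dist_commute)
    then show "v \<in> ball z r" by simp
  qed
  have le4: "cmod (f v) \<le> 4 * cmod (f u)" if v: "v \<in> cball u \<delta>" for v
  proof -
    have d: "dist v z \<le> dist u z + \<delta>" using v dist_triangle[of v z u] by (simp add: dist_commute)
    then have vz: "v \<in> cball z r" using \<delta> r\<delta> by (simp add: dist_commute)
    have "\<delta>\<^sup>2 * cmod (f v) \<le> ?\<phi> v"
      using d r\<delta> \<delta> by (intro mult_right_mono power_mono) auto
    also have "\<dots> \<le> ?\<phi> u" using u(2)[OF vz] .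
    also have "\<dots> = \<delta>\<^sup>2 * (4 * cmod (f u))" by (simp add: \<delta>_def power_divide)
    finally show ?thesis using \<delta> by simp
  qed
  have deriv: "cmod (deriv f v) \<le> 10 * cmod (f u) / \<delta>" if v: "v \<in> ball u (\<delta> / 2)" for v
  proof -
    have sub': "cball v (\<delta>/2) \<subseteq> cball u \<delta>"
    proof
      fix x assume "x \<in> cball v (\<delta>/2)"
      then show "x \<in> cball u \<delta>" using v dist_triangle[of u x v] by simp
    qed
    have "cball u \<delta> \<subseteq> ball u (2 * \<delta>)" using \<delta> by auto
    then have subS: "cball v (\<delta>/2) \<subseteq> S" using sub sub' S(2) ball_subset_cball[of z r] by blast
    have "cmod ((deriv ^^ 1) f v) \<le> fact 1 * (5 * cmod (f u)) / (\<delta>/2) ^ 1"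
    proof (rule Cauchy_higher_deriv_bound)
      show "f holomorphic_on ball v (\<delta>/2)" using hol subS holomorphic_on_subset ball_subset_cball by blast
      show "continuous_on (cball v (\<delta>/2)) f"
        using holomorphic_on_imp_continuous_on[OF hol] subS continuous_on_subset by blast
      show "f w \<in> ball 0 (5 * cmod (f u))" if "w \<in> ball v (\<delta>/2)" for w
      proof -
        have "w \<in> cball u \<delta>" using sub' that ball_subset_cball[of v "\<delta>/2"] by blast
        then have "cmod (f w) \<le> 4 * cmod (f u)" by (rule le4)
        moreover have "cmod (f u) > 0" using fu by simp
        ultimately have "cmod (f w) < 5 * cmod (f u)" by linarith
        then show ?thesis by simp
      qed
    qed (use \<delta> in auto)
    then show ?thesis using \<delta> by (simp add: field_simps)
  qed
  have half: "cmod (f u) \<le> 2 * cmod (f v)" if v: "v \<in> cball u (\<delta> / 20)" for v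
  proof -
    have sb: "cball u (\<delta>/20) \<subseteq> ball u (\<delta>/2)" "cball u (\<delta>/20) \<subseteq> S"
    proof -
      show "cball u (\<delta>/20) \<subseteq> ball u (\<delta>/2)" using \<delta> by auto
      have "cball u (\<delta>/20) \<subseteq> ball u (2 * \<delta>)" using \<delta> by auto
      then show "cball u (\<delta>/20) \<subseteq> S" using sub S(2) ball_subset_cball[of z r] by blast
    qed
    have "cmod (f v - f u) \<le> (10 * cmod (f u) / \<delta>) * cmod (v - u)"
    proof (rule field_differentiable_bound[of "cball u (\<delta>/20)" f "deriv f"])
      fix x assume x: "x \<in> cball u (\<delta>/20)"
      have "(f has_field_derivative deriv f x) (at x)"
        using hol S(1) sb(2) x holomorphic_derivI by blast
      then show "(f has_field_derivative deriv f x) (at x within cball u (\<delta>/20))"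
        by (rule has_field_derivative_at_within)
      show "cmod (deriv f x) \<le> 10 * cmod (f u) / \<delta>" using deriv sb(1) x by blast
    qed (use v \<delta> in auto)
    also have "\<dots> \<le> (10 * cmod (f u) / \<delta>) * (\<delta> / 20)"
      using v \<delta> by (intro mult_left_mono) (auto simp: dist_norm norm_minus_commute)
    also have "\<dots> = cmod (f u) / 2" using \<delta> by simp
    finally have "cmod (f v - f u) \<le> cmod (f u) / 2" .
    moreover have "cmod (f u) \<le> cmod (f v) + cmod (f v - f u)"
      using norm_triangle_ineq[of "f v" "f u - f v"] by (simp add: norm_minus_commute)
    ultimately show ?thesis by simp
  qed
  have "r\<^sup>2 * cmod (f z) \<le> 4 * \<delta>\<^sup>2 * cmod (f u)"
    using z by (simp add: \<delta>_def power_divide)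
  then show ?thesis using that \<delta> sub half by blast
qed

text \<open>The terms that occur are those with \<open>2\<^sup>k y \<ge> d / c\<close>; they at least halve from one \<open>k\<close> to the next, so
their sum is at most twice the first.\<close>

lemma geometric_sum_le:
  fixes y d c s :: real
  assumes y: "y > 0" and c: "c > 0" and d: "d > 0" and s: "s \<ge> 1"
  shows "(\<Sum>k\<le>n. if d \<le> c * (2 ^ k * y) then (2 ^ k * y) powr (- s) else 0)
      \<le> (if d \<le> c * (2 ^ n * y) then 2 * c powr s * d powr (- s) else 0)"
proof -
  have step: "2 * (2 ^ Suc k * y) powr (- s) \<le> (2 ^ k * y) powr (- s)" for k
  proof -
    have "(2 ^ Suc k * y) powr (- s) = 2 powr (- s) * (2 ^ k * y) powr (- s)"
      using y powr_mult[of 2 "2 ^ k * y" "- s"] by (simp add: mult.assoc)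
    moreover have "2 * 2 powr (- s) \<le> (1::real)"
    proof -
      have "2 powr (- s) \<le> 2 powr (-1 :: real)" using s by (intro powr_mono) auto
      then show ?thesis by (simp add: powr_minus)
    qed
    then have "2 * 2 powr (- s) * (2 ^ k * y) powr (- s) \<le> 1 * (2 ^ k * y) powr (- s)"
      by (intro mult_right_mono) auto
    ultimately show ?thesis by simp
  qed
  have mon: "(2 ^ k * y) powr (- s) \<le> c powr s * d powr (- s)" if "d \<le> c * (2 ^ k * y)" for k
  proof -
    have "d / c \<le> 2 ^ k * y" using that c by (simp add: field_simps)
    then have "(2 ^ k * y) powr (- s) \<le> (d / c) powr (- s)"
      using d c s by (intro powr_mono2') auto
    also have "\<dots> = c powr s * d powr (- s)" using c d by (simp add: powr_divide powr_minus field_simps)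
    finally show ?thesis .
  qed
  have "(\<Sum>k\<le>n. if d \<le> c * (2 ^ k * y) then (2 ^ k * y) powr (- s) else 0)
      \<le> (if d \<le> c * (2 ^ n * y) then 2 * c powr s * d powr (- s) - (2 ^ n * y) powr (- s) else 0)"
  proof (induction n)
    case 0
    then show ?case using mon[of 0] by simp
  next
    case (Suc n)
    show ?case
    proof (cases "d \<le> c * (2 ^ n * y)")
      case True
      have "c * (2 ^ n * y) \<le> c * (2 ^ Suc n * y)" using c y by (intro mult_left_mono mult_right_mono) auto
      then have T: "d \<le> c * (2 ^ Suc n * y)" using True by linarith
      have "(\<Sum>k\<le>Suc n. if d \<le> c * (2 ^ k * y) then (2 ^ k * y) powr (- s) else 0)
        = (\<Sum>k\<le>n. if d \<le> c * (2 ^ k * y) then (2 ^ k * y) powr (- s) else 0) + (2 ^ Suc n * y) powr (- s)"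
        using T by (simp only: sum.atMost_Suc if_True)
      then show ?thesis using Suc.IH True T step[of n] by (simp only: if_True)
    next
      case False
      show ?thesis
      proof (cases "d \<le> c * (2 ^ Suc n * y)")
        case T: True
        show ?thesis using Suc.IH False T mon[OF T] by (simp only: sum.atMost_Suc if_True if_False)
      next
        case F: False
        show ?thesis using Suc.IH False F by (simp only: sum.atMost_Suc if_True if_False)
      qed
    qed
  qed
  also have "\<dots> \<le> (if d \<le> c * (2 ^ n * y) then 2 * c powr s * d powr (- s) else 0)"
    by simp
  finally show ?thesis .
qed

lemma cmod_diff_average_le:
  assumes [measurable]: "b \<in> borel_measurable N" "E \<in> sets N"
  shows "ennreal (cmod (c - d)) * emeasure N E \<le> (\<integral>\<^sup>+x. ennreal (cmod (b x - c)) * indicator E x \<partial>N) + (\<integral>\<^sup>+x. ennreal (cmod (b x - d)) * indicator E x \<partial>N)"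
proof -
  have "ennreal (cmod (c - d)) * emeasure N E = (\<integral>\<^sup>+x. ennreal (cmod (c - d)) * indicator E x \<partial>N)"
    by (simp add: nn_integral_cmult_indicator)
  also have "\<dots> \<le> (\<integral>\<^sup>+x. ennreal (cmod (b x - c)) * indicator E x + ennreal (cmod (b x - d)) * indicator E x \<partial>N)"
  proof (rule nn_integral_mono)
    fix x
    have "cmod (c - d) \<le> cmod (b x - c) + cmod (b x - d)"
      using norm_triangle_ineq4[of "b x - d" "b x - c"] by simp
    then have "ennreal (cmod (c - d)) \<le> ennreal (cmod (b x - c)) + ennreal (cmod (b x - d))"
      by (simp add: ennreal_plus[symmetric] del: ennreal_plus)
    then show "ennreal (cmod (c - d)) * indicator E x \<le> ennreal (cmod (b x - c)) * indicator E x + ennreal (cmod (b x - d)) * indicator E x"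
      by (auto simp: indicator_def)
  qed
  also have "\<dots> = (\<integral>\<^sup>+x. ennreal (cmod (b x - c)) * indicator E x \<partial>N) + (\<integral>\<^sup>+x. ennreal (cmod (b x - d)) * indicator E x \<partial>N)"
    by (rule nn_integral_add) measurable
  finally show ?thesis .
qed

lemma open_upper_half: "open upper_half"
  unfolding upper_half_def by (rule open_halfspace_Im_gt)

context half_plane begin

text \<open>The constant \<open>12800 = 32 \<cdot> 20\<^sup>2\<close> comes from the radius \<open>\<delta> / 20\<close> of the disc and from the factors lost in
comparing \<open>f\<close> with its values on this disc.\<close>

definition c_mean :: real where
  "c_mean = 12800 / (box_const * (1 + \<alpha>) * 2 powr (- \<bar>\<alpha>\<bar>))"

lemma c_mean_pos: "c_mean > 0" using box_const_pos alpha by (simp add: c_mean_def)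

text \<open>The sub-mean value property with respect to \<open>M\<close> on a disc at distance from the boundary comparable to
its radius. The maximum argument yields a smaller disc on which \<open>|f|\<close> is at least half its value at the
centre, and the integral over a square inside that disc can be bounded from below.\<close>

lemma sub_mean_value:
  assumes hol: "f holomorphic_on upper_half" and z: "z \<in> upper_half"
  shows "ennreal (cmod (f z)) \<le> ennreal (c_mean * (Im z) powr (- (2 + \<alpha>))) *
     (\<integral>\<^sup>+v. ennreal (cmod (f v)) * indicator (ball z (Im z / 2)) v \<partial>M)"
proof (cases "f z = 0")
  case False
  define y where "y = Im z"
  have y: "y > 0" using z by (simp add: y_def upper_half_def)
  have Im_near: "Im v \<ge> y / 2 \<and> Im v \<le> 3 * y / 2" if "v \<in> cball z (y/2)" for v
    using abs_Im_le_cmod[of "z - v"] that by (auto simp: dist_norm y_def abs_le_iff)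
  have sub: "cball z (y/2) \<subseteq> upper_half"
  proof
    fix v assume "v \<in> cball z (y/2)"
    from Im_near[OF this] have "Im v > 0" using y by linarith
    then show "v \<in> upper_half" by (simp add: upper_half_def)
  qed
  obtain u \<delta> where u: "\<delta> > 0" "ball u (2 * \<delta>) \<subseteq> ball z (y/2)" "(y/2)\<^sup>2 * cmod (f z) \<le> 4 * \<delta>\<^sup>2 * cmod (f u)"
    "\<And>v. v \<in> cball u (\<delta> / 20) \<Longrightarrow> cmod (f u) \<le> 2 * cmod (f v)"
    using holomorphic_local_max[OF half_gt_zero[OF y] hol open_upper_half sub False] by metis
  define \<rho> where "\<rho> = \<delta> / 20"
  have \<rho>: "\<rho> > 0" using u by (simp add: \<rho>_def)
  \<comment> \<open>A square inside the disc, whose measure is known explicitly.\<close>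
  define a s where "a = Re u - \<rho>/2" and "s = Im u - \<rho>/2"
  let ?S = "slab a (a + \<rho>) s (s + \<rho>)"
  have S_sub: "?S \<subseteq> cball u \<rho>"
  proof
    fix v assume v: "v \<in> ?S"
    have "a \<le> Re v" "Re v < a + \<rho>" "s \<le> Im v" "Im v < s + \<rho>" using v by (simp_all add: slab_def)
    then have "\<bar>Re (u - v)\<bar> \<le> \<rho>/2" "\<bar>Im (u - v)\<bar> \<le> \<rho>/2"
      unfolding a_def s_def abs_le_iff minus_complex.simps by linarith+
    then have "\<bar>Re (u - v)\<bar> + \<bar>Im (u - v)\<bar> \<le> \<rho>/2 + \<rho>/2" by (rule add_mono)
    with cmod_le[of "u - v"] have "cmod (u - v) \<le> \<rho>/2 + \<rho>/2" by (rule order_trans)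
    also have "\<dots> = \<rho>" by simp
    finally show "v \<in> cball u \<rho>" by (simp add: dist_norm)
  qed
  have cb: "cball u \<rho> \<subseteq> ball z (y/2)" 
  proof
    fix v assume "v \<in> cball u \<rho>"
    then have "v \<in> ball u (2 * \<delta>)" using u(1) by (simp add: \<rho>_def)
    then show "v \<in> ball z (y/2)" using u(2) by blast
  qed
  have ends: "y / 2 \<le> s" "s + \<rho> \<le> 2 * y"
  proof -
    have "Complex (Re u) s \<in> cball u \<rho>" "Complex (Re u) (s + \<rho>) \<in> cball u \<rho>"
      using \<rho> cmod_le[of "u - Complex (Re u) s"] cmod_le[of "u - Complex (Re u) (s + \<rho>)"]
      by (simp_all add: dist_norm s_def)
    then have "Complex (Re u) s \<in> cball z (y/2)" "Complex (Re u) (s + \<rho>) \<in> cball z (y/2)"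
      using cb ball_subset_cball by blast+
    then have "y / 2 \<le> s" "s + \<rho> \<le> 3 * y / 2" using Im_near by fastforce+
    then show "y / 2 \<le> s" "s + \<rho> \<le> 2 * y" using y by linarith+
  qed
  let ?\<kappa> = "box_const * (1 + \<alpha>) * 2 powr (- \<bar>\<alpha>\<bar>)"
  have \<kappa>: "?\<kappa> > 0" using box_const_pos alpha by simp
  have mS: "emeasure M ?S \<ge> ennreal (?\<kappa> * y powr \<alpha> * \<rho>\<^sup>2)"
  proof -
    have "emeasure M ?S = ennreal (box_const * \<rho> * ((s + \<rho>) powr (1 + \<alpha>) - s powr (1 + \<alpha>)))"
      using emeasure_slab[OF alpha, of s "s + \<rho>" a "a + \<rho>"] ends y \<rho> by (simp add: box_const_def)
    also have "\<dots> \<ge> ennreal (box_const * \<rho> * ((1 + \<alpha>) * 2 powr (- \<bar>\<alpha>\<bar>) * y powr \<alpha> * \<rho>))"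
      using box_const_pos \<rho> by (intro ennreal_leI mult_left_mono powr_increment_ge[OF alpha y ends \<rho>]) auto
    also have "box_const * \<rho> * ((1 + \<alpha>) * 2 powr (- \<bar>\<alpha>\<bar>) * y powr \<alpha> * \<rho>) = ?\<kappa> * y powr \<alpha> * \<rho>\<^sup>2"
      by (simp add: power2_eq_square mult_ac)
    finally show ?thesis .
  qed
  have "ennreal (cmod (f u) / 2 * (?\<kappa> * y powr \<alpha> * \<rho>\<^sup>2)) \<le> ennreal (cmod (f u) / 2) * emeasure M ?S"
    using mS \<kappa> by (subst ennreal_mult) (auto intro!: mult_left_mono)
  also have "\<dots> = (\<integral>\<^sup>+v. ennreal (cmod (f u) / 2) * indicator ?S v \<partial>M)"
    by (simp add: nn_integral_cmult_indicator)
  also have "\<dots> \<le> (\<integral>\<^sup>+v. ennreal (cmod (f v)) * indicator (ball z (y/2)) v \<partial>M)"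
  proof (rule nn_integral_mono)
    fix v
    show "ennreal (cmod (f u) / 2) * indicator ?S v \<le> ennreal (cmod (f v)) * indicator (ball z (y/2)) v"
    proof (cases "v \<in> ?S")
      case True
      then have "v \<in> cball u (\<delta>/20)" "v \<in> ball z (y/2)" using S_sub cb by (auto simp: \<rho>_def)
      then have "ennreal (cmod (f u) / 2) \<le> ennreal (cmod (f v))"
        using u(4)[of v] by (intro ennreal_leI) simp
      then show ?thesis using True \<open>v \<in> ball z (y/2)\<close> by (simp only: indicator_simps mult_1_right)
    qed simp
  qed
  finally have 1: "ennreal (cmod (f u) / 2 * (?\<kappa> * y powr \<alpha> * \<rho>\<^sup>2)) \<le> (\<integral>\<^sup>+v. ennreal (cmod (f v)) * indicator (ball z (y/2)) v \<partial>M)" .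
  have yp: "y powr (- (2 + \<alpha>)) * y powr \<alpha> = 1 / y\<^sup>2"
  proof -
    have "y powr (- (2 + \<alpha>)) * y powr \<alpha> = y powr (- (2 + \<alpha>) + \<alpha>)" by (rule powr_add[symmetric])
    also have "- (2 + \<alpha>) + \<alpha> = - 2" by simp
    finally show ?thesis using y by (simp add: powr_minus_divide)
  qed
  have "y\<^sup>2 * cmod (f z) \<le> 16 * \<delta>\<^sup>2 * cmod (f u)"
    using u(3) by (simp add: power_divide)
  then have "cmod (f z) \<le> (16 * \<delta>\<^sup>2 * cmod (f u)) / y\<^sup>2"
    using y by (simp add: pos_le_divide_eq mult.commute)
  also have "\<dots> = 12800 * (cmod (f u) / 2 * \<rho>\<^sup>2) / y\<^sup>2" by (simp add: \<rho>_def power_divide)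
  also have "\<dots> = c_mean * ?\<kappa> * (cmod (f u) / 2 * \<rho>\<^sup>2) / y\<^sup>2"
  proof -
    have "c_mean * ?\<kappa> = 12800" unfolding c_mean_def using \<kappa> by (metis less_irrefl nonzero_eq_divide_eq)
    then show ?thesis by (simp only:)
  qed
  also have "\<dots> = c_mean * (1 / y\<^sup>2) * (cmod (f u) / 2 * (?\<kappa> * \<rho>\<^sup>2))"
    by (simp only: divide_inverse mult_ac mult_1_left mult_1_right)
  also have "\<dots> = c_mean * (y powr (- (2 + \<alpha>)) * y powr \<alpha>) * (cmod (f u) / 2 * (?\<kappa> * \<rho>\<^sup>2))"
    by (simp only: yp)
  also have "\<dots> = c_mean * y powr (- (2 + \<alpha>)) * (cmod (f u) / 2 * (?\<kappa> * y powr \<alpha> * \<rho>\<^sup>2))"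
    by (simp only: mult_ac)
  finally have "ennreal (cmod (f z)) \<le> ennreal (c_mean * y powr (- (2 + \<alpha>))) * ennreal (cmod (f u) / 2 * (?\<kappa> * y powr \<alpha> * \<rho>\<^sup>2))"
    using c_mean_pos \<kappa> by (subst ennreal_mult[symmetric]) (auto intro!: ennreal_leI)
  also have "\<dots> \<le> ennreal (c_mean * y powr (- (2 + \<alpha>))) * (\<integral>\<^sup>+v. ennreal (cmod (f v)) * indicator (ball z (y/2)) v \<partial>M)"
    by (intro mult_left_mono 1) simp
  finally show ?thesis by (simp add: y_def)
qed simp

end

lemma ennreal_double: "B \<ge> 0 \<Longrightarrow> ennreal B * x + ennreal B * x = ennreal (2 * B) * x"
  by (simp only: distrib_right[symmetric] ennreal_plus[symmetric] mult_2)

lemma ennreal_le_add: "x \<le> y + z \<Longrightarrow> 0 \<le> y \<Longrightarrow> 0 \<le> z \<Longrightarrow> ennreal x \<le> ennreal y + ennreal z"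
  by (metis ennreal_leI ennreal_plus)

context half_plane begin

text \<open>\<open>J\<close> is a dyadic interval of the scale \<open>t\<close> around \<open>x\<close>. The factor \<open>10\<close> leaves room for the common last box
of two chains.\<close>

definition box_at :: "real set \<Rightarrow> real \<Rightarrow> real \<Rightarrow> bool" where
  "box_at J x t \<longleftrightarrow> J \<in> D1 \<union> D2 \<and> {x - t..x + t} \<subseteq> J \<and> len J \<le> 10 * C0 * t"

lemma box_at_exists:
  assumes "t > 0"
  obtains J where "box_at J x t"
proof -
  obtain J where J: "J \<in> D1 \<union> D2" "{x - t..x + t} \<subseteq> J" "len J \<le> C0 * (x + t - (x - t))"
    using cover[of "x - t" "x + t"] assms by auto
  have "C0 * (x + t - (x - t)) = 2 * (C0 * t)" by (simp add: algebra_simps)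
  moreover have "C0 * t \<ge> 0" using C0 assms by simp
  ultimately have "len J \<le> 10 * C0 * t" using J(3) by simp
  then show ?thesis using J that by (auto simp: box_at_def)
qed

lemma box_len_ge:
  assumes "J \<in> D1 \<union> D2" "{x - t..x + t} \<subseteq> J" "t > 0"
  shows "2 * t < len J"
proof -
  obtain a b where ab: "J = {a..<b}" "a < b" using half_open[OF assms(1)] .
  have "a \<le> x - t" "x + t < b"
    using assms(2,3) unfolding ab by (auto simp: atLeastAtMost_subseteq_atLeastLessThan_iff)
  then show ?thesis using ab by (simp add: len_atLeastLessThan)
qed

definition c_box :: real where "c_box = 1 / (box_const * 2 powr (2 + \<alpha>))"

lemma c_box_pos: "c_box > 0" using box_const_pos by (simp add: c_box_def)

text \<open>Both averages are compared with \<open>b\<close> on the smaller box over the common interval.\<close>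

lemma box_avg_compare:
  assumes [measurable]: "b \<in> borel_measurable M" and t: "t > 0"
    and J: "J \<in> D1 \<union> D2" "{x - t..x + t} \<subseteq> J" and J': "J' \<in> D1 \<union> D2" "{x - t..x + t} \<subseteq> J'"
  shows "ennreal (cmod (c - d)) \<le> ennreal (c_box * t powr (- (2 + \<alpha>))) *
     ((deviation b c (carleson J))
      + (deviation b d (carleson J')))"
proof -
  let ?E = "carleson {x - t..<x + t}"
  let ?I = "\<lambda>E c. \<integral>\<^sup>+v. ennreal (cmod (b v - c)) * indicator E v \<partial>M"
  have len: "len {x - t..<x + t} = 2 * t" using t by (simp add: len_atLeastLessThan)
  have E [measurable]: "?E \<in> sets M" using carleson_half_open[of "x - t" "x + t"] t slab_sets_dA by simp
  have sub: "?E \<subseteq> carleson J" "?E \<subseteq> carleson J'"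
    using box_len_ge[OF J t] box_len_ge[OF J' t] J(2) J'(2) by (auto simp: carleson_def len)
  have mono: "?I ?E c \<le> ?I F c" if "?E \<subseteq> F" for F c
    using that by (intro nn_integral_mono mult_left_mono) (auto simp: indicator_def)
  have eE: "emeasure M ?E = ennreal (box_const * (2 * t) powr (2 + \<alpha>))"
    using carleson_measure[of "x - t" "x + t"] t by (simp add: mult.commute)
  have "ennreal (cmod (c - d)) * emeasure M ?E \<le> ?I ?E c + ?I ?E d"
    by (rule cmod_diff_average_le) measurable
  also have "\<dots> \<le> ?I (carleson J) c + ?I (carleson J') d"
    by (intro add_mono mono sub)
  finally have le: "ennreal (cmod (c - d)) * emeasure M ?E \<le> ?I (carleson J) c + ?I (carleson J') d" .
  have 1: "(c_box * t powr (- (2 + \<alpha>))) * (box_const * (2 * t) powr (2 + \<alpha>)) = 1"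
  proof -
    have "(2 * t) powr (2 + \<alpha>) = 2 powr (2 + \<alpha>) * t powr (2 + \<alpha>)" using t by (intro powr_mult) 
    then show ?thesis using t box_const_pos by (simp add: c_box_def powr_minus_divide del: minus_add_distrib)
  qed
  have "ennreal (cmod (c - d)) = ennreal (c_box * t powr (- (2 + \<alpha>))) * (ennreal (cmod (c - d)) * emeasure M ?E)"
  proof -
    have "ennreal (c_box * t powr (- (2 + \<alpha>))) * emeasure M ?E = 1"
      unfolding eE using c_box_pos box_const_pos by (subst ennreal_mult[symmetric]) (simp_all add: 1 del: minus_add_distrib)
    then show ?thesis by (simp add: mult.left_commute)
  qed
  also have "\<dots> \<le> ennreal (c_box * t powr (- (2 + \<alpha>))) * (?I (carleson J) c + ?I (carleson J') d)"
    by (intro mult_left_mono le) simp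
  finally show ?thesis .
qed

text \<open>If \<open>Im z \<le> t\<close>, a box at scale \<open>t\<close> around \<open>Re z\<close> lies within \<open>d\<close>-distance \<open>c_near * t\<close> of \<open>z\<close>.\<close>

definition c_near :: real where "c_near = 20 * C0 + 1"

lemma hdist_in_box_at:
  assumes J: "box_at J (Re z) t" and z: "0 < Im z" "Im z \<le> t" and v: "v \<in> carleson J"
  shows "hdist z v \<le> c_near * t"
proof -
  obtain a b where ab: "J = {a..<b}" "a < b" using half_open J by (auto simp: box_at_def)
  have "Re z \<in> J" using J z by (auto simp: box_at_def)
  have l: "len J = b - a" using ab by (simp add: len_atLeastLessThan)
  have v': "a \<le> Re v" "Re v < b" "0 < Im v" "Im v < b - a" using v ab l by (auto simp: carleson_def)
  have "a \<le> Re z" "Re z < b" using \<open>Re z \<in> J\<close> ab by auto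
  then have "\<bar>Re z - Re v\<bar> \<le> b - a" using v' by (simp add: abs_le_iff)
  moreover have "\<bar>Im z + Im v\<bar> \<le> t + (b - a)" using v' z by (simp add: abs_le_iff)
  ultimately have "hdist z v \<le> (b - a) + (t + (b - a))" using order_trans[OF hdist_le add_mono] by blast
  also have "\<dots> = 2 * len J + t" by (simp add: l)
  also have "\<dots> \<le> 2 * (10 * C0 * t) + t" using J by (auto simp: box_at_def)
  also have "\<dots> = c_near * t" by (simp add: c_near_def algebra_simps)
  finally show ?thesis .
qed

lemma c_near_pos: "c_near > 0" using C0 by (simp add: c_near_def)

definition ball_mass :: "(complex \<Rightarrow> real) \<Rightarrow> complex \<Rightarrow> real \<Rightarrow> ennreal" where
  "ball_mass \<nu> z R = (\<integral>\<^sup>+v. ennreal (\<nu> v) * indicator {v. hdist z v \<le> R} v \<partial>M)"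

definition potential :: "(complex \<Rightarrow> real) \<Rightarrow> complex \<Rightarrow> real \<Rightarrow> ennreal" where
  "potential \<nu> z R = (\<integral>\<^sup>+v. ennreal (\<nu> v) * ennreal (kern \<alpha> z v) * indicator {v. hdist z v \<le> R} v \<partial>M)"

lemma ball_mass_mono: "R \<le> R' \<Longrightarrow> ball_mass \<nu> z R \<le> ball_mass \<nu> z R'"
  unfolding ball_mass_def by (intro nn_integral_mono mult_left_mono) (auto simp: indicator_def)

lemma box_le_ball_mass:
  assumes "box_at J (Re z) t" "0 < Im z" "Im z \<le> t"
  shows "mass \<nu> (carleson J) \<le> ball_mass \<nu> z (c_near * t)"
  unfolding ball_mass_def using hdist_in_box_at[OF assms]
  by (intro nn_integral_mono mult_left_mono) (auto simp: indicator_def)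

text \<open>The inequality behind the BMO norm in multiplied form.\<close>

definition bmo_bound :: "(complex \<Rightarrow> real) \<Rightarrow> (complex \<Rightarrow> complex) \<Rightarrow> real \<Rightarrow> bool" where
  "bmo_bound \<nu> b B \<longleftrightarrow> B \<ge> 0 \<and> (\<forall>J\<in>D1 \<union> D2.
     (deviation b (box_avg \<alpha> b J) (carleson J))
       \<le> ennreal B * (mass \<nu> (carleson J)))"

definition c_chain :: real where "c_chain = c_mean + 2 * 2 powr (2 + \<alpha>) * c_box"

lemma c_chain_ge: "c_mean \<le> c_chain" "2 * 2 powr (2 + \<alpha>) * c_box \<le> c_chain"
  using c_mean_pos c_box_pos by (simp_all add: c_chain_def)

text \<open>The disc around \<open>z\<close> of radius \<open>Im z / 2\<close> lies in the box, whose side is comparable to \<open>Im z\<close>.\<close>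

lemma chain_start:
  assumes hol: "b holomorphic_on upper_half" and B: "bmo_bound \<nu> b B" and z: "z \<in> upper_half"
    and J: "box_at J (Re z) (Im z)"
  shows "ennreal (cmod (b z - box_avg \<alpha> b J)) \<le> ennreal (B * c_chain * Im z powr (- (2 + \<alpha>))) * ball_mass \<nu> z (c_near * Im z)"
proof -
  let ?c = "box_avg \<alpha> b J"
  have y: "Im z > 0" using z by (simp add: upper_half_def)
  have J': "J \<in> D1 \<union> D2" "{Re z - Im z..Re z + Im z} \<subseteq> J" using J by (auto simp: box_at_def)
  have sub: "ball z (Im z / 2) \<subseteq> carleson J"
  proof
    fix v assume "v \<in> ball z (Im z / 2)"
    then have "cmod (z - v) < Im z / 2" by (simp add: dist_norm)
    then have d: "\<bar>Re z - Re v\<bar> < Im z / 2" "\<bar>Im z - Im v\<bar> < Im z / 2"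
      using abs_Re_le_cmod[of "z - v"] abs_Im_le_cmod[of "z - v"] by auto
    then have "Re v \<in> {Re z - Im z..Re z + Im z}" using y unfolding abs_less_iff atLeastAtMost_iff by linarith
    moreover have "0 < Im v" "Im v < 2 * Im z" using d(2) y unfolding abs_less_iff by linarith+
    ultimately show "v \<in> carleson J" using J'(2) box_len_ge[OF J' y] by (auto simp: carleson_def)
  qed
  have "(\<lambda>v. b v - ?c) holomorphic_on upper_half" using hol by (intro holomorphic_intros)
  then have "ennreal (cmod (b z - ?c)) \<le> ennreal (c_mean * (Im z) powr (- (2 + \<alpha>))) *
     (deviation b ?c (ball z (Im z / 2)))"
    using sub_mean_value z by blast
  also have "\<dots> \<le> ennreal (c_mean * (Im z) powr (- (2 + \<alpha>))) *
     (deviation b ?c (carleson J))"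
    using sub by (intro mult_left_mono nn_integral_mono) (auto simp: indicator_def)
  also have "\<dots> \<le> ennreal (c_mean * (Im z) powr (- (2 + \<alpha>))) * (ennreal B * ball_mass \<nu> z (c_near * Im z))"
  proof (intro mult_left_mono)
    have "(deviation b ?c (carleson J))
      \<le> ennreal B * (mass \<nu> (carleson J))"
      using B J' by (auto simp: bmo_bound_def)
    also have "\<dots> \<le> ennreal B * ball_mass \<nu> z (c_near * Im z)"
      by (intro mult_left_mono box_le_ball_mass[OF J y]) auto
    finally show "deviation b ?c (carleson J) \<le> ennreal B * ball_mass \<nu> z (c_near * Im z)" .
  qed simp
  also have "\<dots> = ennreal (c_mean * (Im z) powr (- (2 + \<alpha>)) * B) * ball_mass \<nu> z (c_near * Im z)"
    using B c_mean_pos by (subst ennreal_mult) (auto simp: bmo_bound_def mult.assoc)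
  also have "\<dots> \<le> ennreal (B * c_chain * Im z powr (- (2 + \<alpha>))) * ball_mass \<nu> z (c_near * Im z)"
  proof (intro mult_right_mono ennreal_leI)
    have "c_mean * (Im z) powr (- (2 + \<alpha>)) * B = (B * Im z powr (- (2 + \<alpha>))) * c_mean" by (simp only: mult_ac)
    also have "\<dots> \<le> (B * Im z powr (- (2 + \<alpha>))) * c_chain"
      using B by (intro mult_left_mono c_chain_ge) (auto simp: bmo_bound_def)
    finally show "c_mean * (Im z) powr (- (2 + \<alpha>)) * B \<le> B * c_chain * Im z powr (- (2 + \<alpha>))" by (simp only: mult_ac)
  qed simp
  finally show ?thesis .
qed

lemma chain_step:
  assumes mb: "b \<in> borel_measurable M" and B: "bmo_bound \<nu> b B" and z: "0 < Im z" "Im z \<le> t"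
    and J: "box_at J (Re z) t" and J': "box_at J' (Re z) (2 * t)"
  shows "ennreal (cmod (box_avg \<alpha> b J - box_avg \<alpha> b J')) \<le> ennreal (B * c_chain * (2 * t) powr (- (2 + \<alpha>))) * ball_mass \<nu> z (c_near * (2 * t))"
proof -
  have t: "t > 0" using z by linarith
  have "{Re z - t..Re z + t} \<subseteq> {Re z - 2 * t..Re z + 2 * t}" using t by auto
  then have sub: "{Re z - t..Re z + t} \<subseteq> J" "{Re z - t..Re z + t} \<subseteq> J'" and JD: "J \<in> D1 \<union> D2" "J' \<in> D1 \<union> D2"
    using J J' by (auto simp: box_at_def)
  let ?m = "ball_mass \<nu> z (c_near * (2 * t))"
  have le: "(deviation b (box_avg \<alpha> b K) (carleson K)) \<le> ennreal B * ?m"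
    if K: "box_at K (Re z) r" "Im z \<le> r" "r \<le> 2 * t" for K r
  proof -
    have "(deviation b (box_avg \<alpha> b K) (carleson K))
      \<le> ennreal B * (mass \<nu> (carleson K))"
      using B K by (auto simp: bmo_bound_def box_at_def)
    also have "\<dots> \<le> ennreal B * ball_mass \<nu> z (c_near * r)"
      by (intro mult_left_mono box_le_ball_mass[OF K(1) z(1) K(2)]) auto
    also have "\<dots> \<le> ennreal B * ?m"
      using K(3) c_near_pos by (intro mult_left_mono ball_mass_mono) auto
    finally show ?thesis .
  qed
  have "ennreal (cmod (box_avg \<alpha> b J - box_avg \<alpha> b J')) \<le> ennreal (c_box * t powr (- (2 + \<alpha>))) *
     ((deviation b (box_avg \<alpha> b J) (carleson J))
      + (deviation b (box_avg \<alpha> b J') (carleson J')))"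
    by (rule box_avg_compare[OF mb t JD(1) sub(1) JD(2) sub(2)])
  also have "\<dots> \<le> ennreal (c_box * t powr (- (2 + \<alpha>))) * (ennreal B * ?m + ennreal B * ?m)"
    using z t by (intro mult_left_mono add_mono le[OF J] le[OF J']) auto
  also have "\<dots> = ennreal (c_box * t powr (- (2 + \<alpha>))) * (ennreal (2 * B) * ?m)"
    using B by (simp only: ennreal_double bmo_bound_def)
  also have "\<dots> = ennreal (c_box * t powr (- (2 + \<alpha>)) * (2 * B)) * ?m"
    using B c_box_pos by (subst ennreal_mult) (auto simp: bmo_bound_def mult.assoc)
  also have "\<dots> \<le> ennreal (B * c_chain * (2 * t) powr (- (2 + \<alpha>))) * ?m"
  proof (intro mult_right_mono ennreal_leI)
    have "2 powr (2 + \<alpha>) * (2 * t) powr (- (2 + \<alpha>)) = 2 powr (2 + \<alpha>) * (2 powr (- (2 + \<alpha>)) * t powr (- (2 + \<alpha>)))"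
      using t by (subst powr_mult) auto
    also have "\<dots> = (2 powr (2 + \<alpha>) * 2 powr (- (2 + \<alpha>))) * t powr (- (2 + \<alpha>))" by (simp only: mult.assoc)
    also have "2 powr (2 + \<alpha>) * 2 powr (- (2 + \<alpha>)) = (1::real)"
      by (simp only: powr_add[symmetric]) simp
    finally have p: "t powr (- (2 + \<alpha>)) = 2 powr (2 + \<alpha>) * (2 * t) powr (- (2 + \<alpha>))" by simp
    have "c_box * t powr (- (2 + \<alpha>)) * (2 * B) = (B * (2 * t) powr (- (2 + \<alpha>))) * (2 * 2 powr (2 + \<alpha>) * c_box)"
      unfolding p by (simp only: mult_ac)
    also have "\<dots> \<le> (B * (2 * t) powr (- (2 + \<alpha>))) * c_chain"
      using B by (intro mult_left_mono c_chain_ge) (auto simp: bmo_bound_def)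
    finally show "c_box * t powr (- (2 + \<alpha>)) * (2 * B) \<le> B * c_chain * (2 * t) powr (- (2 + \<alpha>))" by (simp only: mult_ac)
  qed simp
  finally show ?thesis .
qed

lemma chain:
  assumes mb: "b \<in> borel_measurable M" and hol: "b holomorphic_on upper_half" and B: "bmo_bound \<nu> b B" and z: "z \<in> upper_half"
    and J: "box_at J (Re z) (2 ^ n * Im z)"
  shows "ennreal (cmod (b z - box_avg \<alpha> b J)) \<le>
    (\<Sum>k\<le>n. ennreal (B * c_chain * (2 ^ k * Im z) powr (- (2 + \<alpha>))) * ball_mass \<nu> z (c_near * (2 ^ k * Im z)))"
  using J
proof (induction n arbitrary: J)
  case 0
  then show ?case using chain_start[OF hol B z, of J] by simp
next
  case (Suc n)
  have y: "Im z > 0" using z by (simp add: upper_half_def)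
  have ge: "Im z \<le> 2 ^ n * Im z" using y by simp
  obtain J' where J': "box_at J' (Re z) (2 ^ n * Im z)" using box_at_exists y by (metis mult_pos_pos zero_less_numeral zero_less_power)
  have J2: "box_at J (Re z) (2 * (2 ^ n * Im z))" using Suc.prems by (simp add: mult.assoc)
  have "cmod (b z - box_avg \<alpha> b J) \<le> cmod (b z - box_avg \<alpha> b J') + cmod (box_avg \<alpha> b J' - box_avg \<alpha> b J)"
    using norm_triangle_ineq[of "b z - box_avg \<alpha> b J'" "box_avg \<alpha> b J' - box_avg \<alpha> b J"] by simp
  then have "ennreal (cmod (b z - box_avg \<alpha> b J)) \<le> ennreal (cmod (b z - box_avg \<alpha> b J')) + ennreal (cmod (box_avg \<alpha> b J' - box_avg \<alpha> b J))"
    by (intro ennreal_le_add) auto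
  also have "\<dots> \<le> (\<Sum>k\<le>n. ennreal (B * c_chain * (2 ^ k * Im z) powr (- (2 + \<alpha>))) * ball_mass \<nu> z (c_near * (2 ^ k * Im z)))
     + ennreal (B * c_chain * (2 * (2 ^ n * Im z)) powr (- (2 + \<alpha>))) * ball_mass \<nu> z (c_near * (2 * (2 ^ n * Im z)))"
    by (intro add_mono Suc.IH[OF J'] chain_step[OF mb B y ge J' J2])
  also have "\<dots> = (\<Sum>k\<le>Suc n. ennreal (B * c_chain * (2 ^ k * Im z) powr (- (2 + \<alpha>))) * ball_mass \<nu> z (c_near * (2 ^ k * Im z)))"
    by (simp only: sum.atMost_Suc power_Suc mult.assoc)
  finally show ?case .
qed

definition c_pot :: real where "c_pot = 2 * c_chain * c_near powr (2 + \<alpha>)"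

lemma c_pot_pos: "c_pot > 0"
  using c_near_pos c_mean_pos c_box_pos by (simp add: c_pot_def c_chain_def add_pos_pos)

text \<open>Interchanging sum and integral turns the sum over the chain into \<open>\<nu>\<close> times a geometric series, whose
value at \<open>v\<close> is comparable to \<open>k(z,v)\<close>.\<close>

lemma chain_potential:
  assumes mb: "b \<in> borel_measurable M" and hol: "b holomorphic_on upper_half" and B: "bmo_bound \<nu> b B" and z: "z \<in> upper_half"
    and [measurable]: "\<nu> \<in> borel_measurable M"
    and J: "box_at J (Re z) (2 ^ n * Im z)"
  shows "ennreal (cmod (b z - box_avg \<alpha> b J)) \<le> ennreal (B * c_pot) * potential \<nu> z (c_near * (2 ^ n * Im z))"
proof -
  have y: "Im z > 0" using z by (simp add: upper_half_def)
  have B0: "B \<ge> 0" using B by (simp add: bmo_bound_def)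
  have [measurable]: "(\<lambda>v. hdist z v) \<in> borel_measurable M"
    by (rule measurable_hdist[OF measurable_const measurable_ident_dA]) simp
  let ?s = "2 + \<alpha>"
  let ?A = "\<lambda>k. {v. hdist z v \<le> c_near * (2 ^ k * Im z)}"
  have cc: "c_chain > 0" using c_mean_pos c_box_pos by (simp add: c_chain_def add_pos_pos)
  have Am [measurable]: "Measurable.pred M (\<lambda>v. v \<in> ?A k)" for k by simp
  have "(\<Sum>k\<le>n. ennreal (B * c_chain * (2 ^ k * Im z) powr (- ?s)) * ball_mass \<nu> z (c_near * (2 ^ k * Im z)))
     = (\<Sum>k\<le>n. \<integral>\<^sup>+v. ennreal (B * c_chain * (2 ^ k * Im z) powr (- ?s)) * (ennreal (\<nu> v) * indicator (?A k) v) \<partial>M)"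
    unfolding ball_mass_def by (intro sum.cong refl nn_integral_cmult[symmetric]) measurable
  also have "\<dots> = (\<integral>\<^sup>+v. (\<Sum>k\<le>n. ennreal (B * c_chain * (2 ^ k * Im z) powr (- ?s)) * (ennreal (\<nu> v) * indicator (?A k) v)) \<partial>M)"
    by (rule nn_integral_sum[symmetric]) measurable
  also have "\<dots> \<le> (\<integral>\<^sup>+v. ennreal (B * c_pot) * (ennreal (\<nu> v) * ennreal (kern \<alpha> z v) * indicator (?A n) v) \<partial>M)"
  proof (rule nn_integral_mono)
    fix v assume "v \<in> space M"
    then have d: "hdist z v > 0" using hdist_pos[OF z] by simp
    let ?g = "\<lambda>k. if hdist z v \<le> c_near * (2 ^ k * Im z) then (2 ^ k * Im z) powr (- ?s) else 0"
    have e: "ennreal (B * c_chain * p) = ennreal (B * c_chain) * ennreal p" if "p \<ge> 0" for p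
      using B0 cc that by (intro ennreal_mult) auto
    have "(\<Sum>k\<le>n. ennreal (B * c_chain * (2 ^ k * Im z) powr (- ?s)) * (ennreal (\<nu> v) * indicator (?A k) v))
       = (\<Sum>k\<le>n. ennreal (\<nu> v) * (ennreal (B * c_chain) * ennreal (?g k)))"
    proof (intro sum.cong refl)
      fix k
      show "ennreal (B * c_chain * (2 ^ k * Im z) powr (- ?s)) * (ennreal (\<nu> v) * indicator (?A k) v)
         = ennreal (\<nu> v) * (ennreal (B * c_chain) * ennreal (?g k))"
        unfolding e[OF powr_ge_zero] by (cases "hdist z v \<le> c_near * (2 ^ k * Im z)") (simp_all only: indicator_def mem_Collect_eq of_bool_eq if_True if_False mult_ac mult_1_left mult_1_right mult_zero_left mult_zero_right ennreal_0)
    qed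
    also have "\<dots> = ennreal (\<nu> v) * (ennreal (B * c_chain) * ennreal (\<Sum>k\<le>n. ?g k))"
    proof -
      have "ennreal (\<Sum>k\<le>n. ?g k) = (\<Sum>k\<le>n. ennreal (?g k))" by (rule sum_ennreal[symmetric]) auto
      then show ?thesis by (simp only: sum_distrib_left)
    qed
    also have "\<dots> \<le> ennreal (\<nu> v) * (ennreal (B * c_chain) * ennreal (if hdist z v \<le> c_near * (2 ^ n * Im z) then 2 * c_near powr ?s * hdist z v powr (- ?s) else 0))"
      using alpha by (intro mult_left_mono ennreal_leI geometric_sum_le y c_near_pos d) auto
    also have "\<dots> = ennreal (B * c_pot) * (ennreal (\<nu> v) * ennreal (kern \<alpha> z v) * indicator (?A n) v)"
    proof (cases "hdist z v \<le> c_near * (2 ^ n * Im z)")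
      case True
      have "ennreal (B * c_chain) * ennreal (2 * c_near powr ?s * hdist z v powr (- ?s)) = ennreal (B * c_pot) * ennreal (kern \<alpha> z v)"
      proof -
        have "ennreal (B * c_chain) * ennreal (2 * c_near powr ?s * hdist z v powr (- ?s)) = ennreal ((B * c_chain) * (2 * c_near powr ?s * hdist z v powr (- ?s)))"
          using B0 cc by (intro ennreal_mult[symmetric]) auto
        also have "(B * c_chain) * (2 * c_near powr ?s * hdist z v powr (- ?s)) = (B * c_pot) * kern \<alpha> z v"
          unfolding c_pot_def kern_def by (simp only: mult_ac)
        also have "ennreal ((B * c_pot) * kern \<alpha> z v) = ennreal (B * c_pot) * ennreal (kern \<alpha> z v)"
          using B0 c_pot_pos by (intro ennreal_mult) auto
        finally show ?thesis .
      qed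
      with True show ?thesis
        by (simp only: indicator_def mem_Collect_eq of_bool_eq if_True mult_ac mult_1_right mult_1_left)
    qed (simp add: indicator_def)
    finally show "(\<Sum>k\<le>n. ennreal (B * c_chain * (2 ^ k * Im z) powr (- ?s)) * (ennreal (\<nu> v) * indicator (?A k) v))
       \<le> ennreal (B * c_pot) * (ennreal (\<nu> v) * ennreal (kern \<alpha> z v) * indicator (?A n) v)" .
  qed
  also have "\<dots> = ennreal (B * c_pot) * potential \<nu> z (c_near * (2 ^ n * Im z))"
    unfolding potential_def by (rule nn_integral_cmult) measurable
  finally show ?thesis using chain[OF mb hol B z J] by (rule order_trans[rotated])
qed

lemma potential_mono: "R \<le> R' \<Longrightarrow> potential \<nu> z R \<le> potential \<nu> z R'"
  unfolding potential_def by (intro nn_integral_mono mult_left_mono) (auto simp: indicator_def)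

lemma scale_exists:
  fixes y L :: real
  assumes "0 < y" "y \<le> L"
  obtains n :: nat where "L \<le> 2 ^ n * y" "2 ^ n * y \<le> 2 * L"
proof -
  define n where "n = (LEAST n::nat. L \<le> 2 ^ n * y)"
  have "\<exists>n::nat. L \<le> 2 ^ n * y"
  proof -
    obtain n :: nat where "L / y < 2 ^ n" using real_arch_pow[of 2 "L/y"] by auto
    then show ?thesis using assms by (auto simp: field_simps intro!: exI[of _ n])
  qed
  then have 1: "L \<le> 2 ^ n * y" unfolding n_def by (rule LeastI_ex)
  have "2 ^ n * y \<le> 2 * L"
  proof (cases n)
    case 0 then show ?thesis using assms by simp
  next
    case (Suc m)
    then have "\<not> L \<le> 2 ^ m * y" using not_less_Least[of m "\<lambda>n. L \<le> 2 ^ n * y"] by (simp add: n_def)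
    then show ?thesis using Suc by simp
  qed
  then show ?thesis using 1 that by blast
qed

text \<open>The chains from \<open>z\<close> and from \<open>w\<close> are both continued up to the scale \<open>d(z,w)\<close> and end in one box \<open>J\<close>.\<close>

lemma oscillation_potential:
  assumes mb: "b \<in> borel_measurable M" and hol: "b holomorphic_on upper_half" and B: "bmo_bound \<nu> b B"
    and m\<nu>: "\<nu> \<in> borel_measurable M" and z: "z \<in> upper_half" and w: "w \<in> upper_half"
  shows "ennreal (cmod (b z - b w)) \<le> ennreal (B * c_pot) *
     (potential \<nu> z (2 * c_near * hdist z w) + potential \<nu> w (2 * c_near * hdist z w))"
proof -
  define L where "L = hdist z w"
  have y: "Im z > 0" "Im w > 0" using z w by (auto simp: upper_half_def)
  have L: "L > 0" "Im z \<le> L" "Im w \<le> L" "\<bar>Re z - Re w\<bar> \<le> L"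
    using hdist_pos[OF z w] Im_le_hdist[of z w] Re_le_hdist[of z w] y by (auto simp: L_def)
  \<comment> \<open>The chains below end at scales of at most \<open>2 L\<close>, so that the intervals around \<open>Re z\<close> and \<open>Re w\<close> fit.\<close>
  obtain J where J: "J \<in> D1 \<union> D2" "{Re z - 5 * L..Re z + 5 * L} \<subseteq> J" "len J \<le> C0 * (Re z + 5 * L - (Re z - 5 * L))"
    using cover[of "Re z - 5 * L" "Re z + 5 * L"] L by auto
  have len: "len J \<le> 10 * C0 * L" using J(3) by (simp add: algebra_simps)
  have box: "box_at J x t" if "\<bar>Re z - x\<bar> \<le> L" "L \<le> t" "t \<le> 2 * L" for x t
  proof -
    have "{x - t..x + t} \<subseteq> {Re z - 5 * L..Re z + 5 * L}" using that L(1) by (auto simp: abs_le_iff)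
    moreover have "10 * C0 * L \<le> 10 * C0 * t" using C0 that by simp
    ultimately show ?thesis using J(1,2) len by (auto simp: box_at_def)
  qed
  have one: "ennreal (cmod (b u - box_avg \<alpha> b J)) \<le> ennreal (B * c_pot) * potential \<nu> u (2 * c_near * L)"
    if u: "u \<in> upper_half" "Im u \<le> L" "\<bar>Re z - Re u\<bar> \<le> L" for u
  proof -
    obtain n where n: "L \<le> 2 ^ n * Im u" "2 ^ n * Im u \<le> 2 * L"
      using scale_exists[of "Im u" L] u by (auto simp: upper_half_def)
    have "ennreal (cmod (b u - box_avg \<alpha> b J)) \<le> ennreal (B * c_pot) * potential \<nu> u (c_near * (2 ^ n * Im u))"
      by (rule chain_potential[OF mb hol B u(1) m\<nu> box[OF u(3) n]])
    also have "c_near * (2 ^ n * Im u) \<le> 2 * c_near * L"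
      using mult_left_mono[OF n(2) less_imp_le[OF c_near_pos]] by simp
    then have "ennreal (B * c_pot) * potential \<nu> u (c_near * (2 ^ n * Im u)) \<le> ennreal (B * c_pot) * potential \<nu> u (2 * c_near * L)"
      by (intro mult_left_mono potential_mono) auto
    finally show ?thesis .
  qed
  have "cmod (b z - b w) \<le> cmod (b z - box_avg \<alpha> b J) + cmod (b w - box_avg \<alpha> b J)"
    using norm_triangle_ineq4[of "b z - box_avg \<alpha> b J" "b w - box_avg \<alpha> b J"] by simp
  then have "ennreal (cmod (b z - b w)) \<le> ennreal (cmod (b z - box_avg \<alpha> b J)) + ennreal (cmod (b w - box_avg \<alpha> b J))"
    by (intro ennreal_le_add) auto
  also have "\<dots> \<le> ennreal (B * c_pot) * potential \<nu> z (2 * c_near * L) + ennreal (B * c_pot) * potential \<nu> w (2 * c_near * L)"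
    using L z w by (intro add_mono one) auto
  finally show ?thesis by (simp add: distrib_left L_def)
qed

definition c_osc :: real where "c_osc = 2 * c_pot * (2 * c_near + 1) powr (2 + \<alpha>)"

lemma c_osc_pos: "c_osc > 0" using c_pot_pos c_near_pos by (simp add: c_osc_def)

text \<open>For \<open>v\<close> within a multiple of \<open>d(z,w)\<close> of \<open>z\<close>, the triangle inequality bounds \<open>d(v,w)\<close> by a multiple of
\<open>d(z,w)\<close>, so that \<open>k(z,w)\<close> may be replaced by \<open>k(v,w)\<close>.\<close>

lemma potential_kern:
  assumes z: "z \<in> upper_half" and w: "w \<in> upper_half" and [measurable]: "\<nu> \<in> borel_measurable M"
  shows "potential \<nu> z (2 * c_near * hdist z w) * ennreal (kern \<alpha> z w)
    \<le> ennreal ((2 * c_near + 1) powr (2 + \<alpha>)) * (\<integral>\<^sup>+v. ennreal (kern \<alpha> z v) * (ennreal (\<nu> v) * ennreal (kern \<alpha> v w)) \<partial>M)"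
proof -
  let ?L = "hdist z w" and ?s = "2 + \<alpha>"
  let ?A = "{v. hdist z v \<le> 2 * c_near * ?L}"
  have L: "?L > 0" using hdist_pos[OF z w] .
  have [measurable]: "(\<lambda>v. hdist z v) \<in> borel_measurable M"
    by (rule measurable_hdist[OF measurable_const measurable_ident_dA]) simp
  have [measurable]: "(\<lambda>v. kern \<alpha> v w) \<in> borel_measurable M"
    by (subst kern_commute) measurable
  have [measurable]: "Measurable.pred M (\<lambda>v. v \<in> ?A)" by simp
  have "potential \<nu> z (2 * c_near * ?L) * ennreal (kern \<alpha> z w)
     = (\<integral>\<^sup>+v. ennreal (\<nu> v) * ennreal (kern \<alpha> z v) * indicator ?A v * ennreal (kern \<alpha> z w) \<partial>M)"
    unfolding potential_def by (rule nn_integral_multc[symmetric]) measurable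
  also have "\<dots> \<le> (\<integral>\<^sup>+v. ennreal ((2 * c_near + 1) powr ?s) * (ennreal (kern \<alpha> z v) * (ennreal (\<nu> v) * ennreal (kern \<alpha> v w))) \<partial>M)"
  proof (rule nn_integral_mono)
    fix v assume "v \<in> space M"
    then have v: "v \<in> upper_half" by simp
    show "ennreal (\<nu> v) * ennreal (kern \<alpha> z v) * indicator ?A v * ennreal (kern \<alpha> z w)
      \<le> ennreal ((2 * c_near + 1) powr ?s) * (ennreal (kern \<alpha> z v) * (ennreal (\<nu> v) * ennreal (kern \<alpha> v w)))"
    proof (cases "v \<in> ?A")
      case True
      have "hdist v w \<le> hdist v z + hdist z w" by (rule hdist_triangle[OF z w])
      also have "\<dots> \<le> (2 * c_near + 1) * ?L" using True by (simp add: hdist_commute[of v z] algebra_simps)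
      finally have "hdist v w \<le> (2 * c_near + 1) * ?L" .
      then have "((2 * c_near + 1) * ?L) powr (- ?s) \<le> hdist v w powr (- ?s)"
        using hdist_pos[OF v w] alpha by (intro powr_mono2') auto
      then have "(2 * c_near + 1) powr (- ?s) * ?L powr (- ?s) \<le> hdist v w powr (- ?s)"
        using L c_near_pos by (subst (asm) powr_mult) auto
      then have "(2 * c_near + 1) powr ?s * ((2 * c_near + 1) powr (- ?s) * ?L powr (- ?s)) \<le> (2 * c_near + 1) powr ?s * hdist v w powr (- ?s)"
        by (rule mult_left_mono) simp
      moreover have "(2 * c_near + 1) powr ?s * ((2 * c_near + 1) powr (- ?s) * ?L powr (- ?s)) = ?L powr (- ?s)"
      proof -
        have "(2 * c_near + 1) powr ?s * (2 * c_near + 1) powr (- ?s) = 1"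
          using c_near_pos by (simp only: powr_add[symmetric]) simp
        then show ?thesis by (simp only: mult.assoc[symmetric] mult_1_left)
      qed
      ultimately have "kern \<alpha> z w \<le> (2 * c_near + 1) powr ?s * kern \<alpha> v w" by (simp only: kern_def)
      then have "ennreal (kern \<alpha> z w) \<le> ennreal ((2 * c_near + 1) powr ?s) * ennreal (kern \<alpha> v w)"
        by (subst ennreal_mult[symmetric]) (auto intro: ennreal_leI)
      then have "ennreal (\<nu> v) * ennreal (kern \<alpha> z v) * ennreal (kern \<alpha> z w)
        \<le> ennreal (\<nu> v) * ennreal (kern \<alpha> z v) * (ennreal ((2 * c_near + 1) powr ?s) * ennreal (kern \<alpha> v w))"
        by (rule mult_left_mono) simp
      then show ?thesis using True by (simp add: mult_ac)
    qed simp
  qed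
  also have "\<dots> = ennreal ((2 * c_near + 1) powr ?s) * (\<integral>\<^sup>+v. ennreal (kern \<alpha> z v) * (ennreal (\<nu> v) * ennreal (kern \<alpha> v w)) \<partial>M)"
    by (rule nn_integral_cmult) measurable
  finally show ?thesis .
qed

text \<open>The pointwise estimate that reduces the commutator to a composition of positive operators.\<close>

lemma oscillation_kernel:
  assumes mb: "b \<in> borel_measurable M" and hol: "b holomorphic_on upper_half" and B: "bmo_bound \<nu> b B"
    and m\<nu>: "\<nu> \<in> borel_measurable M" and z: "z \<in> upper_half" and w: "w \<in> upper_half"
  shows "ennreal (cmod (b z - b w)) * ennreal (kern \<alpha> z w) \<le> ennreal (B * c_osc) *
     (\<integral>\<^sup>+v. ennreal (kern \<alpha> z v) * (ennreal (\<nu> v) * ennreal (kern \<alpha> v w)) \<partial>M)"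
proof -
  let ?I = "\<integral>\<^sup>+v. ennreal (kern \<alpha> z v) * (ennreal (\<nu> v) * ennreal (kern \<alpha> v w)) \<partial>M"
  let ?c = "ennreal ((2 * c_near + 1) powr (2 + \<alpha>))"
  have B0: "B \<ge> 0" using B by (simp add: bmo_bound_def)
  have sym: "(\<integral>\<^sup>+v. ennreal (kern \<alpha> w v) * (ennreal (\<nu> v) * ennreal (kern \<alpha> v z)) \<partial>M) = ?I"
    by (intro nn_integral_cong) (simp only: kern_commute[of \<alpha> w] kern_commute[of \<alpha> _ z] mult_ac)
  have p1: "potential \<nu> z (2 * c_near * hdist z w) * ennreal (kern \<alpha> z w) \<le> ?c * ?I"
    by (rule potential_kern[OF z w m\<nu>])
  have p2: "potential \<nu> w (2 * c_near * hdist z w) * ennreal (kern \<alpha> z w) \<le> ?c * ?I"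
    using potential_kern[OF w z m\<nu>] unfolding sym by (simp only: hdist_commute[of w z] kern_commute[of \<alpha> w z])
  have "ennreal (cmod (b z - b w)) * ennreal (kern \<alpha> z w) \<le> ennreal (B * c_pot) *
     (potential \<nu> z (2 * c_near * hdist z w) + potential \<nu> w (2 * c_near * hdist z w)) * ennreal (kern \<alpha> z w)"
    by (intro mult_right_mono oscillation_potential[OF mb hol B m\<nu> z w]) simp
  also have "\<dots> = ennreal (B * c_pot) *
     (potential \<nu> z (2 * c_near * hdist z w) * ennreal (kern \<alpha> z w) + potential \<nu> w (2 * c_near * hdist z w) * ennreal (kern \<alpha> z w))"
    by (simp only: mult.assoc distrib_right)
  also have "\<dots> \<le> ennreal (B * c_pot) * (?c * ?I + ?c * ?I)"
    by (intro mult_left_mono add_mono p1 p2) simp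
  also have "\<dots> = ennreal (B * c_pot) * ennreal (2 * (2 * c_near + 1) powr (2 + \<alpha>)) * ?I"
    by (subst ennreal_double) (simp_all only: powr_ge_zero mult.assoc)
  also have "\<dots> = ennreal (B * c_osc) * ?I"
  proof -
    have "ennreal (B * c_pot) * ennreal (2 * (2 * c_near + 1) powr (2 + \<alpha>)) = ennreal ((B * c_pot) * (2 * (2 * c_near + 1) powr (2 + \<alpha>)))"
      using B0 c_pot_pos by (intro ennreal_mult[symmetric]) auto
    also have "(B * c_pot) * (2 * (2 * c_near + 1) powr (2 + \<alpha>)) = B * c_osc"
      unfolding c_osc_def by (simp only: mult_ac)
    finally show ?thesis by (simp only:)
  qed
  finally show ?thesis .
qed

end

section \<open>Sufficiency: bounding the commutator\<close>

definition intop :: "real \<Rightarrow> (complex \<Rightarrow> complex \<Rightarrow> complex) \<Rightarrow> (complex \<Rightarrow> complex) \<Rightarrow> complex \<Rightarrow> complex" where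
  "intop \<alpha> k f z = (\<integral>w. k z w * f w \<partial>dA \<alpha>)"

text \<open>The commutator written with a single integral. For \<open>b\<close> of bounded mean oscillation this
extends \<open>b T f - T (b f)\<close> to all \<open>f\<close> in the weighted space, as the integrand is then absolutely integrable for
almost every \<open>z\<close>.\<close>

definition commop :: "real \<Rightarrow> (complex \<Rightarrow> complex \<Rightarrow> complex) \<Rightarrow> (complex \<Rightarrow> complex) \<Rightarrow> (complex \<Rightarrow> complex) \<Rightarrow> complex \<Rightarrow> complex" where
  "commop \<alpha> k b f z = (\<integral>w. (b z - b w) * k z w * f w \<partial>dA \<alpha>)"

definition bergman_type_kernel :: "real \<Rightarrow> (complex \<Rightarrow> complex \<Rightarrow> complex) \<Rightarrow> bool" where
  "bergman_type_kernel \<alpha> k \<longleftrightarrow> (\<lambda>p. k (fst p) (snd p)) \<in> borel_measurable (dA \<alpha> \<Otimes>\<^sub>M dA \<alpha>) \<and>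
     (\<forall>z\<in>upper_half. \<forall>w\<in>upper_half. cmod (k z w) = kern \<alpha> z w)"

lemma L2_norm_nonneg: "(\<And>z. z \<in> upper_half \<Longrightarrow> w z \<ge> 0) \<Longrightarrow> L2_norm \<alpha> w f \<ge> 0"
  unfolding L2_norm_def by (intro real_sqrt_ge_zero integral_nonneg_AE AE_I2) simp

lemma L2_nn_integral:
  assumes f: "f \<in> L2 \<alpha> w" and w: "\<And>z. z \<in> upper_half \<Longrightarrow> w z \<ge> 0"
  shows "(\<integral>\<^sup>+z. (ennreal (cmod (f z)))\<^sup>2 * ennreal (w z) \<partial>dA \<alpha>) = ennreal ((L2_norm \<alpha> w f)\<^sup>2)"
proof -
  have int: "integrable (dA \<alpha>) (\<lambda>z. (cmod (f z))\<^sup>2 * w z)" using f by (simp add: L2_def)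
  have "(\<integral>\<^sup>+z. (ennreal (cmod (f z)))\<^sup>2 * ennreal (w z) \<partial>dA \<alpha>) = (\<integral>\<^sup>+z. ennreal ((cmod (f z))\<^sup>2 * w z) \<partial>dA \<alpha>)"
    using w by (intro nn_integral_cong) (simp add: ennreal_power ennreal_mult)
  also have "\<dots> = ennreal (\<integral>z. (cmod (f z))\<^sup>2 * w z \<partial>dA \<alpha>)"
    using w by (intro nn_integral_eq_integral[OF int] AE_I2) simp
  also have "(\<integral>z. (cmod (f z))\<^sup>2 * w z \<partial>dA \<alpha>) = (L2_norm \<alpha> w f)\<^sup>2"
    unfolding L2_norm_def by (subst real_sqrt_pow2) (auto intro!: integral_nonneg_AE AE_I2 simp: w)
  finally show ?thesis .
qed

lemma L2_nn_integral_le: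
  assumes m: "f \<in> borel_measurable (dA \<alpha>)" "w \<in> borel_measurable (dA \<alpha>)" and w: "\<And>z. z \<in> upper_half \<Longrightarrow> w z \<ge> 0"
    and C: "C \<ge> 0" and le: "(\<integral>\<^sup>+z. (ennreal (cmod (f z)))\<^sup>2 * ennreal (w z) \<partial>dA \<alpha>) \<le> ennreal (C\<^sup>2)"
  shows "f \<in> L2 \<alpha> w" "L2_norm \<alpha> w f \<le> C"
proof -
  note [measurable] = m
  have e: "(\<integral>\<^sup>+z. (ennreal (cmod (f z)))\<^sup>2 * ennreal (w z) \<partial>dA \<alpha>) = (\<integral>\<^sup>+z. ennreal ((cmod (f z))\<^sup>2 * w z) \<partial>dA \<alpha>)"
    using w by (intro nn_integral_cong) (simp add: ennreal_power ennreal_mult)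
  have "integrable (dA \<alpha>) (\<lambda>z. (cmod (f z))\<^sup>2 * w z)"
    using le w by (intro integrableI_nonneg AE_I2) (auto simp: e intro: order_le_less_trans)
  then show f: "f \<in> L2 \<alpha> w" using m by (simp add: L2_def)
  have "ennreal ((L2_norm \<alpha> w f)\<^sup>2) \<le> ennreal (C\<^sup>2)" using le L2_nn_integral[OF f w] by simp
  then have "(L2_norm \<alpha> w f)\<^sup>2 \<le> C\<^sup>2" by (simp add: ennreal_le_iff)
  then show "L2_norm \<alpha> w f \<le> C" using C by (rule power2_le_imp_le)
qed

context half_plane begin

lemma measurable_integral_param:
  fixes F :: "complex \<Rightarrow> complex \<Rightarrow> complex"
  assumes "(\<lambda>p. F (fst p) (snd p)) \<in> borel_measurable (M \<Otimes>\<^sub>M M)"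
  shows "(\<lambda>z. \<integral>w. F z w \<partial>M) \<in> borel_measurable M"
  using sigma_finite_measure.borel_measurable_lebesgue_integral[OF sigma_finite_dA[OF alpha], of F M] assms
  by (simp add: split_beta')

text \<open>Fubini's theorem turns the kernel estimate into domination by \<open>P (\<nu> P |f|)\<close>; the operator \<open>P\<close> is
bounded on \<open>L\<^sup>2(\<lambda>)\<close> and on \<open>L\<^sup>2(\<mu>)\<close>, and \<open>\<nu>\<^sup>2 \<lambda> = \<mu>\<close> links the two spaces. The integral of absolute values
is estimated, so that absolute convergence comes out as well.\<close>

lemma commutator_bound:
  assumes k: "bergman_type_kernel \<alpha> k" and \<mu>: "bekolle \<mu> K1" and lam: "bekolle lam K2"
    and \<nu>: "\<And>z. z \<in> upper_half \<Longrightarrow> (\<nu> z)\<^sup>2 * lam z = \<mu> z" "\<And>z. z \<in> upper_half \<Longrightarrow> \<nu> z \<ge> 0"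
    and [measurable]: "\<nu> \<in> borel_measurable M"
    and [measurable]: "b \<in> borel_measurable M" and hol: "b holomorphic_on upper_half" and B: "bmo_bound \<nu> b B"
    and [measurable]: "f \<in> borel_measurable M"
  shows "(\<integral>\<^sup>+z. (\<integral>\<^sup>+w. ennreal (cmod ((b z - b w) * k z w * f w)) \<partial>M)\<^sup>2 * ennreal (lam z) \<partial>M)
    \<le> ennreal ((B * c_osc * posop_const K2 * posop_const K1)\<^sup>2) * (\<integral>\<^sup>+w. (ennreal (cmod (f w)))\<^sup>2 * ennreal (\<mu> w) \<partial>M)"
proof -
  have [measurable]: "\<mu> \<in> borel_measurable M" "lam \<in> borel_measurable M" "(\<lambda>p. k (fst p) (snd p)) \<in> borel_measurable (M \<Otimes>\<^sub>M M)"
    using \<mu> lam k by (auto simp: bekolle_def bergman_type_kernel_def)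
  have B0: "B \<ge> 0" using B by (simp add: bmo_bound_def)
  define \<phi> where "\<phi> = (\<lambda>w. ennreal (cmod (f w)))"
  define h where "h = posop \<alpha> \<phi>"
  define \<psi> where "\<psi> = (\<lambda>z. ennreal (\<nu> z) * h z)"
  define G where "G = posop \<alpha> \<psi>"
  have [measurable]: "\<phi> \<in> borel_measurable M" "h \<in> borel_measurable M" "\<psi> \<in> borel_measurable M" "G \<in> borel_measurable M"
    by (simp_all add: \<phi>_def h_def \<psi>_def G_def)
  have ptw: "(\<integral>\<^sup>+w. ennreal (cmod ((b z - b w) * k z w * f w)) \<partial>M) \<le> ennreal (B * c_osc) * G z"
    if z: "z \<in> upper_half" for z
  proof -
    let ?F = "\<lambda>v w. ennreal (kern \<alpha> z v) * (ennreal (\<nu> v) * (ennreal (kern \<alpha> v w) * \<phi> w))"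
    have "(\<integral>\<^sup>+w. ennreal (cmod ((b z - b w) * k z w * f w)) \<partial>M)
       \<le> (\<integral>\<^sup>+w. ennreal (B * c_osc) * (\<integral>\<^sup>+v. ?F v w \<partial>M) \<partial>M)"
    proof (rule nn_integral_mono)
      fix w assume "w \<in> space M"
      then have w: "w \<in> upper_half" by simp
      have [measurable]: "(\<lambda>v. kern \<alpha> v w) \<in> borel_measurable M"
        by (subst kern_commute) measurable
      have "cmod ((b z - b w) * k z w * f w) = cmod (b z - b w) * kern \<alpha> z w * cmod (f w)"
        using k z w by (simp add: bergman_type_kernel_def norm_mult)
      then have "ennreal (cmod ((b z - b w) * k z w * f w)) = ennreal (cmod (b z - b w)) * ennreal (kern \<alpha> z w) * \<phi> w"
        by (simp add: \<phi>_def ennreal_mult)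
      also have "\<dots> \<le> ennreal (B * c_osc) * (\<integral>\<^sup>+v. ennreal (kern \<alpha> z v) * (ennreal (\<nu> v) * ennreal (kern \<alpha> v w)) \<partial>M) * \<phi> w"
        by (intro mult_right_mono oscillation_kernel[OF _ hol B _ z w]) auto
      also have "\<dots> = ennreal (B * c_osc) * (\<integral>\<^sup>+v. ennreal (kern \<alpha> z v) * (ennreal (\<nu> v) * ennreal (kern \<alpha> v w)) * \<phi> w \<partial>M)"
        by (subst nn_integral_multc) (simp_all add: mult.assoc)
      finally show "ennreal (cmod ((b z - b w) * k z w * f w)) \<le> ennreal (B * c_osc) * (\<integral>\<^sup>+v. ?F v w \<partial>M)"
        by (simp only: mult.assoc)
    qed
    also have "\<dots> = ennreal (B * c_osc) * (\<integral>\<^sup>+w. \<integral>\<^sup>+v. ?F v w \<partial>M \<partial>M)"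
    proof (rule nn_integral_cmult, rule measurable_nn_integral_param)
      have [measurable]: "(\<lambda>p. kern \<alpha> z (snd p)) \<in> borel_measurable (M \<Otimes>\<^sub>M M)"
        by (rule measurable_compose[OF measurable_snd measurable_kern_section])
      show "(\<lambda>p. ?F (snd p) (fst p)) \<in> borel_measurable (M \<Otimes>\<^sub>M M)"
        by measurable
    qed
    also have "(\<integral>\<^sup>+w. \<integral>\<^sup>+v. ?F v w \<partial>M \<partial>M) = (\<integral>\<^sup>+v. \<integral>\<^sup>+w. ?F v w \<partial>M \<partial>M)"
    proof (rule Fubini')
      have [measurable]: "(\<lambda>p. kern \<alpha> z (fst p)) \<in> borel_measurable (M \<Otimes>\<^sub>M M)"
        by (rule measurable_compose[OF measurable_fst measurable_kern_section])
      have "(\<lambda>p. ?F (fst p) (snd p)) \<in> borel_measurable (M \<Otimes>\<^sub>M M)" by measurable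
      then show "case_prod ?F \<in> borel_measurable (M \<Otimes>\<^sub>M M)" by (simp add: split_beta')
    qed
    also have "(\<integral>\<^sup>+v. \<integral>\<^sup>+w. ?F v w \<partial>M \<partial>M) = G z"
    proof -
      have "(\<integral>\<^sup>+w. ?F v w \<partial>M) = ennreal (kern \<alpha> z v) * \<psi> v" for v
        unfolding \<psi>_def h_def posop_def by (simp add: nn_integral_cmult)
      then show ?thesis by (simp only: G_def posop_def)
    qed
    finally show ?thesis .
  qed
  have "(\<integral>\<^sup>+z. (\<integral>\<^sup>+w. ennreal (cmod ((b z - b w) * k z w * f w)) \<partial>M)\<^sup>2 * ennreal (lam z) \<partial>M)
    \<le> (\<integral>\<^sup>+z. ennreal ((B * c_osc)\<^sup>2) * ((G z)\<^sup>2 * ennreal (lam z)) \<partial>M)"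
  proof (rule nn_integral_mono)
    fix z assume "z \<in> space M"
    then have z: "z \<in> upper_half" by simp
    have "(\<integral>\<^sup>+w. ennreal (cmod ((b z - b w) * k z w * f w)) \<partial>M)\<^sup>2 \<le> (ennreal (B * c_osc) * G z)\<^sup>2"
      by (intro power_mono ptw z) simp
    also have "\<dots> = ennreal ((B * c_osc)\<^sup>2) * (G z)\<^sup>2"
      using B0 c_osc_pos by (simp add: power_mult_distrib ennreal_power)
    finally show "(\<integral>\<^sup>+w. ennreal (cmod ((b z - b w) * k z w * f w)) \<partial>M)\<^sup>2 * ennreal (lam z) \<le> ennreal ((B * c_osc)\<^sup>2) * ((G z)\<^sup>2 * ennreal (lam z))"
      unfolding mult.assoc[symmetric] by (intro mult_right_mono) auto
  qed
  also have "\<dots> = ennreal ((B * c_osc)\<^sup>2) * (energy G lam)"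
    by (rule nn_integral_cmult) measurable
  also have "\<dots> \<le> ennreal ((B * c_osc)\<^sup>2) * (ennreal ((posop_const K2)\<^sup>2) * (energy \<psi> lam))"
    unfolding G_def by (intro mult_left_mono posop_bounded[OF lam]) auto
  also have "energy \<psi> lam = (energy h \<mu>)"
  proof (intro nn_integral_cong)
    fix z assume "z \<in> space M"
    then have z: "z \<in> upper_half" by simp
    have "lam z \<ge> 0" using lam z by (auto simp: bekolle_def less_imp_le)
    then have "ennreal (\<mu> z) = (ennreal (\<nu> z))\<^sup>2 * ennreal (lam z)"
      unfolding \<nu>(1)[OF z, symmetric] using \<nu>(2)[OF z] by (simp add: ennreal_mult ennreal_power)
    then show "(\<psi> z)\<^sup>2 * ennreal (lam z) = (h z)\<^sup>2 * ennreal (\<mu> z)"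
      by (simp add: \<psi>_def power_mult_distrib mult_ac)
  qed
  also have "ennreal ((B * c_osc)\<^sup>2) * (ennreal ((posop_const K2)\<^sup>2) * (energy h \<mu>))
     \<le> ennreal ((B * c_osc)\<^sup>2) * (ennreal ((posop_const K2)\<^sup>2) * (ennreal ((posop_const K1)\<^sup>2) * (energy \<phi> \<mu>)))"
    unfolding h_def by (intro mult_left_mono posop_bounded[OF \<mu>]) auto
  also have "\<dots> = ennreal ((B * c_osc * posop_const K2 * posop_const K1)\<^sup>2) * (energy \<phi> \<mu>)"
    by (simp add: power_mult_distrib ennreal_mult mult.assoc)
  finally show ?thesis unfolding \<phi>_def .
qed

lemma compact_subset_box:
  assumes K: "compact K" "K \<subseteq> upper_half"
  obtains J where "J \<in> D1 \<union> D2" "K \<subseteq> carleson J"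
proof -
  obtain R where R: "R > 0" "\<And>z. z \<in> K \<Longrightarrow> cmod z \<le> R"
    using compact_imp_bounded[OF K(1)] by (auto simp: bounded_pos)
  obtain J where J: "J \<in> D1 \<union> D2" "{0 - R..0 + R} \<subseteq> J" using cover[of "-R" R] R by auto
  have "K \<subseteq> carleson J"
  proof
    fix z assume z: "z \<in> K"
    have "\<bar>Re z\<bar> \<le> R" "\<bar>Im z\<bar> \<le> R"
      using R(2)[OF z] abs_Re_le_cmod[of z] abs_Im_le_cmod[of z] by auto
    moreover have "Im z > 0" using z K by (auto simp: upper_half_def)
    ultimately show "z \<in> carleson J"
      using J(2) box_len_ge[OF J R(1)] R(1) by (auto simp: carleson_def abs_le_iff)
  qed
  then show ?thesis using that J by blast
qed

lemma bdd_cpt_suppE: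
  assumes "f \<in> bdd_cpt_supp"
  obtains K C where "compact K" "K \<subseteq> upper_half" "K \<in> sets M" "emeasure M K < \<infinity>" "f \<in> borel_measurable M"
    "\<And>z. z \<in> upper_half \<Longrightarrow> cmod (f z) \<le> C" "\<And>z. z \<in> upper_half \<Longrightarrow> z \<notin> K \<Longrightarrow> f z = 0"
proof -
  obtain K where K: "compact K" "K \<subseteq> upper_half" "\<forall>z\<in>upper_half - K. f z = 0"
    using assms by (auto simp: bdd_cpt_supp_def)
  obtain C where C: "\<forall>x\<in>f ` upper_half. cmod x \<le> C"
    using assms by (auto simp: bdd_cpt_supp_def bounded_iff)
  obtain J where J: "J \<in> D1 \<union> D2" "K \<subseteq> carleson J" using compact_subset_box[OF K(1,2)] .
  have KM: "K \<in> sets M" using K by (intro borel_sets_dA) (auto simp: borel_compact)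
  have "emeasure M K \<le> emeasure M (carleson J)" using J carleson_sets_D by (intro emeasure_mono) auto
  also have "\<dots> < \<infinity>" using carleson_measure_D[OF J(1)] by simp
  finally have "emeasure M K < \<infinity>" .
  moreover have "f \<in> borel_measurable M"
    using assms measurable_cong_sets[OF sets_dA refl] by (auto simp: bdd_cpt_supp_def)
  ultimately show ?thesis using that[of K C] K C KM by auto
qed

lemma kernel_section:
  assumes k: "bergman_type_kernel \<alpha> k" and z: "z \<in> upper_half"
  shows "k z \<in> borel_measurable M" "\<And>w. w \<in> upper_half \<Longrightarrow> cmod (k z w) \<le> Im z powr (- (2 + \<alpha>))"
proof -
  have "(\<lambda>p. k (fst p) (snd p)) \<in> borel_measurable (M \<Otimes>\<^sub>M M)" using k by (simp add: bergman_type_kernel_def)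
  from measurable_compose_Pair1[OF _ this, of z] show "k z \<in> borel_measurable M" using z by simp
  fix w assume w: "w \<in> upper_half"
  have "0 < Im z" "Im z \<le> hdist z w" using z w Im_le_hdist[of z w] by (auto simp: upper_half_def)
  then have "kern \<alpha> z w \<le> Im z powr (- (2 + \<alpha>))"
    unfolding kern_def using alpha by (intro powr_mono2') auto
  then show "cmod (k z w) \<le> Im z powr (- (2 + \<alpha>))" using k z w by (simp add: bergman_type_kernel_def)
qed

lemma commutator_eq_commop:
  assumes k: "bergman_type_kernel \<alpha> k" and hol: "b holomorphic_on upper_half" and mb [measurable]: "b \<in> borel_measurable M"
    and f: "f \<in> bdd_cpt_supp" and z: "z \<in> upper_half"
  shows "commutator b (intop \<alpha> k) f z = commop \<alpha> k b f z"
    and "integrable M (\<lambda>w. (b z - b w) * k z w * f w)"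
proof -
  obtain K C where K: "compact K" "K \<subseteq> upper_half" "K \<in> sets M" "emeasure M K < \<infinity>"
    and fm [measurable]: "f \<in> borel_measurable M"
    and C: "\<And>z. z \<in> upper_half \<Longrightarrow> cmod (f z) \<le> C" "\<And>z. z \<in> upper_half \<Longrightarrow> z \<notin> K \<Longrightarrow> f z = 0"
    using bdd_cpt_suppE[OF f] by metis
  have [measurable]: "k z \<in> borel_measurable M" by (rule kernel_section[OF k z])
  have "compact (b ` K)"
    using holomorphic_on_imp_continuous_on[OF hol] K continuous_on_subset compact_continuous_image by blast
  then obtain Cb where Cb: "Cb > 0" "\<And>w. w \<in> K \<Longrightarrow> cmod (b w) \<le> Cb"
    using compact_imp_bounded[of "b ` K"] unfolding bounded_pos by blast
  have Kz: "cmod (k z w) \<le> Im z powr (- (2 + \<alpha>))" "cmod (f w) \<le> C" if "w \<in> space M" for w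
    using kernel_section(2)[OF k z] C(1) that by simp_all
  let ?y = "Im z powr (- (2 + \<alpha>))"
  have 1: "integrable M (\<lambda>w. k z w * f w)"
  proof (rule integrableI_bounded_set[OF K(3) _ K(4), of _ "?y * C"])
    show "AE w in M. w \<in> K \<longrightarrow> norm (k z w * f w) \<le> ?y * C"
      unfolding norm_mult by (intro AE_I2 impI mult_mono Kz) simp_all
    show "AE w in M. w \<notin> K \<longrightarrow> k z w * f w = 0" using C(2) by (intro AE_I2) auto
  qed measurable
  have 2: "integrable M (\<lambda>w. k z w * (b w * f w))"
  proof (rule integrableI_bounded_set[OF K(3) _ K(4), of _ "?y * (Cb * C)"])
    show "AE w in M. w \<in> K \<longrightarrow> norm (k z w * (b w * f w)) \<le> ?y * (Cb * C)"
      unfolding norm_mult using less_imp_le[OF Cb(1)] by (intro AE_I2 impI mult_mono Kz Cb(2)) simp_all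
    show "AE w in M. w \<notin> K \<longrightarrow> k z w * (b w * f w) = 0" using C(2) by (intro AE_I2) auto
  qed measurable
  have eq: "(\<lambda>w. (b z - b w) * k z w * f w) = (\<lambda>w. b z * (k z w * f w) - k z w * (b w * f w))"
    by (auto simp: algebra_simps)
  show "integrable M (\<lambda>w. (b z - b w) * k z w * f w)"
    unfolding eq using 1 2 by (intro Bochner_Integration.integrable_diff integrable_mult_right)
  show "commutator b (intop \<alpha> k) f z = commop \<alpha> k b f z"
  proof -
    have "commop \<alpha> k b f z = (\<integral>w. b z * (k z w * f w) \<partial>M) - (\<integral>w. k z w * (b w * f w) \<partial>M)"
      unfolding commop_def eq by (intro Bochner_Integration.integral_diff integrable_mult_right 1 2)
    then show ?thesis by (simp add: commutator_def intop_def)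
  qed
qed

text \<open>Linearity holds only almost everywhere, namely at the points where the integrals for both functions
converge absolutely.\<close>

lemma commutator_extension:
  assumes k: "bergman_type_kernel \<alpha> k" and \<mu>: "bekolle \<mu> K1" and lam: "bekolle lam K2"
    and \<nu>: "\<And>z. z \<in> upper_half \<Longrightarrow> (\<nu> z)\<^sup>2 * lam z = \<mu> z" "\<And>z. z \<in> upper_half \<Longrightarrow> \<nu> z \<ge> 0"
    and m\<nu> [measurable]: "\<nu> \<in> borel_measurable M"
    and mb [measurable]: "b \<in> borel_measurable M" and hol: "b holomorphic_on upper_half" and B: "bmo_bound \<nu> b B"
  shows "bounded_extension \<alpha> \<mu> lam (commutator b (intop \<alpha> k)) (commop \<alpha> k b) (c_osc * posop_const K2 * posop_const K1 * B)"
proof -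
  have [measurable]: "\<mu> \<in> borel_measurable M" "lam \<in> borel_measurable M" "(\<lambda>p. k (fst p) (snd p)) \<in> borel_measurable (M \<Otimes>\<^sub>M M)"
    using \<mu> lam k by (auto simp: bekolle_def bergman_type_kernel_def)
  have pos: "\<mu> z \<ge> 0" "lam z > 0" "lam z \<ge> 0" if "z \<in> upper_half" for z
    using \<mu> lam that by (auto simp: bekolle_def less_imp_le)
  let ?C = "c_osc * posop_const K2 * posop_const K1 * B"
  have C: "?C \<ge> 0"
    using \<mu> lam B c_osc_pos posop_const_pos[of K1] posop_const_pos[of K2] by (auto simp: bekolle_def bmo_bound_def)
  define H where "H = (\<lambda>f z. \<integral>\<^sup>+w. ennreal (cmod ((b z - b w) * k z w * f w)) \<partial>M)"
  have mH: "H f \<in> borel_measurable M" if [measurable]: "f \<in> borel_measurable M" for f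
    unfolding H_def by (rule measurable_nn_integral_param) measurable
  have H_le: "(\<integral>\<^sup>+z. (H f z)\<^sup>2 * ennreal (lam z) \<partial>M) \<le> ennreal ((?C * L2_norm \<alpha> \<mu> f)\<^sup>2)" if f: "f \<in> L2 \<alpha> \<mu>" for f
  proof -
    have fm: "f \<in> borel_measurable M" using f by (simp add: L2_def)
    have e: "(\<integral>\<^sup>+z. (ennreal (cmod (f z)))\<^sup>2 * ennreal (\<mu> z) \<partial>M) = ennreal ((L2_norm \<alpha> \<mu> f)\<^sup>2)"
      by (rule L2_nn_integral[OF f]) (rule pos(1))
    have "(\<integral>\<^sup>+z. (H f z)\<^sup>2 * ennreal (lam z) \<partial>M) \<le> ennreal ((B * c_osc * posop_const K2 * posop_const K1)\<^sup>2) * ennreal ((L2_norm \<alpha> \<mu> f)\<^sup>2)"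
      unfolding H_def e[symmetric]
      by (rule commutator_bound[OF k \<mu> lam \<nu> m\<nu> mb hol B fm])
    also have "\<dots> = ennreal ((?C * L2_norm \<alpha> \<mu> f)\<^sup>2)"
      by (simp add: ennreal_mult[symmetric] power_mult_distrib mult_ac)
    finally show ?thesis .
  qed
  have fin: "AE z in M. H f z < \<infinity>" if f: "f \<in> L2 \<alpha> \<mu>" for f
  proof -
    have fm: "f \<in> borel_measurable M" using f by (simp add: L2_def)
    note [measurable] = mH[OF fm]
    have "(\<integral>\<^sup>+z. (H f z)\<^sup>2 * ennreal (lam z) \<partial>M) \<noteq> \<infinity>" using H_le[OF f] by (auto simp: top_unique)
    then have "AE z in M. (H f z)\<^sup>2 * ennreal (lam z) \<noteq> \<infinity>" by (intro nn_integral_PInf_AE) measurable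
    then show ?thesis using AE_space
    proof eventually_elim
      case (elim z)
      then have "lam z > 0" using pos(2) by simp
      then have "ennreal (lam z) \<noteq> 0" by (simp add: ennreal_eq_0_iff)
      then show ?case using elim(1) by (auto simp: ennreal_mult_eq_top_iff less_top power2_eq_square)
    qed
  qed
  have int: "integrable M (\<lambda>w. (b z - b w) * k z w * f w)"
    if "f \<in> borel_measurable M" "z \<in> upper_half" "H f z < \<infinity>" for f z
  proof (rule integrableI_bounded)
    have [measurable]: "k z \<in> borel_measurable M" "f \<in> borel_measurable M" using kernel_section[OF k that(2)] that by auto
    show "(\<lambda>w. (b z - b w) * k z w * f w) \<in> borel_measurable M" by measurable
    show "(\<integral>\<^sup>+w. ennreal (norm ((b z - b w) * k z w * f w)) \<partial>M) < \<infinity>" using that(3) by (simp add: H_def)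
  qed
  have le: "ennreal (cmod (commop \<alpha> k b f z)) \<le> H f z" for f z
  proof (cases "integrable M (\<lambda>w. (b z - b w) * k z w * f w)")
    case True
    then show ?thesis unfolding commop_def H_def by (rule integral_norm_bound_ennreal)
  next
    case False
    then show ?thesis by (simp add: commop_def not_integrable_integral_eq)
  qed
  show ?thesis unfolding bounded_extension_def
  proof (intro conjI ballI allI)
    fix f assume f: "f \<in> L2 \<alpha> \<mu>"
    have fm [measurable]: "f \<in> borel_measurable M" using f by (simp add: L2_def)
    have m: "commop \<alpha> k b f \<in> borel_measurable M"
      unfolding commop_def by (rule measurable_integral_param) measurable
    have "(\<integral>\<^sup>+z. (ennreal (cmod (commop \<alpha> k b f z)))\<^sup>2 * ennreal (lam z) \<partial>M) \<le> (\<integral>\<^sup>+z. (H f z)\<^sup>2 * ennreal (lam z) \<partial>M)"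
      by (intro nn_integral_mono mult_right_mono power_mono le) auto
    also have "\<dots> \<le> ennreal ((?C * L2_norm \<alpha> \<mu> f)\<^sup>2)" by (rule H_le[OF f])
    finally have *: "(\<integral>\<^sup>+z. (ennreal (cmod (commop \<alpha> k b f z)))\<^sup>2 * ennreal (lam z) \<partial>M) \<le> ennreal ((?C * L2_norm \<alpha> \<mu> f)\<^sup>2)" .
    have nn: "?C * L2_norm \<alpha> \<mu> f \<ge> 0" using C L2_norm_nonneg[of \<mu> \<alpha> f] pos by simp
    show "commop \<alpha> k b f \<in> L2 \<alpha> lam" "L2_norm \<alpha> lam (commop \<alpha> k b f) \<le> ?C * L2_norm \<alpha> \<mu> f"
      using L2_nn_integral_le[OF m _ pos(3) nn *] by auto
  next
    fix f g and c d :: complex assume f: "f \<in> L2 \<alpha> \<mu>" and g: "g \<in> L2 \<alpha> \<mu>"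
    have fm: "f \<in> borel_measurable M" "g \<in> borel_measurable M" using f g by (simp_all add: L2_def)
    show "AE z in M. commop \<alpha> k b (\<lambda>w. c * f w + d * g w) z = c * commop \<alpha> k b f z + d * commop \<alpha> k b g z"
      using fin[OF f] fin[OF g] AE_space
    proof eventually_elim
      case (elim z)
      have i: "integrable M (\<lambda>w. (b z - b w) * k z w * f w)" "integrable M (\<lambda>w. (b z - b w) * k z w * g w)"
        using int fm elim by auto
      have "commop \<alpha> k b (\<lambda>w. c * f w + d * g w) z = (\<integral>w. c * ((b z - b w) * k z w * f w) + d * ((b z - b w) * k z w * g w) \<partial>M)"
        unfolding commop_def by (intro Bochner_Integration.integral_cong) (auto simp: algebra_simps)
      also have "\<dots> = c * commop \<alpha> k b f z + d * commop \<alpha> k b g z"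
        unfolding commop_def using i by (subst Bochner_Integration.integral_add) auto
      finally show ?case .
    qed
  next
    fix f assume "f \<in> bdd_cpt_supp"
    then show "AE z in M. commop \<alpha> k b f z = commutator b (intop \<alpha> k) f z"
      using commutator_eq_commop(1)[OF k hol mb] by (intro AE_I2) simp
  qed
qed

end

section \<open>Necessity: testing the commutator on indicators\<close>

text \<open>The kernel is relatively constant under displacements that are small compared with \<open>d(z0,w0)\<close>.\<close>

definition slowly_varying :: "(complex \<Rightarrow> complex \<Rightarrow> complex) \<Rightarrow> bool" where
  "slowly_varying k \<longleftrightarrow> (\<forall>\<delta>>0. \<exists>\<eta>>0. \<forall>z\<in>upper_half. \<forall>w\<in>upper_half. \<forall>z0\<in>upper_half. \<forall>w0\<in>upper_half.
     cmod (z - z0) + cmod (w - w0) \<le> \<eta> * hdist z0 w0 \<longrightarrow> cmod (k z w - k z0 w0) \<le> \<delta> * cmod (k z0 w0))"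

lemma indicator_slab_bdd_cpt_supp:
  assumes "s > 0"
  shows "(indicator (slab a b s t) :: complex \<Rightarrow> complex) \<in> bdd_cpt_supp"
proof -
  have "indicator (slab a b s t) \<in> borel_measurable (lebesgue_on upper_half)"
    using slab_sets_dA sets_dA by (intro borel_measurable_indicator) blast
  moreover have "bounded ((indicator (slab a b s t) :: complex \<Rightarrow> complex) ` upper_half)"
    unfolding bounded_iff by (intro exI[of _ 1]) (auto simp: indicator_def)
  moreover have "slab a b s t \<subseteq> cbox (Complex a s) (Complex b t)"
    by (auto simp: slab_def in_cbox_complex_iff)
  moreover have "cbox (Complex a s) (Complex b t) \<subseteq> upper_half"
    using assms by (auto simp: upper_half_def in_cbox_complex_iff)
  ultimately show ?thesis
    unfolding bdd_cpt_supp_def by (auto intro!: exI[of _ "cbox (Complex a s) (Complex b t)"] simp: indicator_def compact_cbox)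
qed

lemma ennreal_sq_le:
  assumes "x\<^sup>2 \<le> (ennreal r)\<^sup>2" "r \<ge> 0"
  shows "x \<le> ennreal r"
proof (cases x)
  case (real q)
  then have "q\<^sup>2 \<le> r\<^sup>2" using assms by (simp add: ennreal_power ennreal_le_iff)
  then show ?thesis using real assms(2) by (auto intro!: ennreal_leI power2_le_imp_le)
next
  case top
  then show ?thesis using assms by (simp add: ennreal_power ennreal_top_mult power2_eq_square[of top] top_unique)
qed

context half_plane begin

text \<open>The mean is, up to a factor \<open>2\<close>, the constant that approximates best.\<close>

lemma average_deviation:
  assumes F: "F \<in> sets M" "emeasure M F = ennreal A" "A > 0" and mb [measurable]: "b \<in> borel_measurable M"
    and int: "set_integrable M F b"
  shows "(deviation b ((LINT w:F|M. b w) / of_real A) F)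
     \<le> 2 * (deviation b c F)"
proof -
  note [measurable] = F(1)
  define m where "m = (LINT w:F|M. b w) / of_real A"
  let ?I = "\<integral>\<^sup>+w. ennreal (cmod (b w - c)) * indicator F w \<partial>M"
  have mA: "measure M F = A" using F by (simp add: measure_def)
  have Fi: "F \<inter> upper_half = F" using sets.sets_into_space[OF F(1)] by auto
  have intc: "set_integrable M F (\<lambda>w. c)" using F by (simp add: set_integrable_def)
  have "(LINT w:F|M. b w - c) = (LINT w:F|M. b w) - (LINT w:F|M. c)"
    by (rule set_integral_diff(2)[OF int intc])
  also have "(LINT w:F|M. c) = of_real A * c"
    by (simp add: set_lebesgue_integral_def Fi mA scaleR_conv_of_real)
  finally have e0: "(LINT w:F|M. b w - c) = (LINT w:F|M. b w) - of_real A * c" .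
  have "of_real A * m = (LINT w:F|M. b w)" unfolding m_def using F(3) by simp
  then have e: "(LINT w:F|M. b w - c) = of_real A * (m - c)"
    by (simp only: e0 right_diff_distrib)
  have "ennreal (A * cmod (m - c)) = ennreal (cmod (LINT w:F|M. b w - c))"
    unfolding e norm_mult using F(3) by simp
  also have "\<dots> \<le> (\<integral>\<^sup>+w. ennreal (norm (indicator F w *\<^sub>R (b w - c))) \<partial>M)"
    unfolding set_lebesgue_integral_def
    using set_integral_diff(1)[OF int intc] by (intro integral_norm_bound_ennreal) (simp add: set_integrable_def)
  also have "\<dots> = ?I" by (intro nn_integral_cong) (auto simp: indicator_def)
  finally have 1: "ennreal (A * cmod (m - c)) \<le> ?I" .
  have "deviation b m F \<le> (\<integral>\<^sup>+w. ennreal (cmod (b w - c)) * indicator F w + ennreal (cmod (m - c)) * indicator F w \<partial>M)"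
  proof (rule nn_integral_mono)
    fix w
    have "cmod (b w - m) \<le> cmod (b w - c) + cmod (m - c)"
      using norm_triangle_ineq4[of "b w - c" "m - c"] by simp
    then have "ennreal (cmod (b w - m)) \<le> ennreal (cmod (b w - c)) + ennreal (cmod (m - c))"
      by (intro ennreal_le_add) auto
    then show "ennreal (cmod (b w - m)) * indicator F w \<le> ennreal (cmod (b w - c)) * indicator F w + ennreal (cmod (m - c)) * indicator F w"
      by (auto simp: indicator_def)
  qed
  also have "\<dots> = ?I + ennreal (cmod (m - c)) * emeasure M F"
    by (subst nn_integral_add) (auto simp: nn_integral_cmult_indicator)
  also have "ennreal (cmod (m - c)) * emeasure M F = ennreal (A * cmod (m - c))"
    unfolding F(2) using F(3) by (simp add: ennreal_mult mult.commute)
  also have "?I + ennreal (A * cmod (m - c)) \<le> ?I + ?I" by (intro add_left_mono 1)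
  finally show ?thesis by (simp add: m_def mult_2)
qed

lemma double_oscillation_le:
  assumes [measurable]: "E \<in> sets M" "F \<in> sets M" "b \<in> borel_measurable M"
  shows "(\<integral>\<^sup>+z. (\<integral>\<^sup>+w. ennreal (cmod (b z - b w)) * indicator F w \<partial>M) * indicator E z \<partial>M)
    \<le> emeasure M F * (deviation b c E) + emeasure M E * (deviation b c F)"
proof -
  let ?Y = "\<integral>\<^sup>+w. ennreal (cmod (b w - c)) * indicator F w \<partial>M"
  have "(\<integral>\<^sup>+w. ennreal (cmod (b z - b w)) * indicator F w \<partial>M) \<le> ennreal (cmod (b z - c)) * emeasure M F + ?Y" for z
  proof -
    have "(\<integral>\<^sup>+w. ennreal (cmod (b z - b w)) * indicator F w \<partial>M) \<le> (\<integral>\<^sup>+w. ennreal (cmod (b z - c)) * indicator F w + ennreal (cmod (b w - c)) * indicator F w \<partial>M)"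
    proof (rule nn_integral_mono)
      fix w
      have "cmod (b z - b w) \<le> cmod (b z - c) + cmod (b w - c)"
        using norm_triangle_ineq4[of "b z - c" "b w - c"] by simp
      then have "ennreal (cmod (b z - b w)) \<le> ennreal (cmod (b z - c)) + ennreal (cmod (b w - c))"
        by (intro ennreal_le_add) auto
      then show "ennreal (cmod (b z - b w)) * indicator F w \<le> ennreal (cmod (b z - c)) * indicator F w + ennreal (cmod (b w - c)) * indicator F w"
        by (auto simp: indicator_def)
    qed
    also have "\<dots> = ennreal (cmod (b z - c)) * emeasure M F + ?Y"
      by (subst nn_integral_add) (auto simp: nn_integral_cmult_indicator)
    finally show ?thesis .
  qed
  then have "(\<integral>\<^sup>+z. (\<integral>\<^sup>+w. ennreal (cmod (b z - b w)) * indicator F w \<partial>M) * indicator E z \<partial>M)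
    \<le> (\<integral>\<^sup>+z. (ennreal (cmod (b z - c)) * emeasure M F + ?Y) * indicator E z \<partial>M)"
    by (intro nn_integral_mono mult_right_mono) auto
  also have "\<dots> = (\<integral>\<^sup>+z. emeasure M F * (ennreal (cmod (b z - c)) * indicator E z) + ?Y * indicator E z \<partial>M)"
    by (intro nn_integral_cong) (simp only: distrib_right distrib_left mult_ac)
  also have "\<dots> = emeasure M F * (deviation b c E) + ?Y * emeasure M E"
    by (subst nn_integral_add) (auto simp: nn_integral_cmult_indicator nn_integral_cmult)
  finally show ?thesis by (simp only: mult.commute)
qed

text \<open>If the kernel were equal to \<open>K0\<close> on \<open>E \<times> F\<close>, then \<open>[b,T]1\<^sub>F\<close> would be \<open>K0 M(F) (b - b\<^sub>F)\<close> on \<open>E\<close>. The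
difference is an integral of \<open>b(z) - b(w)\<close> against \<open>k(z,w) - K0\<close>.\<close>

lemma commutator_test:
  assumes k: "bergman_type_kernel \<alpha> k" and mb [measurable]: "b \<in> borel_measurable M" and hol: "b holomorphic_on upper_half"
    and E [measurable]: "E \<in> sets M" and F: "F \<in> sets M" "emeasure M F = ennreal A" "A > 0" and FC: "(indicator F :: complex \<Rightarrow> complex) \<in> bdd_cpt_supp"
    and int: "set_integrable M F b"
    and K0: "\<And>z w. z \<in> E \<Longrightarrow> w \<in> F \<Longrightarrow> cmod (k z w - K0) \<le> \<delta> * cmod K0" and \<delta>: "\<delta> \<ge> 0"
  shows "ennreal (cmod K0 * A) * (deviation b ((LINT w:F|M. b w) / of_real A) E)
    \<le> (\<integral>\<^sup>+z. ennreal (cmod (commop \<alpha> k b (indicator F) z)) * indicator E z \<partial>M)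
      + ennreal (\<delta> * cmod K0) * (\<integral>\<^sup>+z. (\<integral>\<^sup>+w. ennreal (cmod (b z - b w)) * indicator F w \<partial>M) * indicator E z \<partial>M)"
proof -
  note [measurable] = F(1)
  have [measurable]: "(\<lambda>p. k (fst p) (snd p)) \<in> borel_measurable (M \<Otimes>\<^sub>M M)" using k by (simp add: bergman_type_kernel_def)
  have mA: "measure M F = A" using F by (simp add: measure_def)
  have Fi: "F \<inter> upper_half = F" using sets.sets_into_space[OF F(1)] by auto
  define c where "c = (LINT w:F|M. b w) / of_real A"
  have ptw: "ennreal (cmod K0 * A) * ennreal (cmod (b z - c))
     \<le> ennreal (cmod (commop \<alpha> k b (indicator F) z)) + ennreal (\<delta> * cmod K0) * (\<integral>\<^sup>+w. ennreal (cmod (b z - b w)) * indicator F w \<partial>M)"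
    if z: "z \<in> E" for z
  proof -
    have zu: "z \<in> upper_half" using z sets.sets_into_space[OF E] by auto
    have [measurable]: "k z \<in> borel_measurable M" by (rule kernel_section[OF k zu])
    let ?g = "\<lambda>w. indicator F w * (b z - b w)"
    have intz: "set_integrable M F (\<lambda>w. b z)" using F by (simp add: set_integrable_def)
    have "(\<lambda>w. indicator F w *\<^sub>R (b z - b w)) = ?g" by (auto simp: indicator_def)
    then have ig: "integrable M ?g" and Lg: "(LINT w:F|M. b z - b w) = (\<integral>w. ?g w \<partial>M)"
      using set_integral_diff(1)[OF intz int] by (simp_all add: set_integrable_def set_lebesgue_integral_def)
    have "(LINT w:F|M. b z - b w) = (LINT w:F|M. b z) - (LINT w:F|M. b w)"
      by (rule set_integral_diff(2)[OF intz int])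
    also have "(LINT w:F|M. b z) = of_real A * b z"
      by (simp add: set_lebesgue_integral_def Fi mA scaleR_conv_of_real)
    finally have g0: "(\<integral>w. ?g w \<partial>M) = of_real A * b z - (LINT w:F|M. b w)" unfolding Lg .
    have Ac: "of_real A * c = (LINT w:F|M. b w)" unfolding c_def using F(3) by simp
    have g: "(\<integral>w. ?g w \<partial>M) = of_real A * (b z - c)"
      unfolding g0 Ac[symmetric] by (rule right_diff_distrib[symmetric])
    have ik: "integrable M (\<lambda>w. (b z - b w) * k z w * indicator F w)"
      by (rule commutator_eq_commop(2)[OF k hol mb FC zu])
    have i0: "integrable M (\<lambda>w. K0 * ?g w - (b z - b w) * k z w * indicator F w)"
      by (intro Bochner_Integration.integrable_diff integrable_mult_right ig ik)
    have "K0 * (of_real A * (b z - c)) = (\<integral>w. K0 * ?g w \<partial>M)"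
      unfolding g[symmetric] by (rule integral_mult_right_zero[symmetric])
    also have "\<dots> = (\<integral>w. (b z - b w) * k z w * indicator F w + (K0 * ?g w - (b z - b w) * k z w * indicator F w) \<partial>M)"
      by (intro Bochner_Integration.integral_cong refl) simp
    also have "\<dots> = commop \<alpha> k b (indicator F) z + (\<integral>w. K0 * ?g w - (b z - b w) * k z w * indicator F w \<partial>M)"
      unfolding commop_def by (rule Bochner_Integration.integral_add[OF ik i0])
    finally have eq: "K0 * (of_real A * (b z - c)) = commop \<alpha> k b (indicator F) z + (\<integral>w. K0 * ?g w - (b z - b w) * k z w * indicator F w \<partial>M)" .
    have "cmod (K0 * (of_real A * (b z - c))) \<le> cmod (commop \<alpha> k b (indicator F) z) + cmod (\<integral>w. K0 * ?g w - (b z - b w) * k z w * indicator F w \<partial>M)"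
      unfolding eq by (rule norm_triangle_ineq)
    then have "ennreal (cmod K0 * A * cmod (b z - c)) \<le> ennreal (cmod (commop \<alpha> k b (indicator F) z)) + ennreal (cmod (\<integral>w. K0 * ?g w - (b z - b w) * k z w * indicator F w \<partial>M))"
    proof (intro ennreal_le_add)
      have "cmod (K0 * (of_real A * (b z - c))) = cmod K0 * A * cmod (b z - c)"
        using F(3) by (simp only: norm_mult norm_of_real mult.assoc abs_of_pos)
      then show "cmod K0 * A * cmod (b z - c) \<le> cmod (commop \<alpha> k b (indicator F) z) + cmod (\<integral>w. K0 * ?g w - (b z - b w) * k z w * indicator F w \<partial>M)"
        using \<open>cmod (K0 * (of_real A * (b z - c))) \<le> _\<close> by (simp only:)
    qed simp_all
    also have "ennreal (cmod (\<integral>w. K0 * ?g w - (b z - b w) * k z w * indicator F w \<partial>M)) \<le> (\<integral>\<^sup>+w. ennreal (cmod (K0 * ?g w - (b z - b w) * k z w * indicator F w)) \<partial>M)"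
      by (rule integral_norm_bound_ennreal[OF i0])
    also have "\<dots> \<le> (\<integral>\<^sup>+w. ennreal (\<delta> * cmod K0) * (ennreal (cmod (b z - b w)) * indicator F w) \<partial>M)"
    proof (rule nn_integral_mono)
      fix w
      show "ennreal (cmod (K0 * ?g w - (b z - b w) * k z w * indicator F w)) \<le> ennreal (\<delta> * cmod K0) * (ennreal (cmod (b z - b w)) * indicator F w)"
      proof (cases "w \<in> F")
        case True
        have "cmod (K0 * (b z - b w) - (b z - b w) * k z w) = cmod (k z w - K0) * cmod (b z - b w)"
        proof -
          have "K0 * (b z - b w) - (b z - b w) * k z w = - ((k z w - K0) * (b z - b w))" by (simp add: algebra_simps)
          then show ?thesis by (simp only: norm_minus_cancel norm_mult)
        qed
        also have "\<dots> \<le> \<delta> * cmod K0 * cmod (b z - b w)" by (intro mult_right_mono K0 z True) simp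
        finally have "ennreal (cmod (K0 * (b z - b w) - (b z - b w) * k z w)) \<le> ennreal (\<delta> * cmod K0) * ennreal (cmod (b z - b w))"
          using \<delta> by (subst ennreal_mult[symmetric]) (auto intro: ennreal_leI)
        then show ?thesis using True by simp
      qed simp
    qed
    also have "\<dots> = ennreal (\<delta> * cmod K0) * (\<integral>\<^sup>+w. ennreal (cmod (b z - b w)) * indicator F w \<partial>M)"
      by (rule nn_integral_cmult) measurable
    finally have *: "ennreal (cmod K0 * A * cmod (b z - c)) \<le> ennreal (cmod (commop \<alpha> k b (indicator F) z)) + ennreal (\<delta> * cmod K0) * (\<integral>\<^sup>+w. ennreal (cmod (b z - b w)) * indicator F w \<partial>M)"
      by (simp add: add_left_mono)
    have "ennreal (cmod K0 * A) * ennreal (cmod (b z - c)) = ennreal (cmod K0 * A * cmod (b z - c))"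
      using F(3) by (intro ennreal_mult[symmetric]) auto
    then show ?thesis using * by simp
  qed
  have mD [measurable]: "(\<lambda>z. \<integral>\<^sup>+w. ennreal (cmod (b z - b w)) * indicator F w \<partial>M) \<in> borel_measurable M"
    by (rule measurable_nn_integral_param) measurable
  have mC [measurable]: "(\<lambda>z. commop \<alpha> k b (indicator F) z) \<in> borel_measurable M"
    unfolding commop_def by (rule measurable_integral_param) measurable
  have "ennreal (cmod K0 * A) * (deviation b c E)
     = (\<integral>\<^sup>+z. ennreal (cmod K0 * A) * ennreal (cmod (b z - c)) * indicator E z \<partial>M)"
    unfolding mult.assoc by (rule nn_integral_cmult[symmetric]) measurable
  also have "\<dots> \<le> (\<integral>\<^sup>+z. ennreal (cmod (commop \<alpha> k b (indicator F) z)) * indicator E z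
      + ennreal (\<delta> * cmod K0) * ((\<integral>\<^sup>+w. ennreal (cmod (b z - b w)) * indicator F w \<partial>M) * indicator E z) \<partial>M)"
  proof (rule nn_integral_mono)
    fix z
    show "ennreal (cmod K0 * A) * ennreal (cmod (b z - c)) * indicator E z \<le> ennreal (cmod (commop \<alpha> k b (indicator F) z)) * indicator E z
      + ennreal (\<delta> * cmod K0) * ((\<integral>\<^sup>+w. ennreal (cmod (b z - b w)) * indicator F w \<partial>M) * indicator E z)"
      using ptw[of z] by (cases "z \<in> E") simp_all
  qed
  also have "\<dots> = (\<integral>\<^sup>+z. ennreal (cmod (commop \<alpha> k b (indicator F) z)) * indicator E z \<partial>M)
      + ennreal (\<delta> * cmod K0) * (\<integral>\<^sup>+z. (\<integral>\<^sup>+w. ennreal (cmod (b z - b w)) * indicator F w \<partial>M) * indicator E z \<partial>M)"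
    by (subst nn_integral_add) (auto simp: nn_integral_cmult)
  finally show ?thesis by (simp only: c_def)
qed

text \<open>Cauchy-Schwarz against \<open>\<lambda>\<^bsup>-1\<^esup>\<close>, and the operator bound for \<open>1\<^sub>F\<close>.\<close>

lemma commutator_mass_le:
  assumes k: "bergman_type_kernel \<alpha> k" and mb [measurable]: "b \<in> borel_measurable M" and hol: "b holomorphic_on upper_half"
    and \<mu>: "bekolle \<mu> K1" and lam: "bekolle lam K2"
    and S: "bounded_extension \<alpha> \<mu> lam (commutator b (intop \<alpha> k)) S C" and C: "C \<ge> 0"
    and E [measurable]: "E \<in> sets M" and F [measurable]: "F \<in> sets M" and FC: "(indicator F :: complex \<Rightarrow> complex) \<in> bdd_cpt_supp"
    and W: "mass \<mu> F * (mass (\<lambda>z. inverse (lam z)) E) \<le> ennreal (W\<^sup>2)" "W \<ge> 0"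
    and fin: "mass \<mu> F < \<infinity>"
  shows "(\<integral>\<^sup>+z. ennreal (cmod (commop \<alpha> k b (indicator F) z)) * indicator E z \<partial>M) \<le> ennreal (C * W)"
proof -
  have [measurable]: "\<mu> \<in> borel_measurable M" "lam \<in> borel_measurable M" "(\<lambda>p. k (fst p) (snd p)) \<in> borel_measurable (M \<Otimes>\<^sub>M M)"
    using \<mu> lam k by (auto simp: bekolle_def bergman_type_kernel_def)
  have pos: "\<mu> z \<ge> 0" "lam z > 0" "lam z \<ge> 0" if "z \<in> upper_half" for z
    using \<mu> lam that by (auto simp: bekolle_def less_imp_le)
  let ?f = "indicator F :: complex \<Rightarrow> complex"
  let ?T = "commop \<alpha> k b ?f"
  have [measurable]: "?T \<in> borel_measurable M"
    unfolding commop_def by (rule measurable_integral_param) measurable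
  have e1: "(\<integral>\<^sup>+z. (ennreal (cmod (?f z)))\<^sup>2 * ennreal (\<mu> z) \<partial>M) = (mass \<mu> F)"
    by (intro nn_integral_cong) (auto simp: indicator_def)
  obtain r where r: "r \<ge> 0" "mass \<mu> F = ennreal r"
    using fin by (cases "\<integral>\<^sup>+z. ennreal (\<mu> z) * indicator F z \<partial>M") auto
  have fL2: "?f \<in> L2 \<alpha> \<mu>"
    by (rule L2_nn_integral_le(1)[where C = "sqrt r"]) (use pos r e1 in auto)
  have nf: "ennreal ((L2_norm \<alpha> \<mu> ?f)\<^sup>2) = (mass \<mu> F)"
    using L2_nn_integral[OF fL2, of] pos(1) e1 by simp
  have SL2: "S ?f \<in> L2 \<alpha> lam" and Sn: "L2_norm \<alpha> lam (S ?f) \<le> C * L2_norm \<alpha> \<mu> ?f"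
    and SA: "AE z in M. S ?f z = commutator b (intop \<alpha> k) ?f z"
    using S fL2 FC unfolding bounded_extension_def by blast+
  have ST: "AE z in M. ?T z = S ?f z"
    using SA AE_space by eventually_elim (use commutator_eq_commop(1)[OF k hol mb FC] in simp)
  have "(\<integral>\<^sup>+z. (ennreal (cmod (?T z)))\<^sup>2 * ennreal (lam z) \<partial>M) = (\<integral>\<^sup>+z. (ennreal (cmod (S ?f z)))\<^sup>2 * ennreal (lam z) \<partial>M)"
    by (rule nn_integral_cong_AE, use ST in eventually_elim) simp
  also have "\<dots> = ennreal ((L2_norm \<alpha> lam (S ?f))\<^sup>2)" by (rule L2_nn_integral[OF SL2]) (rule pos(3))
  also have "\<dots> \<le> ennreal ((C * L2_norm \<alpha> \<mu> ?f)\<^sup>2)"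
    using L2_norm_nonneg[of lam \<alpha> "S ?f"] pos(3) by (intro ennreal_leI power_mono Sn) auto
  also have "\<dots> = ennreal (C\<^sup>2) * ennreal ((L2_norm \<alpha> \<mu> ?f)\<^sup>2)" by (simp add: power_mult_distrib ennreal_mult)
  finally have T2: "(\<integral>\<^sup>+z. (ennreal (cmod (?T z)))\<^sup>2 * ennreal (lam z) \<partial>M) \<le> ennreal (C\<^sup>2) * (mass \<mu> F)"
    unfolding nf .
  have inv: "ennreal (lam z) * ennreal (inverse (lam z)) = 1" if "z \<in> upper_half" for z
    using pos(2)[OF that] by (subst ennreal_mult[symmetric]) auto
  let ?g = "\<lambda>z. ennreal (cmod (?T z)) * ennreal (lam z)"
  have "(\<integral>\<^sup>+z. ennreal (cmod (?T z)) * indicator E z \<partial>M)\<^sup>2 = (\<integral>\<^sup>+z. ?g z * ennreal (inverse (lam z)) * indicator E z \<partial>M)\<^sup>2"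
    by (intro arg_cong[where f = "\<lambda>x. x\<^sup>2"] nn_integral_cong) (simp add: mult.assoc inv)
  also have "\<dots> \<le> (\<integral>\<^sup>+z. (?g z)\<^sup>2 * ennreal (inverse (lam z)) * indicator E z \<partial>M) * (mass (\<lambda>z. inverse (lam z)) E)"
    by (rule weighted_Cauchy_Schwarz) (use pos in auto)
  also have "\<dots> \<le> (\<integral>\<^sup>+z. (ennreal (cmod (?T z)))\<^sup>2 * ennreal (lam z) \<partial>M) * (mass (\<lambda>z. inverse (lam z)) E)"
  proof (intro mult_right_mono nn_integral_mono)
    fix z assume "z \<in> space M"
    then have "(?g z)\<^sup>2 * ennreal (inverse (lam z)) = (ennreal (cmod (?T z)))\<^sup>2 * ennreal (lam z)"
      by (simp add: power2_eq_square mult.assoc inv) (simp add: mult_ac)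
    then show "(?g z)\<^sup>2 * ennreal (inverse (lam z)) * indicator E z \<le> (ennreal (cmod (?T z)))\<^sup>2 * ennreal (lam z)"
      by (auto simp: indicator_def)
  qed simp
  also have "\<dots> \<le> (ennreal (C\<^sup>2) * (mass \<mu> F)) * (mass (\<lambda>z. inverse (lam z)) E)"
    by (intro mult_right_mono T2) simp
  also have "\<dots> \<le> ennreal (C\<^sup>2) * ennreal (W\<^sup>2)"
    unfolding mult.assoc by (intro mult_left_mono W) simp
  also have "\<dots> = (ennreal (C * W))\<^sup>2" using C W by (simp add: ennreal_mult power_mult_distrib ennreal_power)
  finally show ?thesis by (rule ennreal_sq_le) (use C W in simp)
qed

text \<open>Adding the two inequalities, the terms with factor \<open>\<delta>\<close> make up at most half of \<open>x + y\<close>.\<close>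

lemma absorb_cross_terms:
  fixes x y p q \<delta> \<theta>' :: real
  assumes "x \<ge> 0" "y \<ge> 0" "\<theta>' \<ge> 1" and \<delta>: "\<delta> = 1 / (8 * \<theta>')"
    and x: "x \<le> p + \<delta> * (x + \<theta>' * (2 * y))" and y: "y \<le> q + \<delta> * (2 * x + y)"
  shows "x \<le> 2 * (p + q)"
proof -
  have "\<delta> * (x + \<theta>' * (2 * y)) = \<delta> * x + (\<delta> * \<theta>') * (2 * y)" by (simp add: algebra_simps)
  also have "\<delta> * \<theta>' = 1 / 8" using assms by simp
  finally have 1: "\<delta> * (x + \<theta>' * (2 * y)) = \<delta> * x + y / 4" by simp
  have d: "\<delta> \<le> 1 / 8" unfolding \<delta> using assms(3) by (intro divide_left_mono) auto
  have "\<delta> * x \<le> 1 / 8 * x" by (rule mult_right_mono[OF d assms(1)])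
  moreover have "\<delta> * y \<le> 1 / 8 * y" by (rule mult_right_mono[OF d assms(2)])
  moreover have "\<delta> * (2 * x + y) = 2 * (\<delta> * x) + \<delta> * y" by (simp add: algebra_simps)
  ultimately have "x \<le> 2 * p + 2 * q" using x y assms(1,2) unfolding 1 by linarith
  then show ?thesis by (simp only: distrib_left)
qed

end

lemma half_open_interval: "is_interval {a..<c::real} \<and> bounded {a..<c}"
  using bounded_subset[OF bounded_closed_interval[of a c], of "{a..<c}"]
  by (auto simp: is_interval_co subset_iff)

context half_plane begin

definition weight_ratio :: "real \<Rightarrow> real \<Rightarrow> real \<Rightarrow> real" where
  "weight_ratio K1 K2 R = sqrt (K1 * K2) * ((C0 * (2 * R + 1)) powr (2 + \<alpha>))\<^sup>2"

text \<open>Let \<open>A\<close>, \<open>A\<^sub>J\<close> be the measures of the two boxes. Cauchy-Schwarz twice gives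
\<open>A\<^sup>4 \<le> \<nu>(Q\<^sub>I)\<^sup>2 \<nu>\<^bsup>-1\<^esup>(Q\<^sub>I)\<^sup>2 \<le> \<nu>(Q\<^sub>I)\<^sup>2 \<mu>\<^bsup>-1\<^esup>(Q\<^sub>J) \<lambda>(Q\<^sub>J)\<close>. Multiplying by \<open>\<mu>(Q\<^sub>J) \<lambda>\<^bsup>-1\<^esup>(Q\<^sub>J)\<close> and using both
Bekolle conditions on \<open>J\<close> bounds \<open>A\<^sup>4 \<mu>(Q\<^sub>J) \<lambda>\<^bsup>-1\<^esup>(Q\<^sub>J)\<close> by \<open>K1 K2 A\<^sub>J\<^sup>4 \<nu>(Q\<^sub>I)\<^sup>2\<close>.\<close>

lemma two_weight_box:
  assumes \<mu>: "bekolle \<mu> K1" and lam: "bekolle lam K2"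
    and \<nu>: "\<And>z. z \<in> upper_half \<Longrightarrow> (\<nu> z)\<^sup>2 * lam z = \<mu> z" "\<And>z. z \<in> upper_half \<Longrightarrow> \<nu> z > 0"
    and [measurable]: "\<nu> \<in> borel_measurable M"
    and I: "I \<in> D1 \<union> D2" and J: "J \<in> D1 \<union> D2" "I \<subseteq> J" "len J \<le> C0 * (2 * R + 1) * len I" and R: "R > 0"
    and v: "mass \<nu> (carleson I) = ennreal v" "v \<ge> 0"
  shows "mass \<mu> (carleson J) * (mass (\<lambda>z. inverse (lam z)) (carleson J))
     \<le> ennreal ((weight_ratio K1 K2 R * v)\<^sup>2)"
proof -
  have [measurable]: "\<mu> \<in> borel_measurable M" "lam \<in> borel_measurable M" "carleson I \<in> sets M" "carleson J \<in> sets M"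
    using \<mu> lam carleson_sets_D I J by (auto simp: bekolle_def)
  have K: "K1 \<ge> 0" "K2 \<ge> 0" using \<mu> lam by (auto simp: bekolle_def)
  have pos: "\<mu> z > 0" "lam z > 0" if "z \<in> upper_half" for z
    using \<mu> lam that by (auto simp: bekolle_def)
  have lI: "len I > 0" and lJ: "len J > 0" using len_pos I J by auto
  have sub: "carleson I \<subseteq> carleson J"
    using J(2) by (auto simp: carleson_def) (metis I J(1) J(2) dual_order.strict_trans1 half_open len_atLeastLessThan
        less_imp_le ivl_subset diff_mono not_le)
  have mono: "mass w (carleson I) \<le> mass w (carleson J)" for w
    using sub by (intro nn_integral_mono mult_left_mono) (auto simp: indicator_def)
  have fin: "mass \<mu> (carleson J) < \<infinity>" "mass (\<lambda>z. inverse (\<mu> z)) (carleson J) < \<infinity>" "mass lam (carleson J) < \<infinity>" "mass (\<lambda>z. inverse (lam z)) (carleson J) < \<infinity>"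
    using bekolle_finite[OF \<mu> J(1)] bekolle_finite[OF bekolle_inverse[OF \<mu>] J(1)]
      bekolle_finite[OF lam J(1)] bekolle_finite[OF bekolle_inverse[OF lam] J(1)] by auto
  obtain m where m: "mass \<mu> (carleson J) = ennreal m" "m \<ge> 0" using fin(1) by (cases "mass \<mu> (carleson J)") auto
  obtain m' where m': "mass (\<lambda>z. inverse (\<mu> z)) (carleson J) = ennreal m'" "m' \<ge> 0" using fin(2) by (cases "mass (\<lambda>z. inverse (\<mu> z)) (carleson J)") auto
  obtain l where l: "mass lam (carleson J) = ennreal l" "l \<ge> 0" using fin(3) by (cases "mass lam (carleson J)") auto
  obtain l' where l': "mass (\<lambda>z. inverse (lam z)) (carleson J) = ennreal l'" "l' \<ge> 0" using fin(4) by (cases "mass (\<lambda>z. inverse (lam z)) (carleson J)") auto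
  define A AJ where "A = box_const * len I powr (2 + \<alpha>)" and "AJ = box_const * len J powr (2 + \<alpha>)"
  have A: "A > 0" "AJ > 0" using box_const_pos lI lJ by (auto simp: A_def AJ_def)
  have mm: "m * m' \<le> K1 * AJ\<^sup>2" and ll: "l * l' \<le> K2 * AJ\<^sup>2"
  proof -
    have "mass \<mu> (carleson J) * mass (\<lambda>z. inverse (\<mu> z)) (carleson J) \<le> ennreal K1 * (emeasure M (carleson J))\<^sup>2"
      using \<mu> J(1) unfolding bekolle_def by blast
    then have "ennreal (m * m') \<le> ennreal (K1 * AJ\<^sup>2)"
      unfolding m m' carleson_measure_D[OF J(1)] AJ_def[symmetric] using K A m m' by (simp add: ennreal_mult ennreal_power)
    then show "m * m' \<le> K1 * AJ\<^sup>2" using K by (simp add: ennreal_le_iff)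
    have "mass lam (carleson J) * mass (\<lambda>z. inverse (lam z)) (carleson J) \<le> ennreal K2 * (emeasure M (carleson J))\<^sup>2"
      using lam J(1) unfolding bekolle_def by blast
    then have "ennreal (l * l') \<le> ennreal (K2 * AJ\<^sup>2)"
      unfolding l l' carleson_measure_D[OF J(1)] AJ_def[symmetric] using K A l l' by (simp add: ennreal_mult ennreal_power)
    then show "l * l' \<le> K2 * AJ\<^sup>2" using K by (simp add: ennreal_le_iff)
  qed
  have "A ^ 4 \<le> v\<^sup>2 * (m' * l)"
  proof -
    let ?n = "mass (\<lambda>z. inverse (\<nu> z)) (carleson I)"
    have 1: "(emeasure M (carleson I))\<^sup>2 \<le> ?n * ennreal v"
      unfolding v(1)[symmetric] by (rule weight_dual_ge) (use \<nu> in auto)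
    let ?f = "\<lambda>z. ennreal (inverse (\<nu> z) * inverse (lam z))"
    have "?n\<^sup>2 = (\<integral>\<^sup>+z. ?f z * ennreal (lam z) * indicator (carleson I) z \<partial>M)\<^sup>2"
    proof (intro arg_cong[where f = "\<lambda>x. x\<^sup>2"] nn_integral_cong)
      fix z assume "z \<in> space M"
      then have p: "lam z > 0" "\<nu> z > 0" using pos \<nu> by auto
      have "?f z * ennreal (lam z) = ennreal (inverse (\<nu> z))"
        using p by (subst ennreal_mult[symmetric]) (auto simp: field_simps)
      then show "ennreal (inverse (\<nu> z)) * indicator (carleson I) z = ?f z * ennreal (lam z) * indicator (carleson I) z" by simp
    qed
    also have "\<dots> \<le> (\<integral>\<^sup>+z. (?f z)\<^sup>2 * ennreal (lam z) * indicator (carleson I) z \<partial>M) * mass lam (carleson I)"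
      by (rule weighted_Cauchy_Schwarz) (use pos in \<open>auto simp: less_imp_le\<close>)
    also have "(\<integral>\<^sup>+z. (?f z)\<^sup>2 * ennreal (lam z) * indicator (carleson I) z \<partial>M) = mass (\<lambda>z. inverse (\<mu> z)) (carleson I)"
    proof (intro nn_integral_cong)
      fix z assume "z \<in> space M"
      then have z: "z \<in> upper_half" by simp
      then have p: "lam z > 0" "\<nu> z > 0" using pos \<nu> by auto
      have "(?f z)\<^sup>2 * ennreal (lam z) = ennreal ((inverse (\<nu> z) * inverse (lam z))\<^sup>2 * lam z)"
        using p by (simp add: ennreal_power ennreal_mult[symmetric])
      also have "(inverse (\<nu> z) * inverse (lam z))\<^sup>2 * lam z = inverse (\<mu> z)"
        unfolding \<nu>(1)[OF z, symmetric] using p by (simp add: field_simps power2_eq_square)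
      finally show "(?f z)\<^sup>2 * ennreal (lam z) * indicator (carleson I) z = ennreal (inverse (\<mu> z)) * indicator (carleson I) z" by simp
    qed
    also have "mass (\<lambda>z. inverse (\<mu> z)) (carleson I) * mass lam (carleson I) \<le> ennreal m' * ennreal l"
      unfolding m'(1)[symmetric] l(1)[symmetric] by (intro mult_mono mono) auto
    finally have 2: "?n\<^sup>2 \<le> ennreal m' * ennreal l" .
    have "((emeasure M (carleson I))\<^sup>2)\<^sup>2 \<le> (?n * ennreal v)\<^sup>2" by (intro power_mono 1) simp
    also have "\<dots> = ?n\<^sup>2 * ennreal (v\<^sup>2)" using v by (simp add: power_mult_distrib ennreal_power)
    also have "\<dots> \<le> (ennreal m' * ennreal l) * ennreal (v\<^sup>2)" by (intro mult_right_mono 2) simp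
    also have "\<dots> = ennreal (v\<^sup>2 * (m' * l))" using m' l by (simp add: ennreal_mult mult_ac)
    finally have "ennreal ((A\<^sup>2)\<^sup>2) \<le> ennreal (v\<^sup>2 * (m' * l))"
      unfolding carleson_measure_D[OF I] A_def[symmetric] using A by (simp add: ennreal_power)
    then have "(A\<^sup>2)\<^sup>2 \<le> v\<^sup>2 * (m' * l)" using m' l by (simp add: ennreal_le_iff)
    then show ?thesis by (simp add: power_mult[symmetric])
  qed
  then have "A ^ 4 * (m * l') \<le> v\<^sup>2 * (m' * l) * (m * l')"
    using m l' by (intro mult_right_mono) auto
  also have "\<dots> = v\<^sup>2 * ((m * m') * (l * l'))" by (simp only: mult_ac)
  also have "\<dots> \<le> v\<^sup>2 * ((K1 * AJ\<^sup>2) * (K2 * AJ\<^sup>2))"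
    using m m' l l' K by (intro mult_left_mono mult_mono mm ll) auto
  also have "\<dots> = A ^ 4 * ((sqrt (K1 * K2) * (AJ / A)\<^sup>2 * v)\<^sup>2)"
    using A K by (simp add: power_mult_distrib power_divide power_mult[symmetric])
  finally have "m * l' \<le> (sqrt (K1 * K2) * (AJ / A)\<^sup>2 * v)\<^sup>2" using A by simp
  also have "\<dots> \<le> (weight_ratio K1 K2 R * v)\<^sup>2"
  proof -
    have "AJ / A = (len J / len I) powr (2 + \<alpha>)"
      using box_const_pos lI lJ by (simp add: A_def AJ_def powr_divide)
    also have "\<dots> \<le> (C0 * (2 * R + 1)) powr (2 + \<alpha>)"
      using alpha lI lJ J(3) by (intro powr_mono2) (auto simp: field_simps)
    finally have "(AJ / A)\<^sup>2 \<le> ((C0 * (2 * R + 1)) powr (2 + \<alpha>))\<^sup>2" using A by (intro power_mono) auto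
    then have "sqrt (K1 * K2) * (AJ / A)\<^sup>2 * v \<le> weight_ratio K1 K2 R * v"
      unfolding weight_ratio_def using K v by (intro mult_right_mono mult_left_mono) auto
    moreover have "sqrt (K1 * K2) * (AJ / A)\<^sup>2 * v \<ge> 0" using K v by simp
    ultimately show ?thesis by (intro power_mono)
  qed
  finally show ?thesis unfolding m(1) l'(1) using m l' by (simp add: ennreal_mult[symmetric] ennreal_leI)
qed

lemma slab_set_integrable:
  fixes b :: "complex \<Rightarrow> complex"
  assumes "\<forall>I. is_interval I \<and> bounded I \<longrightarrow> set_integrable M (carleson I) b" "a < c" "s \<ge> 0"
  shows "set_integrable M (slab a c s (c - a)) b"
proof (rule set_integrable_subset)
  show "set_integrable M (carleson {a..<c}) b"
    using assms(1) half_open_interval by blast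
  show "slab a c s (c - a) \<in> sets M" by (rule slab_sets_dA)
  show "slab a c s (c - a) \<subseteq> carleson {a..<c}"
    unfolding carleson_half_open[OF assms(2)] by (auto simp: slab_def)
qed

lemma set_integrable_deviation_finite:
  assumes "set_integrable M E b" "E \<in> sets M" "emeasure M E < \<infinity>"
  shows "deviation b c E < \<infinity>"
proof -
  have "set_integrable M E (\<lambda>w. c)" using assms by (simp add: set_integrable_def)
  then have "set_integrable M E (\<lambda>z. b z - c)" using assms by (intro set_integral_diff(1))
  then have "(\<integral>\<^sup>+z. ennreal (norm (indicator E z *\<^sub>R (b z - c))) \<partial>M) < \<infinity>"
    unfolding set_integrable_def by (simp add: integrable_iff_bounded)
  also have "(\<integral>\<^sup>+z. ennreal (norm (indicator E z *\<^sub>R (b z - c))) \<partial>M) = (deviation b c E)"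
    by (intro nn_integral_cong) (auto simp: indicator_def)
  finally show ?thesis .
qed

text \<open>Points of the two boxes can be moved to the reference points \<open>z0\<close>, \<open>w0\<close> by at most \<open>2 L\<close> each, while
\<open>d(z0,w0) \<ge> R L\<close>.\<close>

lemma kernel_nearly_constant:
  assumes k: "bergman_type_kernel \<alpha> k" and L: "L > 0" and R: "R \<ge> 1 + 4 / \<eta>" and \<eta>: "\<eta> > 0"
    and flat: "\<forall>z\<in>upper_half. \<forall>w\<in>upper_half. \<forall>z0\<in>upper_half. \<forall>w0\<in>upper_half.
     cmod (z - z0) + cmod (w - w0) \<le> \<eta> * hdist z0 w0 \<longrightarrow> cmod (k z w - k z0 w0) \<le> \<delta> * cmod (k z0 w0)"
    and aa': "\<bar>a - a'\<bar> = R * L"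
  obtains K0 where "((R + 3) * L) powr (- (2 + \<alpha>)) \<le> cmod K0"
    "\<And>z w. z \<in> slab a (a + L) 0 L \<Longrightarrow> w \<in> slab a' (a' + L) 0 L \<Longrightarrow> cmod (k z w - K0) \<le> \<delta> * cmod K0"
proof -
  define z0 w0 where "z0 = Complex a (L/2)" and "w0 = Complex a' (L/2)"
  have up: "z0 \<in> upper_half" "w0 \<in> upper_half" using L by (auto simp: z0_def w0_def upper_half_def)
  have "hdist z0 w0 \<le> \<bar>a - a'\<bar> + \<bar>L/2 + L/2\<bar>" using hdist_le[of z0 w0] by (simp add: z0_def w0_def)
  also have "\<dots> = R * L + L" unfolding aa' using L by simp
  also have "\<dots> \<le> (R + 3) * L" using L by (simp add: algebra_simps)
  finally have up_le: "hdist z0 w0 \<le> (R + 3) * L" .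
  have lo: "R * L \<le> hdist z0 w0" using Re_le_hdist[of z0 w0] aa' by (simp add: z0_def w0_def)
  have "4 * L \<le> \<eta> * (R * L)"
  proof -
    have "4 \<le> \<eta> * R" using mult_left_mono[OF R less_imp_le[OF \<eta>]] \<eta> by (simp add: distrib_left)
    then show ?thesis using mult_right_mono[of 4 "\<eta> * R" L] L by (simp add: mult.assoc)
  qed
  also have "\<dots> \<le> \<eta> * hdist z0 w0" using lo \<eta> by (intro mult_left_mono) auto
  finally have sep: "4 * L \<le> \<eta> * hdist z0 w0" .
  have near: "cmod (z - Complex x (L/2)) \<le> 2 * L" if "z \<in> slab x (x + L) 0 L" for x z
  proof -
    have "cmod (z - Complex x (L/2)) \<le> \<bar>Re (z - Complex x (L/2))\<bar> + \<bar>Im (z - Complex x (L/2))\<bar>" by (rule cmod_le)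
    also have "\<dots> \<le> L + L" using that L by (intro add_mono) (auto simp: slab_def abs_le_iff)
    finally show ?thesis by simp
  qed
  have "kern \<alpha> z0 w0 \<ge> ((R + 3) * L) powr (- (2 + \<alpha>))"
    unfolding kern_def using up_le hdist_pos[OF up] alpha by (intro powr_mono2') auto
  then have 1: "((R + 3) * L) powr (- (2 + \<alpha>)) \<le> cmod (k z0 w0)" using k up by (simp add: bergman_type_kernel_def)
  have 2: "cmod (k z w - k z0 w0) \<le> \<delta> * cmod (k z0 w0)" if "z \<in> slab a (a + L) 0 L" "w \<in> slab a' (a' + L) 0 L" for z w
  proof -
    have "cmod (z - z0) + cmod (w - w0) \<le> 2 * L + 2 * L"
      unfolding z0_def w0_def by (intro add_mono near that)
    also have "\<dots> \<le> \<eta> * hdist z0 w0" using sep by simp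
    finally show ?thesis using flat up that slab_subset by blast
  qed
  show ?thesis by (rule that[OF 1 2])
qed

text \<open>One of the two inequalities to be absorbed: the oscillation on \<open>E\<close> about the mean over \<open>F\<close>, in terms of
the norm of the commutator and of the same two oscillations with the small factor \<open>\<delta>\<close>.\<close>

lemma oscillation_from_test:
  assumes k: "bergman_type_kernel \<alpha> k" and mb [measurable]: "b \<in> borel_measurable M" and hol: "b holomorphic_on upper_half"
    and \<mu>: "bekolle \<mu> K1" and lam: "bekolle lam K2"
    and S: "bounded_extension \<alpha> \<mu> lam (commutator b (intop \<alpha> k)) S C" and C: "C \<ge> 0"
    and E [measurable]: "E \<in> sets M" and eE: "emeasure M E = ennreal eE" "eE > 0" and intE: "set_integrable M E b"
    and F [measurable]: "F \<in> sets M" and AF: "emeasure M F = ennreal AF" "AF > 0" and intF: "set_integrable M F b"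
    and FC: "(indicator F :: complex \<Rightarrow> complex) \<in> bdd_cpt_supp"
    and J: "J \<in> D1 \<union> D2" "E \<subseteq> carleson J" "F \<subseteq> carleson J"
    and W: "mass \<mu> (carleson J) * (mass (\<lambda>z. inverse (lam z)) (carleson J)) \<le> ennreal (W\<^sup>2)" "W \<ge> 0"
    and K0: "\<And>z w. z \<in> E \<Longrightarrow> w \<in> F \<Longrightarrow> cmod (k z w - K0) \<le> \<delta> * cmod K0" and \<delta>: "\<delta> \<ge> 0"
    and \<kappa>: "\<kappa> > 0" "\<kappa> \<le> cmod K0 * AF"
    and x: "(deviation b ((LINT w:F|M. b w) / of_real AF) E) = ennreal x" "x \<ge> 0"
    and y: "(deviation b ((LINT w:E|M. b w) / of_real eE) F) = ennreal y" "y \<ge> 0"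
  shows "x \<le> C * W / \<kappa> + \<delta> * (x + eE / AF * (2 * y))"
proof -
  let ?c = "(LINT w:F|M. b w) / of_real AF"
  let ?D = "\<integral>\<^sup>+z. (\<integral>\<^sup>+w. ennreal (cmod (b z - b w)) * indicator F w \<partial>M) * indicator E z \<partial>M"
  have mono: "mass w G \<le> mass w (carleson J)" if "G \<subseteq> carleson J" for w G
    using that by (intro nn_integral_mono mult_left_mono) (auto simp: indicator_def)
  have Wle: "mass \<mu> F * mass (\<lambda>z. inverse (lam z)) E \<le> ennreal (W\<^sup>2)"
    by (rule order_trans[OF mult_mono[OF mono[OF J(3)] mono[OF J(2)]] W(1)]) simp_all
  have fin: "mass \<mu> F < \<infinity>"
    using mono[OF J(3), of \<mu>] bekolle_finite[OF \<mu> J(1)] by (rule order_le_less_trans)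
  have P: "(\<integral>\<^sup>+z. ennreal (cmod (commop \<alpha> k b (indicator F) z)) * indicator E z \<partial>M) \<le> ennreal (C * W)"
    by (rule commutator_mass_le[OF k mb hol \<mu> lam S C E F FC Wle W(2) fin])
  have dev: "deviation b ?c F \<le> 2 * ennreal y"
    unfolding y(1)[symmetric] by (rule average_deviation[OF F AF mb intF])
  have "?D \<le> ennreal AF * ennreal x + ennreal eE * (deviation b ?c F)"
    using double_oscillation_le[OF E F mb, of ?c] unfolding AF(1) eE(1) x(1) .
  also have "\<dots> \<le> ennreal AF * ennreal x + ennreal eE * (2 * ennreal y)"
    by (intro add_left_mono mult_left_mono dev) simp
  also have "\<dots> = ennreal (AF * x + eE * (2 * y))"
    using AF(2) eE(2) x y by (simp add: ennreal_mult)
  finally have D: "?D \<le> ennreal (AF * x + eE * (2 * y))" .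
  define Z where "Z = AF * x + eE * (2 * y)"
  have Z: "Z \<ge> 0" using AF(2) eE(2) x y by (simp add: Z_def)
  have "ennreal (cmod K0 * AF) * ennreal x \<le> ennreal (C * W) + ennreal (\<delta> * cmod K0) * ennreal Z"
    unfolding x(1)[symmetric]
    by (rule order_trans[OF commutator_test[OF k mb hol E F AF FC intF K0 \<delta>]])
       (auto simp: x(1) Z_def intro!: add_mono P mult_left_mono D)
  also have "ennreal (\<delta> * cmod K0) * ennreal Z = ennreal (\<delta> * cmod K0 * Z)"
    using \<delta> Z by (intro ennreal_mult[symmetric]) auto
  also have "ennreal (C * W) + ennreal (\<delta> * cmod K0 * Z) = ennreal (C * W + \<delta> * cmod K0 * Z)"
    using C W \<delta> Z by (intro ennreal_plus[symmetric]) auto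
  also have "ennreal (cmod K0 * AF) * ennreal x = ennreal (cmod K0 * AF * x)"
    using AF(2) x by (intro ennreal_mult[symmetric]) auto
  finally have "cmod K0 * AF * x \<le> C * W + \<delta> * cmod K0 * Z"
    using C W \<delta> Z by (subst (asm) ennreal_le_iff) auto
  then have "cmod K0 * AF * x \<le> C * W + \<delta> * cmod K0 * (AF * x + eE * (2 * y))" by (simp only: Z_def)
  moreover have "\<delta> * cmod K0 * (AF * x + eE * (2 * y)) = (cmod K0 * AF) * (\<delta> * (x + eE / AF * (2 * y)))"
    using AF(2) by (simp add: field_simps)
  ultimately have "(cmod K0 * AF) * (x - \<delta> * (x + eE / AF * (2 * y))) \<le> C * W"
    by (simp add: right_diff_distrib)
  moreover have pos: "cmod K0 * AF > 0" using \<kappa> by linarith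
  ultimately have "x - \<delta> * (x + eE / AF * (2 * y)) \<le> C * W / (cmod K0 * AF)"
    by (simp add: pos_le_divide_eq mult.commute)
  also have "\<dots> \<le> C * W / \<kappa>"
    using C W by (intro divide_left_mono[OF \<kappa>(2)] mult_nonneg_nonneg mult_pos_pos[OF pos \<kappa>(1)]) auto
  finally show ?thesis by simp
qed

text \<open>Cauchy-Schwarz for \<open>\<nu> = \<mu>\<^bsup>1/2\<^esup> \<lambda>\<^bsup>-1/2\<^esup>\<close>.\<close>

lemma ratio_integral_finite:
  assumes \<mu>: "bekolle \<mu> K1" and lam: "bekolle lam K2"
    and \<nu>: "\<And>z. z \<in> upper_half \<Longrightarrow> (\<nu> z)\<^sup>2 * lam z = \<mu> z" "\<And>z. z \<in> upper_half \<Longrightarrow> \<nu> z > 0"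
    and [measurable]: "\<nu> \<in> borel_measurable M" and I: "I \<in> D1 \<union> D2"
  shows "mass \<nu> (carleson I) < \<infinity>"
proof -
  have [measurable]: "\<mu> \<in> borel_measurable M" "lam \<in> borel_measurable M" "carleson I \<in> sets M"
    using \<mu> lam carleson_sets_D I by (auto simp: bekolle_def)
  have pos: "lam z > 0" if "z \<in> upper_half" for z using lam that by (auto simp: bekolle_def)
  let ?f = "\<lambda>z. ennreal (\<nu> z * lam z)"
  have f1: "?f z * ennreal (inverse (lam z)) = ennreal (\<nu> z)" if "z \<in> upper_half" for z
    using pos[OF that] \<nu>(2)[OF that] by (subst ennreal_mult[symmetric]) (auto simp: field_simps)
  have f2: "(?f z)\<^sup>2 * ennreal (inverse (lam z)) = ennreal (\<mu> z)" if z: "z \<in> upper_half" for z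
  proof -
    have "(?f z)\<^sup>2 * ennreal (inverse (lam z)) = ennreal ((\<nu> z * lam z)\<^sup>2 * inverse (lam z))"
      using pos[OF z] \<nu>(2)[OF z] by (simp add: ennreal_power ennreal_mult[symmetric])
    also have "(\<nu> z * lam z)\<^sup>2 * inverse (lam z) = \<mu> z"
      unfolding \<nu>(1)[OF z, symmetric] using pos[OF z] by (simp add: field_simps power2_eq_square)
    finally show ?thesis .
  qed
  have "(mass \<nu> (carleson I))\<^sup>2 = (\<integral>\<^sup>+z. ?f z * ennreal (inverse (lam z)) * indicator (carleson I) z \<partial>M)\<^sup>2"
    by (intro arg_cong[where f = "\<lambda>x. x\<^sup>2"] nn_integral_cong) (simp only: space_dA f1)
  also have "\<dots> \<le> (\<integral>\<^sup>+z. (?f z)\<^sup>2 * ennreal (inverse (lam z)) * indicator (carleson I) z \<partial>M) * mass (\<lambda>z. inverse (lam z)) (carleson I)"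
    by (rule weighted_Cauchy_Schwarz) (use pos in \<open>auto simp: less_imp_le\<close>)
  also have "(\<integral>\<^sup>+z. (?f z)\<^sup>2 * ennreal (inverse (lam z)) * indicator (carleson I) z \<partial>M) = mass \<mu> (carleson I)"
    by (intro nn_integral_cong) (simp only: space_dA f2)
  also have "mass \<mu> (carleson I) * mass (\<lambda>z. inverse (lam z)) (carleson I) < \<infinity>"
    using bekolle_finite[OF \<mu> I] bekolle_finite[OF bekolle_inverse[OF lam] I] by (simp add: ennreal_mult_less_top)
  finally show ?thesis by (auto simp: power2_eq_square ennreal_mult_less_top)
qed

lemma theta_ge_1: "\<theta> \<ge> 1"
  using one_minus_half_powr_pos by (simp add: \<theta>_def)

text \<open>The box over \<open>I\<close> is exhausted by sets \<open>En n\<close> away from the real axis, whose indicators have compact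
support; the companion set \<open>F\<close> stays fixed, so that the constant \<open>cF\<close> does not depend on \<open>n\<close> and
monotone convergence applies to \<open>|b - cF|\<close>.\<close>

lemma commutator_lower_bound:
  assumes k: "bergman_type_kernel \<alpha> k" and flat: "slowly_varying k" and \<mu>: "bekolle \<mu> K1" and lam: "bekolle lam K2"
    and \<nu>: "\<And>z. z \<in> upper_half \<Longrightarrow> (\<nu> z)\<^sup>2 * lam z = \<mu> z" "\<And>z. z \<in> upper_half \<Longrightarrow> \<nu> z > 0"
    and m\<nu>: "\<nu> \<in> borel_measurable M"
  obtains c where "c > 0" "\<And>b S C. b \<in> L1loc \<alpha> \<Longrightarrow> b holomorphic_on upper_half \<Longrightarrow> C \<ge> 0 \<Longrightarrow>
    bounded_extension \<alpha> \<mu> lam (commutator b (intop \<alpha> k)) S C \<Longrightarrow> bmo_bound \<nu> b (c * C)"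
proof -
  \<comment> \<open>The measures of \<open>En n\<close> and \<open>F\<close> differ by a factor of up to \<open>\<theta>\<close>, which \<open>\<delta>\<close> has to compensate.\<close>
  define \<delta> where "\<delta> = 1 / (8 * \<theta>)"
  have \<delta>: "\<delta> > 0" using theta_pos by (simp add: \<delta>_def)
  obtain \<eta> where \<eta>: "\<eta> > 0" and fl: "\<forall>z\<in>upper_half. \<forall>w\<in>upper_half. \<forall>z0\<in>upper_half. \<forall>w0\<in>upper_half.
     cmod (z - z0) + cmod (w - w0) \<le> \<eta> * hdist z0 w0 \<longrightarrow> cmod (k z w - k z0 w0) \<le> \<delta> * cmod (k z0 w0)"
    using flat \<delta> unfolding slowly_varying_def by blast
  define R where "R = 1 + 4 / \<eta>"
  have R: "R > 0" using \<eta> by (simp add: R_def add_pos_pos)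
  define \<kappa> where "\<kappa> = (R + 3) powr (- (2 + \<alpha>)) * box_const / \<theta>"
  have \<kappa>: "\<kappa> > 0" using R box_const_pos theta_pos by (simp add: \<kappa>_def)
  define q where "q = weight_ratio K1 K2 R"
  have q: "q \<ge> 0" using \<mu> lam by (simp add: q_def weight_ratio_def bekolle_def)
  \<comment> \<open>The summand \<open>1\<close> ensures \<open>c > 0\<close>.\<close>
  define c where "c = 8 * q / \<kappa> + 1"
  have c: "c > 0" using q \<kappa> by (simp add: c_def add_nonneg_pos)
  have "bmo_bound \<nu> b (c * C)"
    if bL: "b \<in> L1loc \<alpha>" and hol: "b holomorphic_on upper_half" and C: "C \<ge> 0"
      and S: "bounded_extension \<alpha> \<mu> lam (commutator b (intop \<alpha> k)) S C" for b S C
  proof -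
    have mb [measurable]: "b \<in> borel_measurable M" and bint: "\<forall>I. is_interval I \<and> bounded I \<longrightarrow> set_integrable M (carleson I) b"
      using bL by (auto simp: L1loc_def)
    have "(deviation b (box_avg \<alpha> b I) (carleson I))
       \<le> ennreal (c * C) * (mass \<nu> (carleson I))" if I: "I \<in> D1 \<union> D2" for I
    proof -
      obtain v where v: "mass \<nu> (carleson I) = ennreal v" "v \<ge> 0"
        using ratio_integral_finite[OF \<mu> lam \<nu> m\<nu> I] by (cases "\<integral>\<^sup>+z. ennreal (\<nu> z) * indicator (carleson I) z \<partial>M") auto
      obtain a d where ad: "I = {a..<d}" "a < d" using half_open[OF I] .
      define L where "L = d - a"
      have L: "L > 0" "d = a + L" "len I = L" using ad by (auto simp: L_def len_atLeastLessThan)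
      define a' where "a' = a + R * L"
      obtain J where J: "J \<in> D1 \<union> D2" "{a..a + (R + 1) * L} \<subseteq> J" "len J \<le> C0 * (a + (R + 1) * L - a)"
        using cover[of a "a + (R + 1) * L"] R L by auto
      have RL: "R * L > 0" using R L by simp
      have RL1: "(R + 1) * L = R * L + L" by (simp add: algebra_simps)
      obtain e f where ef: "J = {e..<f}" "e < f" using half_open[OF J(1)] .
      have ends: "e \<le> a" "a + (R * L + L) < f"
        using J(2) RL L(1) unfolding ef RL1 by (auto simp: atLeastAtMost_subseteq_atLeastLessThan_iff)
      have IJ: "I \<subseteq> J" using ends RL L unfolding ad ef by auto
      have lenJ: "len J \<le> C0 * (2 * R + 1) * len I"
      proof -
        have "C0 * (a + (R + 1) * L - a) \<le> C0 * ((2 * R + 1) * L)"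
          using C0 R L(1) by (intro mult_left_mono) (auto simp: algebra_simps)
        then show ?thesis using J(3) L(3) by (simp add: mult.assoc)
      qed
      define W where "W = q * v"
      have W: "W \<ge> 0" "mass \<mu> (carleson J) * (mass (\<lambda>z. inverse (lam z)) (carleson J)) \<le> ennreal (W\<^sup>2)"
        using q v(2) two_weight_box[OF \<mu> lam \<nu> m\<nu> I J(1) IJ lenJ R v] by (auto simp: W_def q_def)
      define F where "F = slab a' (a' + L) (L/2) L"
      define AF where "AF = box_const * L powr (2 + \<alpha>) / \<theta>"
      have AF: "AF > 0" using box_const_pos L theta_pos by (simp add: AF_def)
      have eF: "emeasure M F = ennreal AF" and eT: "emeasure M (slab a (a + L) (L/2) L) = ennreal AF"
      proof -
        have "emeasure M (tophalf I) = ennreal AF" using tophalf_measure[OF I] by (simp add: AF_def L(3))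
        then show eT: "emeasure M (slab a (a + L) (L/2) L) = ennreal AF"
          using tophalf_half_open[OF ad(2)] by (simp add: ad(1) L_def)
        have "emeasure M F = emeasure M (slab a (a + L) (L/2) L)"
          unfolding F_def using emeasure_slab[OF alpha, of "L/2" L a' "a' + L"] emeasure_slab[OF alpha, of "L/2" L a "a + L"] L(1)
          by simp
        then show "emeasure M F = ennreal AF" using eT by simp
      qed
      have F [measurable]: "F \<in> sets M" by (simp add: F_def)
      have intF: "set_integrable M F b" and FC: "(indicator F :: complex \<Rightarrow> complex) \<in> bdd_cpt_supp"
        unfolding F_def using slab_set_integrable[OF bint, of a' "a' + L" "L/2"] indicator_slab_bdd_cpt_supp[of "L/2"] L(1) by auto
      have FJ: "F \<subseteq> carleson J"
        using ends RL L(1) unfolding ef carleson_half_open[OF ef(2)] F_def by (auto simp: slab_def a'_def)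
      define cF where "cF = (LINT w:F|M. b w) / of_real AF"
      have \<kappa>le: "\<kappa> \<le> K * X" if "((R + 3) * L) powr (- (2 + \<alpha>)) \<le> K" "AF \<le> X" for K X
      proof -
        have "\<kappa> = ((R + 3) * L) powr (- (2 + \<alpha>)) * AF"
        proof -
          have "L powr (- (2 + \<alpha>)) * L powr (2 + \<alpha>) = 1" using L(1) by (simp only: powr_add[symmetric]) simp
          moreover have "((R + 3) * L) powr (- (2 + \<alpha>)) = (R + 3) powr (- (2 + \<alpha>)) * L powr (- (2 + \<alpha>))"
            using R L(1) by (intro powr_mult)
          ultimately have "((R + 3) * L) powr (- (2 + \<alpha>)) * L powr (2 + \<alpha>) = (R + 3) powr (- (2 + \<alpha>))" by (simp only: mult.assoc mult_1_right)
          then show ?thesis by (simp add: \<kappa>_def AF_def mult.left_commute)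
        qed
        also have "\<dots> \<le> K * X" using that AF by (intro mult_mono) (auto intro: order_trans[OF powr_ge_zero])
        finally show ?thesis .
      qed
      define En where "En = (\<lambda>n::nat. slab a (a + L) (L / (real n + 2)) L)"
      have En_sets [measurable]: "En n \<in> sets M" for n by (simp add: En_def)
      have En_le: "deviation b cF (En n) \<le> ennreal (4 * q / \<kappa> * C * v)" for n
      proof -
        let ?E = "En n"
        have s: "0 < L / (real n + 2)" "L / (real n + 2) \<le> L / 2"
          using L(1) by (simp, intro divide_left_mono, auto)
        have sub: "slab a (a + L) (L/2) L \<subseteq> ?E" "?E \<subseteq> carleson I"
        proof -
          show "slab a (a + L) (L/2) L \<subseteq> ?E"
          proof
            fix z assume z: "z \<in> slab a (a + L) (L/2) L"
            then have "L / 2 \<le> Im z" by (simp add: slab_def)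
            with s(2) have "L / (real n + 2) \<le> Im z" by (rule order_trans)
            then show "z \<in> ?E" using z by (simp add: slab_def En_def)
          qed
          show "?E \<subseteq> carleson I"
            unfolding ad(1) carleson_half_open[OF ad(2)] En_def L_def[symmetric] by (auto simp: slab_def L(2))
        qed
        have EJ: "?E \<subseteq> carleson J"
          using ends RL L(1) s unfolding ef carleson_half_open[OF ef(2)] En_def by (auto simp: slab_def)
        have up: "emeasure M ?E \<le> ennreal (\<theta> * AF)"
        proof -
          have "emeasure M ?E \<le> emeasure M (carleson I)" using sub(2) carleson_sets_D[OF I] by (intro emeasure_mono)
          also have "\<dots> = ennreal (\<theta> * AF)" using carleson_measure_D[OF I] theta_pos by (simp add: AF_def L(3))
          finally show ?thesis .
        qed
        then obtain X where X: "emeasure M ?E = ennreal X" "X \<ge> 0"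
          by (cases "emeasure M ?E") (auto simp: top_unique)
        have "ennreal AF \<le> ennreal X" unfolding eT[symmetric] X(1)[symmetric] using sub(1) by (intro emeasure_mono) auto
        then have X1: "AF \<le> X" using X by (simp add: ennreal_le_iff)
        have X2: "X \<le> \<theta> * AF" using up X AF theta_pos by (simp add: ennreal_le_iff)
        have X0: "X > 0" using X1 AF by linarith
        have intE: "set_integrable M ?E b" and EC: "(indicator ?E :: complex \<Rightarrow> complex) \<in> bdd_cpt_supp"
          unfolding En_def using slab_set_integrable[OF bint, of a "a + L" "L / (real n + 2)"] indicator_slab_bdd_cpt_supp[OF s(1)] L(1) s(1) by auto
        define cE where "cE = (LINT w:?E|M. b w) / of_real X"
        obtain x where x: "deviation b cF ?E = ennreal x" "x \<ge> 0"
          using set_integrable_deviation_finite[OF intE En_sets, of cF] X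
          by (cases "\<integral>\<^sup>+z. ennreal (cmod (b z - cF)) * indicator ?E z \<partial>M") auto
        obtain y where y: "deviation b cE F = ennreal y" "y \<ge> 0"
          using set_integrable_deviation_finite[OF intF F, of cE] eF
          by (cases "\<integral>\<^sup>+z. ennreal (cmod (b z - cE)) * indicator F z \<partial>M") auto
        have subs: "?E \<subseteq> slab a (a + L) 0 L" "F \<subseteq> slab a' (a' + L) 0 L"
          using s(1) L(1) by (auto simp: En_def F_def slab_def)
        have aa: "\<bar>a - a'\<bar> = R * L" "\<bar>a' - a\<bar> = R * L" using RL by (simp_all add: a'_def)
        obtain K0 where K0: "((R + 3) * L) powr (- (2 + \<alpha>)) \<le> cmod K0"
          "\<And>z w. z \<in> slab a (a + L) 0 L \<Longrightarrow> w \<in> slab a' (a' + L) 0 L \<Longrightarrow> cmod (k z w - K0) \<le> \<delta> * cmod K0"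
          using kernel_nearly_constant[OF k L(1) _ \<eta> fl aa(1)] R_def by blast
        obtain K1' where K1': "((R + 3) * L) powr (- (2 + \<alpha>)) \<le> cmod K1'"
          "\<And>z w. z \<in> slab a' (a' + L) 0 L \<Longrightarrow> w \<in> slab a (a + L) 0 L \<Longrightarrow> cmod (k z w - K1') \<le> \<delta> * cmod K1'"
          using kernel_nearly_constant[OF k L(1) _ \<eta> fl aa(2)] R_def by blast
        have stepx: "x \<le> C * W / \<kappa> + \<delta> * (x + X / AF * (2 * y))"
          by (rule oscillation_from_test[OF k mb hol \<mu> lam S C En_sets X(1) X0 intE F eF AF intF FC J(1) EJ FJ W(2,1) K0(2) less_imp_le[OF \<delta>] \<kappa> \<kappa>le[OF K0(1) order_refl]
               x(1)[unfolded cF_def] x(2) y(1)[unfolded cE_def] y(2)]) (use subs in auto)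
        have stepy: "y \<le> C * W / \<kappa> + \<delta> * (y + AF / X * (2 * x))"
          by (rule oscillation_from_test[OF k mb hol \<mu> lam S C F eF AF intF En_sets X(1) X0 intE EC J(1) FJ EJ W(2,1) K1'(2) less_imp_le[OF \<delta>] \<kappa> \<kappa>le[OF K1'(1) X1]
               y(1)[unfolded cE_def] y(2) x(1)[unfolded cF_def] x(2)]) (use subs in auto)
        have "\<delta> * (x + X / AF * (2 * y)) \<le> \<delta> * (x + \<theta> * (2 * y))"
          using X2 AF \<delta> y by (intro mult_left_mono add_left_mono mult_right_mono) (auto simp: pos_divide_le_eq)
        then have sx: "x \<le> C * W / \<kappa> + \<delta> * (x + \<theta> * (2 * y))" using stepx by linarith
        have "AF / X * (2 * x) \<le> 1 * (2 * x)" using X1 X0 x by (intro mult_right_mono) auto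
        then have "\<delta> * (y + AF / X * (2 * x)) \<le> \<delta> * (2 * x + y)" using \<delta> by (intro mult_left_mono) auto
        then have sy: "y \<le> C * W / \<kappa> + \<delta> * (2 * x + y)" using stepy by linarith
        have "x \<le> 2 * (C * W / \<kappa> + C * W / \<kappa>)"
          by (rule absorb_cross_terms[OF x(2) y(2) theta_ge_1 \<delta>_def sx sy])
        also have "\<dots> = 4 * q / \<kappa> * C * v" by (simp add: W_def)
        finally show ?thesis unfolding x(1) by (rule ennreal_leI)
      qed
      have all: "deviation b cF (carleson I) \<le> ennreal (4 * q / \<kappa> * C * v)"
      proof -
        define N where "N = density M (\<lambda>z. ennreal (cmod (b z - cF)))"
        have eN: "emeasure N G = (deviation b cF G)" if "G \<in> sets M" for G
          unfolding N_def by (rule emeasure_density[OF _ that]) measurable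
        have inc: "incseq En"
        proof (intro monoI)
          fix m n :: nat assume "m \<le> n"
          then have "L / (real n + 2) \<le> L / (real m + 2)" using L(1) by (intro divide_left_mono) auto
          then show "En m \<subseteq> En n" by (auto simp: En_def slab_def)
        qed
        have UN: "(\<Union>n. En n) = carleson I"
        proof (intro equalityI subsetI)
          fix z assume "z \<in> (\<Union>n. En n)"
          then show "z \<in> carleson I"
            unfolding ad(1) carleson_half_open[OF ad(2)] by (auto simp: En_def slab_def L(2))
        next
          fix z assume z: "z \<in> carleson I"
          then have z': "a \<le> Re z" "Re z < a + L" "0 < Im z" "Im z < L"
            unfolding ad(1) carleson_half_open[OF ad(2)] by (auto simp: slab_def L(2))
          obtain n :: nat where "L / Im z < real n" using reals_Archimedean2 by blast
          then have "L < real n * Im z" using z'(3) by (simp add: pos_divide_less_eq)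
          also have "\<dots> \<le> (real n + 2) * Im z" using z'(3) by (intro mult_right_mono) auto
          finally have "L / (real n + 2) \<le> Im z" by (simp add: pos_divide_le_eq mult.commute)
          then have "z \<in> En n" using z' by (auto simp: En_def slab_def)
          then show "z \<in> (\<Union>n. En n)" by blast
        qed
        have "deviation b cF (carleson I) = emeasure N (\<Union>n. En n)"
          unfolding UN using carleson_sets_D[OF I] by (rule eN[symmetric])
        also have "\<dots> = (SUP n. emeasure N (En n))"
          by (rule SUP_emeasure_incseq[symmetric]) (use inc En_sets in \<open>auto simp: N_def\<close>)
        also have "\<dots> \<le> ennreal (4 * q / \<kappa> * C * v)"
          by (intro SUP_least) (simp only: eN[OF En_sets] En_le)
        finally show ?thesis .
      qed
      have Ipos: "box_const * len I powr (2 + \<alpha>) > 0" using box_const_pos L by simp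
      have bI: "box_avg \<alpha> b I = (LINT z:carleson I|M. b z) / of_real (box_const * len I powr (2 + \<alpha>))"
        unfolding box_avg_def measure_def carleson_measure_D[OF I] using Ipos by simp
      have intI: "set_integrable M (carleson I) b" using bint unfolding ad(1) using half_open_interval by blast
      have "(deviation b (box_avg \<alpha> b I) (carleson I))
         \<le> 2 * (deviation b cF (carleson I))"
        unfolding bI by (rule average_deviation[OF carleson_sets_D[OF I] carleson_measure_D[OF I] Ipos mb intI])
      also have "\<dots> \<le> 2 * ennreal (4 * q / \<kappa> * C * v)" by (intro mult_left_mono all) simp
      also have "\<dots> = ennreal (8 * q / \<kappa> * C * v)"
      proof -
        have "4 * q / \<kappa> * C * v \<ge> 0" using q \<kappa> C v by simp
        then have "ennreal 2 * ennreal (4 * q / \<kappa> * C * v) = ennreal (2 * (4 * q / \<kappa> * C * v))" by (intro ennreal_mult[symmetric]) auto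
        moreover have "2 * (4 * q / \<kappa> * C * v) = 8 * q / \<kappa> * C * v" by simp
        ultimately show ?thesis by (simp only: ennreal_numeral)
      qed
      also have "\<dots> \<le> ennreal (c * C * v)"
        using C v by (intro ennreal_leI mult_right_mono) (auto simp: c_def)
      also have "\<dots> = ennreal (c * C) * ennreal v" using c C v by (intro ennreal_mult) auto
      finally show ?thesis unfolding v(1) .
    qed
    then show ?thesis using c C by (auto simp: bmo_bound_def)
  qed
  then show ?thesis by (rule that[OF c])
qed

end

section \<open>The two Bergman kernels\<close>

definition bergman_kernel :: "real \<Rightarrow> complex \<Rightarrow> complex \<Rightarrow> complex" where
  "bergman_kernel \<alpha> z w = \<i> powr of_real (2 + \<alpha>) / (z - cnj w) powr of_real (2 + \<alpha>)"

definition bergman_pos_kernel :: "real \<Rightarrow> complex \<Rightarrow> complex \<Rightarrow> complex" where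
  "bergman_pos_kernel \<alpha> z w = 1 / of_real (cmod (z - cnj w) powr (2 + \<alpha>))"

lemma bergman_eq_intop: "bergman \<alpha> = intop \<alpha> (bergman_kernel \<alpha>)"
proof (intro ext)
  fix f z
  have "bergman \<alpha> f z = (\<integral>w. \<i> powr of_real (2 + \<alpha>) * (f w / (z - cnj w) powr of_real (2 + \<alpha>)) \<partial>dA \<alpha>)"
    unfolding bergman_def by (rule integral_mult_right_zero[symmetric])
  also have "\<dots> = intop \<alpha> (bergman_kernel \<alpha>) f z"
    unfolding intop_def bergman_kernel_def by (intro Bochner_Integration.integral_cong refl) simp
  finally show "bergman \<alpha> f z = intop \<alpha> (bergman_kernel \<alpha>) f z" .
qed

lemma bergman_pos_eq_intop: "bergman_pos \<alpha> = intop \<alpha> (bergman_pos_kernel \<alpha>)"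
  by (intro ext) (simp add: bergman_pos_def intop_def bergman_pos_kernel_def)

lemma diff_cnj_upper: "z \<in> upper_half \<Longrightarrow> w \<in> upper_half \<Longrightarrow> z - cnj w \<in> upper_half"
  by (simp add: upper_half_def)

lemma upper_half_nonzero: "u \<in> upper_half \<Longrightarrow> u \<noteq> 0"
  by (auto simp: upper_half_def)

lemma bergman_type_bergman: "bergman_type_kernel \<alpha> (bergman_kernel \<alpha>)"
  unfolding bergman_type_kernel_def
proof (intro conjI ballI)
  have "continuous_on upper_half Ln"
    by (intro continuous_on_Ln continuous_on_id) (auto simp: upper_half_def complex_nonpos_Reals_iff)
  then have [measurable]: "(\<lambda>u. indicator upper_half u *\<^sub>R Ln u) \<in> borel_measurable borel"
    by (intro borel_measurable_continuous_on_indicator upper_half_borel)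
  have [measurable]: "exp \<in> borel_measurable (borel :: complex measure)"
    by (intro borel_measurable_continuous_onI continuous_on_exp continuous_on_id)
  let ?L = "\<lambda>u. exp (of_real (2 + \<alpha>) * (indicator upper_half u *\<^sub>R Ln u))"
  have "(\<lambda>p. \<i> powr of_real (2 + \<alpha>) / ?L (fst p - cnj (snd p))) \<in> borel_measurable (dA \<alpha> \<Otimes>\<^sub>M dA \<alpha>)"
    by measurable
  then show "(\<lambda>p. bergman_kernel \<alpha> (fst p) (snd p)) \<in> borel_measurable (dA \<alpha> \<Otimes>\<^sub>M dA \<alpha>)"
  proof (rule measurable_cong[THEN iffD1, rotated])
    fix p assume "p \<in> space (dA \<alpha> \<Otimes>\<^sub>M dA \<alpha>)"
    then have u: "fst p - cnj (snd p) \<in> upper_half" by (auto simp: space_pair_measure diff_cnj_upper)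
    then have "fst p - cnj (snd p) \<noteq> 0" by (rule upper_half_nonzero)
    with u show "\<i> powr of_real (2 + \<alpha>) / ?L (fst p - cnj (snd p)) = bergman_kernel \<alpha> (fst p) (snd p)"
      by (simp add: bergman_kernel_def powr_def)
  qed
next
  fix z w assume "z \<in> upper_half" "w \<in> upper_half"
  have 1: "cmod (\<i> powr of_real (2 + \<alpha>)) = 1"
    by (subst norm_powr_real_powr') auto
  have 2: "cmod ((z - cnj w) powr of_real (2 + \<alpha>)) = hdist z w powr (2 + \<alpha>)"
    by (subst norm_powr_real_powr') (auto simp: hdist_def)
  show "cmod (bergman_kernel \<alpha> z w) = kern \<alpha> z w"
    unfolding bergman_kernel_def norm_divide 1 2 kern_def by (rule powr_minus_divide[symmetric])
qed

lemma bergman_type_bergman_pos: "bergman_type_kernel \<alpha> (bergman_pos_kernel \<alpha>)"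
  unfolding bergman_type_kernel_def
proof (intro conjI ballI)
  have "(\<lambda>p. of_real (1 / hdist (fst p) (snd p) powr (2 + \<alpha>)) :: complex) \<in> borel_measurable (dA \<alpha> \<Otimes>\<^sub>M dA \<alpha>)"
    by measurable
  then show "(\<lambda>p. bergman_pos_kernel \<alpha> (fst p) (snd p)) \<in> borel_measurable (dA \<alpha> \<Otimes>\<^sub>M dA \<alpha>)"
    by (simp add: bergman_pos_kernel_def hdist_def)
next
  fix z w
  show "cmod (bergman_pos_kernel \<alpha> z w) = kern \<alpha> z w"
    unfolding bergman_pos_kernel_def kern_def powr_minus_divide hdist_def norm_divide norm_one norm_of_real by simp
qed

text \<open>The principal branch is multiplicative here: the arguments of \<open>u0\<close> and of \<open>\<xi>\<close> add up to a number between
\<open>- pi / 2\<close> and \<open>3 pi / 2\<close>, and only values in \<open>(0, pi)\<close> are compatible with \<open>u0 * \<xi>\<close> in the upper half plane.\<close>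

lemma powr_upper_half_mult:
  assumes u0: "u0 \<in> upper_half" and u: "u0 * \<xi> \<in> upper_half" and \<xi>: "Re \<xi> > 0"
  shows "(u0 * \<xi>) powr s = u0 powr s * \<xi> powr s"
proof -
  have nz: "u0 \<noteq> 0" "\<xi> \<noteq> 0" using \<xi> upper_half_nonzero[OF u0] by auto
  have i0: "0 < Im (Ln u0)" "Im (Ln u0) < pi" using u0 Im_Ln_pos_lt[OF nz(1)] by (auto simp: upper_half_def)
  have i1: "\<bar>Im (Ln \<xi>)\<bar> < pi / 2" using Re_Ln_pos_lt[OF nz(2)] \<xi> by simp
  have u': "0 < Im (Ln (u0 * \<xi>))" using u Im_Ln_pos_lt[of "u0 * \<xi>"] nz by (auto simp: upper_half_def)
  have s1: "\<not> Im (Ln u0 + Ln \<xi>) \<le> - pi" using i0 i1 pi_gt_zero by (simp add: abs_less_iff)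
  have s2: "\<not> Im (Ln u0 + Ln \<xi>) > pi"
  proof
    assume a: "Im (Ln u0 + Ln \<xi>) > pi"
    then have "Ln (u0 * \<xi>) = Ln u0 + Ln \<xi> - \<i> * of_real (2 * pi)"
      unfolding Ln_times[OF nz] using s1 by (simp only: if_False if_True)
    then have "Im (Ln (u0 * \<xi>)) = Im (Ln u0) + Im (Ln \<xi>) - 2 * pi" by simp
    then show False using u' i0 i1 by (simp add: abs_less_iff)
  qed
  have "Ln (u0 * \<xi>) = Ln u0 + Ln \<xi>"
    unfolding Ln_times[OF nz] using s1 s2 by (simp only: if_False)
  then show ?thesis using nz by (simp add: powr_def distrib_left exp_add)
qed

text \<open>A kernel that depends on \<open>z - cnj w\<close> alone and is multiplied by a continuous factor \<open>\<rho> \<zeta>\<close> when this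
argument is multiplied by \<open>1 + \<zeta>\<close>.\<close>

lemma slowly_varyingI:
  assumes cont: "isCont \<rho> 0" "\<rho> 0 = 1"
    and eq: "\<And>z w z0 w0 \<zeta>. z \<in> upper_half \<Longrightarrow> w \<in> upper_half \<Longrightarrow> z0 \<in> upper_half \<Longrightarrow> w0 \<in> upper_half \<Longrightarrow>
      z - cnj w = (z0 - cnj w0) * (1 + \<zeta>) \<Longrightarrow> cmod \<zeta> \<le> 1/2 \<Longrightarrow> k z w = k z0 w0 * \<rho> \<zeta>"
  shows "slowly_varying k"
  unfolding slowly_varying_def
proof (intro allI impI)
  fix \<delta> :: real assume \<delta>: "\<delta> > 0"
  obtain e where e: "e > 0" "\<And>\<zeta>. dist \<zeta> 0 < e \<Longrightarrow> dist (\<rho> \<zeta>) (\<rho> 0) < \<delta>"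
    using cont(1) \<delta> unfolding continuous_at_eps_delta by blast
  define \<eta> where "\<eta> = min (e / 2) (1 / 2)"
  have \<eta>: "\<eta> > 0" "\<eta> < e" "\<eta> \<le> 1/2" using e by (auto simp: \<eta>_def)
  show "\<exists>\<eta>>0. \<forall>z\<in>upper_half. \<forall>w\<in>upper_half. \<forall>z0\<in>upper_half. \<forall>w0\<in>upper_half.
     cmod (z - z0) + cmod (w - w0) \<le> \<eta> * hdist z0 w0 \<longrightarrow> cmod (k z w - k z0 w0) \<le> \<delta> * cmod (k z0 w0)"
  proof (intro exI[of _ \<eta>] conjI \<eta>(1) ballI impI)
    fix z w z0 w0 assume up: "z \<in> upper_half" "w \<in> upper_half" "z0 \<in> upper_half" "w0 \<in> upper_half"
      and near: "cmod (z - z0) + cmod (w - w0) \<le> \<eta> * hdist z0 w0"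
    define u u0 \<zeta> where "u = z - cnj w" and "u0 = z0 - cnj w0" and "\<zeta> = (u - u0) / u0"
    have u0: "u0 \<noteq> 0" unfolding u0_def by (intro upper_half_nonzero diff_cnj_upper up)
    have "u - u0 = (z - z0) - cnj (w - w0)" by (simp add: u_def u0_def)
    then have "cmod (u - u0) \<le> cmod (z - z0) + cmod (cnj (w - w0))" by (simp only: norm_triangle_ineq4)
    also have "\<dots> \<le> \<eta> * cmod u0" using near by (simp only: complex_mod_cnj hdist_def u0_def)
    finally have \<zeta>: "cmod \<zeta> \<le> \<eta>" using u0 by (simp add: \<zeta>_def norm_divide pos_divide_le_eq)
    have "u0 * (1 + \<zeta>) = u" using u0 by (simp add: \<zeta>_def distrib_left)
    then have "k z w = k z0 w0 * \<rho> \<zeta>"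
      using \<zeta> \<eta> by (intro eq up) (simp_all add: u_def u0_def)
    then have "k z w - k z0 w0 = k z0 w0 * (\<rho> \<zeta> - 1)" by (simp add: right_diff_distrib)
    then have "cmod (k z w - k z0 w0) = cmod (k z0 w0) * cmod (\<rho> \<zeta> - 1)" by (simp only: norm_mult)
    also have "\<dots> \<le> cmod (k z0 w0) * \<delta>"
      using e(2)[of \<zeta>] \<zeta> \<eta> cont(2) by (intro mult_left_mono) (auto simp: dist_norm)
    finally show "cmod (k z w - k z0 w0) \<le> \<delta> * cmod (k z0 w0)" by (simp only: mult.commute)
  qed
qed

lemma Re_one_plus_pos: "cmod \<zeta> \<le> 1/2 \<Longrightarrow> Re (1 + \<zeta>) > 0"
  using abs_Re_le_cmod[of \<zeta>] by (simp add: abs_le_iff)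

lemma slowly_varying_bergman: "slowly_varying (bergman_kernel \<alpha>)"
proof (rule slowly_varyingI[where \<rho> = "\<lambda>\<zeta>. 1 / (1 + \<zeta>) powr of_real (2 + \<alpha>)"])
  show "isCont (\<lambda>\<zeta>::complex. 1 / (1 + \<zeta>) powr of_real (2 + \<alpha>)) 0"
    by (intro continuous_intros) (auto simp: complex_nonpos_Reals_iff)
  fix z w z0 w0 \<zeta> assume up: "z \<in> upper_half" "w \<in> upper_half" "z0 \<in> upper_half" "w0 \<in> upper_half"
    and eq: "z - cnj w = (z0 - cnj w0) * (1 + \<zeta>)" and \<zeta>: "cmod \<zeta> \<le> 1/2"
  have "(z - cnj w) powr of_real (2 + \<alpha>) = (z0 - cnj w0) powr of_real (2 + \<alpha>) * (1 + \<zeta>) powr of_real (2 + \<alpha>)"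
    unfolding eq
    by (rule powr_upper_half_mult) (use diff_cnj_upper[OF up(1,2)] diff_cnj_upper[OF up(3,4)] eq Re_one_plus_pos[OF \<zeta>] in auto)
  then show "bergman_kernel \<alpha> z w = bergman_kernel \<alpha> z0 w0 * (1 / (1 + \<zeta>) powr of_real (2 + \<alpha>))"
    by (simp add: bergman_kernel_def)
qed simp

lemma slowly_varying_bergman_pos: "slowly_varying (bergman_pos_kernel \<alpha>)"
proof (rule slowly_varyingI[where \<rho> = "\<lambda>\<zeta>. of_real (1 / cmod (1 + \<zeta>) powr (2 + \<alpha>))"])
  show "isCont (\<lambda>\<zeta>. complex_of_real (1 / cmod (1 + \<zeta>) powr (2 + \<alpha>))) 0"
    by (intro continuous_intros) auto
  fix z w z0 w0 \<zeta> assume eq: "z - cnj w = (z0 - cnj w0) * (1 + \<zeta>)"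
  have "cmod (z - cnj w) powr (2 + \<alpha>) = cmod (z0 - cnj w0) powr (2 + \<alpha>) * cmod (1 + \<zeta>) powr (2 + \<alpha>)"
    unfolding eq norm_mult by (rule powr_mult)
  then show "bergman_pos_kernel \<alpha> z w = bergman_pos_kernel \<alpha> z0 w0 * of_real (1 / cmod (1 + \<zeta>) powr (2 + \<alpha>))"
    by (simp add: bergman_pos_kernel_def)
qed simp

section \<open>The equivalence of norms\<close>

lemma AE_dA: "AE z in lebesgue_on upper_half. P z \<Longrightarrow> AE z in dA \<alpha>. P z"
proof -
  assume P: "AE z in lebesgue_on upper_half. P z"
  have m: "(\<lambda>z. ennreal (1 / pi * (\<alpha> + 1) * (2 * Im z) powr \<alpha>)) \<in> borel_measurable (lebesgue_on upper_half)"
    by (intro measurable_restrict_space1 measurable_completion) simp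
  show "AE z in dA \<alpha>. P z"
    unfolding dA_def AE_density[OF m] using P by eventually_elim simp
qed

text \<open>Weights are positive only almost everywhere; this is an equivalent weight without exceptional points.\<close>

definition positive_version :: "(complex \<Rightarrow> real) \<Rightarrow> complex \<Rightarrow> real" where
  "positive_version \<mu> z = (if \<mu> z > 0 then \<mu> z else 1)"

lemma positive_version_pos: "positive_version \<mu> z > 0"
  by (simp add: positive_version_def)

lemma AE_positive_version: "weight \<mu> \<Longrightarrow> AE z in dA \<alpha>. positive_version \<mu> z = \<mu> z"
  unfolding weight_def by (intro AE_dA) (auto elim!: eventually_mono simp: positive_version_def)

lemma measurable_weight: "weight \<mu> \<Longrightarrow> \<mu> \<in> borel_measurable (dA \<alpha>)"
  unfolding weight_def using measurable_cong_sets[OF sets_dA refl] by blast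

lemma measurable_positive_version:
  assumes "weight \<mu>"
  shows "positive_version \<mu> \<in> borel_measurable (dA \<alpha>)"
proof -
  have [measurable]: "\<mu> \<in> borel_measurable (dA \<alpha>)" using measurable_weight[OF assms] .
  show ?thesis unfolding positive_version_def[abs_def] by measurable
qed

lemma L2_cong_weight:
  assumes "AE z in dA \<alpha>. w' z = w z" and [measurable]: "w \<in> borel_measurable (dA \<alpha>)" "w' \<in> borel_measurable (dA \<alpha>)"
  shows "L2 \<alpha> w' = L2 \<alpha> w" "f \<in> borel_measurable (dA \<alpha>) \<Longrightarrow> L2_norm \<alpha> w' f = L2_norm \<alpha> w f"
proof -
  have ae: "AE z in dA \<alpha>. (cmod (f z))\<^sup>2 * w' z = (cmod (f z))\<^sup>2 * w z" for f :: "complex \<Rightarrow> complex"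
    using assms(1) by eventually_elim simp
  have int: "integrable (dA \<alpha>) (\<lambda>z. (cmod (f z))\<^sup>2 * w' z) = integrable (dA \<alpha>) (\<lambda>z. (cmod (f z))\<^sup>2 * w z)"
    if [measurable]: "f \<in> borel_measurable (dA \<alpha>)" for f
    by (rule integrable_cong_AE) (use ae in measurable)
  show "L2 \<alpha> w' = L2 \<alpha> w" unfolding L2_def using int by blast
  assume [measurable]: "f \<in> borel_measurable (dA \<alpha>)"
  have "(\<integral>z. (cmod (f z))\<^sup>2 * w' z \<partial>dA \<alpha>) = (\<integral>z. (cmod (f z))\<^sup>2 * w z \<partial>dA \<alpha>)"
    by (rule integral_cong_AE) (use ae in measurable)
  then show "L2_norm \<alpha> w' f = L2_norm \<alpha> w f" by (simp add: L2_norm_def)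
qed

lemma bounded_extension_cong_weight:
  assumes "AE z in dA \<alpha>. \<mu>' z = \<mu> z" "\<mu> \<in> borel_measurable (dA \<alpha>)" "\<mu>' \<in> borel_measurable (dA \<alpha>)"
    and "AE z in dA \<alpha>. lam' z = lam z" "lam \<in> borel_measurable (dA \<alpha>)" "lam' \<in> borel_measurable (dA \<alpha>)"
  shows "bounded_extension \<alpha> \<mu>' lam' T S C = bounded_extension \<alpha> \<mu> lam T S C"
proof -
  note m = L2_cong_weight[OF assms(1-3)] and l = L2_cong_weight[OF assms(4-6)]
  have n: "L2_norm \<alpha> \<mu>' f = L2_norm \<alpha> \<mu> f" if "f \<in> L2 \<alpha> \<mu>" for f
    using that by (intro m(2)) (simp add: L2_def)
  have n': "L2_norm \<alpha> lam' f = L2_norm \<alpha> lam f" if "f \<in> L2 \<alpha> lam" for f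
    using that by (intro l(2)) (simp add: L2_def)
  have bound: "(\<forall>f\<in>L2 \<alpha> \<mu>. S f \<in> L2 \<alpha> lam \<and> L2_norm \<alpha> lam' (S f) \<le> C * L2_norm \<alpha> \<mu>' f)
    \<longleftrightarrow> (\<forall>f\<in>L2 \<alpha> \<mu>. S f \<in> L2 \<alpha> lam \<and> L2_norm \<alpha> lam (S f) \<le> C * L2_norm \<alpha> \<mu> f)"
    by (intro ball_cong refl conj_cong) (simp add: n n')
  show ?thesis unfolding bounded_extension_def m(1) l(1) bound ..
qed

context half_plane begin

lemma carleson_measure_pos: "I \<in> D1 \<union> D2 \<Longrightarrow> \<exists>a>0. emeasure M (carleson I) = ennreal a"
  using carleson_measure_D[of I] len_pos[of I] box_const_pos by (intro exI[of _ "box_const * len I powr (2 + \<alpha>)"]) auto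

lemma bekolle_of_B2:
  assumes \<mu>: "\<mu> \<in> B2 \<alpha> (D1 \<union> D2)"
  obtains K where "bekolle (positive_version \<mu>) K"
proof -
  have w: "weight \<mu>" and fin: "B2_const \<alpha> (D1 \<union> D2) \<mu> < \<infinity>" using \<mu> by (auto simp: B2_def)
  obtain K where K: "K \<ge> 0" "B2_const \<alpha> (D1 \<union> D2) \<mu> = ennreal K"
    using fin by (cases "B2_const \<alpha> (D1 \<union> D2) \<mu>") auto
  have "mass (positive_version \<mu>) (carleson I) * mass (\<lambda>z. inverse (positive_version \<mu> z)) (carleson I) \<le> ennreal K * (emeasure M (carleson I))\<^sup>2"
    if I: "I \<in> D1 \<union> D2" for I
  proof -
    obtain a where a: "a > 0" "emeasure M (carleson I) = ennreal a" using carleson_measure_pos[OF I] by blast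
    have e1: "mass (positive_version \<mu>) (carleson I) = mass \<mu> (carleson I)"
      by (rule nn_integral_cong_AE, use AE_positive_version[OF w] in eventually_elim) simp
    have e2: "mass (\<lambda>z. inverse (positive_version \<mu> z)) (carleson I) = mass (\<lambda>z. inverse (\<mu> z)) (carleson I)"
      by (rule nn_integral_cong_AE, use AE_positive_version[OF w] in eventually_elim) simp
    have le: "(mass \<mu> (carleson I) / ennreal a) * (mass (\<lambda>z. inverse (\<mu> z)) (carleson I) / ennreal a) \<le> ennreal K"
      unfolding K(2)[symmetric] B2_const_def a(2)[symmetric] by (rule SUP_upper[OF I])
    have canc: "x / ennreal a * ennreal a = x" for x
      using a(1) by (simp add: ennreal_divide_times)
    have "mass \<mu> (carleson I) * mass (\<lambda>z. inverse (\<mu> z)) (carleson I)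
      = (mass \<mu> (carleson I) / ennreal a * ennreal a) * (mass (\<lambda>z. inverse (\<mu> z)) (carleson I) / ennreal a * ennreal a)"
      by (simp only: canc)
    also have "\<dots> = ((mass \<mu> (carleson I) / ennreal a) * (mass (\<lambda>z. inverse (\<mu> z)) (carleson I) / ennreal a)) * (ennreal a)\<^sup>2"
      by (simp only: power2_eq_square mult_ac)
    also have "\<dots> \<le> ennreal K * (ennreal a)\<^sup>2" by (intro mult_right_mono le) simp
    finally show ?thesis unfolding e1 e2 a(2) .
  qed
  then have "bekolle (positive_version \<mu>) K"
    unfolding bekolle_def using measurable_positive_version[OF w] positive_version_pos K by blast
  then show ?thesis by (rule that)
qed

text \<open>Both estimates are proved for the versions \<open>\<mu>'\<close>, \<open>lam'\<close>, \<open>\<nu>'\<close> without exceptional points and carry over,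
since all quantities in the statement are insensitive to null sets.\<close>

lemma commutator_equivalence:
  assumes k: "bergman_type_kernel \<alpha> k" and flat: "slowly_varying k"
    and \<mu>: "\<mu> \<in> B2 \<alpha> (D1 \<union> D2)" and lam: "lam \<in> B2 \<alpha> (D1 \<union> D2)"
    and \<nu>_def: "\<nu> = (\<lambda>z. \<mu> z powr (1/2) * lam z powr (-1/2))"
  shows "\<forall>b \<in> L1loc \<alpha>. b holomorphic_on upper_half \<longrightarrow>
      (bounded_L2 \<alpha> \<mu> lam (commutator b (intop \<alpha> k)) \<longleftrightarrow> b \<in> BMOA \<alpha> (D1 \<union> D2) \<nu>)"
    and "\<exists>C>0. \<forall>b \<in> L1loc \<alpha>. b holomorphic_on upper_half \<longrightarrow>
      op_norm_L2 \<alpha> \<mu> lam (commutator b (intop \<alpha> k)) \<le> ennreal C * BMO_norm \<alpha> (D1 \<union> D2) \<nu> b \<and>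
      BMO_norm \<alpha> (D1 \<union> D2) \<nu> b \<le> ennreal C * op_norm_L2 \<alpha> \<mu> lam (commutator b (intop \<alpha> k))"
proof -
  define \<mu>' lam' where "\<mu>' = positive_version \<mu>" and "lam' = positive_version lam"
  define \<nu>' where "\<nu>' = (\<lambda>z. \<mu>' z powr (1/2) * lam' z powr (-1/2))"
  have w: "weight \<mu>" "weight lam" using \<mu> lam by (auto simp: B2_def)
  obtain K1 where K1: "bekolle \<mu>' K1" using bekolle_of_B2[OF \<mu>] unfolding \<mu>'_def by blast
  obtain K2 where K2: "bekolle lam' K2" using bekolle_of_B2[OF lam] unfolding lam'_def by blast
  have pos: "\<mu>' z > 0" "lam' z > 0" "\<nu>' z > 0" for z
    using positive_version_pos[of \<mu> z] positive_version_pos[of lam z] by (auto simp: \<mu>'_def lam'_def \<nu>'_def)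
  have m [measurable]: "\<mu> \<in> borel_measurable M" "lam \<in> borel_measurable M" "\<mu>' \<in> borel_measurable M" "lam' \<in> borel_measurable M"
    using measurable_weight w measurable_positive_version unfolding \<mu>'_def lam'_def by blast+
  have m\<nu> [measurable]: "\<nu>' \<in> borel_measurable M" unfolding \<nu>'_def by measurable
  have ae: "AE z in M. \<mu>' z = \<mu> z" "AE z in M. lam' z = lam z"
    unfolding \<mu>'_def lam'_def using AE_positive_version w by blast+
  have \<nu>': "(\<nu>' z)\<^sup>2 * lam' z = \<mu>' z" for z
  proof -
    have "(\<nu>' z)\<^sup>2 = (\<mu>' z powr (1/2))\<^sup>2 * (lam' z powr (-1/2))\<^sup>2" by (simp add: \<nu>'_def power_mult_distrib)
    also have "(\<mu>' z powr (1/2))\<^sup>2 = \<mu>' z" using pos(1)[of z] by (simp add: powr_half_sqrt)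
    also have "(lam' z powr (-1/2))\<^sup>2 = inverse (lam' z)"
      using pos(2)[of z] by (simp add: powr_minus powr_half_sqrt power_inverse)
    finally show ?thesis using pos(2)[of z] by simp
  qed
  have ae\<nu>: "AE z in M. \<nu>' z = \<nu> z"
    using ae by eventually_elim (simp add: \<nu>_def \<nu>'_def)
  let ?T = "\<lambda>b. commutator b (intop \<alpha> k)"
  let ?N = "\<lambda>b. BMO_norm \<alpha> (D1 \<union> D2) \<nu> b"
  have ext: "bounded_extension \<alpha> \<mu>' lam' T S C = bounded_extension \<alpha> \<mu> lam T S C" for T S C
    by (rule bounded_extension_cong_weight) (use ae m in auto)
  let ?V = "\<lambda>I. \<integral>\<^sup>+z. ennreal (\<nu> z) * indicator (carleson I) z \<partial>M"
  let ?V' = "\<lambda>I. \<integral>\<^sup>+z. ennreal (\<nu>' z) * indicator (carleson I) z \<partial>M"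
  let ?O = "\<lambda>b I. \<integral>\<^sup>+z. ennreal (cmod (b z - box_avg \<alpha> b I)) * indicator (carleson I) z \<partial>M"
  have VV: "?V I = ?V' I" for I
    by (rule nn_integral_cong_AE, use ae\<nu> in eventually_elim) simp
  have V: "\<exists>v>0. ?V I = ennreal v" if I: "I \<in> D1 \<union> D2" for I
  proof -
    have "?V' I < \<infinity>" by (rule ratio_integral_finite[OF K1 K2 \<nu>' pos(3) m\<nu> I])
    moreover have "?V' I > 0"
      using carleson_measure_pos[OF I] by (intro weight_integral_pos m\<nu> carleson_sets_D[OF I] pos) auto
    ultimately show ?thesis unfolding VV by (cases "?V' I") auto
  qed
  have norm_iff: "bmo_bound \<nu>' b B \<longleftrightarrow> ?N b \<le> ennreal B" if B: "B \<ge> 0" for b B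
  proof -
    have "?O b I / ?V I \<le> ennreal B \<longleftrightarrow> ?O b I \<le> ennreal B * ?V' I" if I: "I \<in> D1 \<union> D2" for I
    proof -
      obtain v where v: "v > 0" "?V I = ennreal v" using V[OF I] by blast
      have canc: "x / ennreal v * ennreal v = x" "x * ennreal v / ennreal v = x" for x
        using v(1) by (simp_all add: ennreal_divide_times mult_divide_eq_ennreal)
      show ?thesis unfolding VV[symmetric] v(2)
      proof
        assume "?O b I / ennreal v \<le> ennreal B"
        then have "?O b I / ennreal v * ennreal v \<le> ennreal B * ennreal v" by (rule mult_right_mono) simp
        then show "?O b I \<le> ennreal B * ennreal v" by (simp only: canc)
      next
        assume "?O b I \<le> ennreal B * ennreal v"
        then have "?O b I / ennreal v \<le> ennreal B * ennreal v / ennreal v" by (rule divide_right_mono_ennreal)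
        then show "?O b I / ennreal v \<le> ennreal B" by (simp only: canc)
      qed
    qed
    then show ?thesis using B unfolding bmo_bound_def BMO_norm_def SUP_le_iff by blast
  qed
  obtain c where c: "c > 0" and low: "\<And>b S C. b \<in> L1loc \<alpha> \<Longrightarrow> b holomorphic_on upper_half \<Longrightarrow> C \<ge> 0 \<Longrightarrow>
    bounded_extension \<alpha> \<mu>' lam' (?T b) S C \<Longrightarrow> bmo_bound \<nu>' b (c * C)"
    using commutator_lower_bound[OF k flat K1 K2 \<nu>' pos(3) m\<nu>] by blast
  have low': "?N b \<le> ennreal (c * C)"
    if "b \<in> L1loc \<alpha>" "b holomorphic_on upper_half" "C \<ge> 0" "bounded_extension \<alpha> \<mu> lam (?T b) S C" for b S C
    using low[OF that(1-3), of S] that(3,4) c norm_iff[of "c * C" b] by (simp add: ext)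
  define u where "u = c_osc * posop_const K2 * posop_const K1"
  have u: "u > 0" using K1 K2 posop_const_pos[of K1] posop_const_pos[of K2] c_osc_pos by (simp add: u_def bekolle_def)
  have upp: "bounded_extension \<alpha> \<mu> lam (?T b) (commop \<alpha> k b) (u * B)"
    if b: "b \<in> L1loc \<alpha>" "b holomorphic_on upper_half" and B: "B \<ge> 0" "?N b \<le> ennreal B" for b B
  proof -
    have mb: "b \<in> borel_measurable M" using b by (simp add: L1loc_def)
    have "bmo_bound \<nu>' b B" using norm_iff[OF B(1)] B(2) by simp
    then have "bounded_extension \<alpha> \<mu>' lam' (?T b) (commop \<alpha> k b) (u * B)"
      unfolding u_def by (intro commutator_extension[OF k K1 K2 \<nu>' less_imp_le[OF pos(3)] m\<nu> mb b(2)])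
    then show ?thesis unfolding ext .
  qed
  show "\<forall>b \<in> L1loc \<alpha>. b holomorphic_on upper_half \<longrightarrow>
      (bounded_L2 \<alpha> \<mu> lam (?T b) \<longleftrightarrow> b \<in> BMOA \<alpha> (D1 \<union> D2) \<nu>)"
  proof (intro ballI impI iffI)
    fix b assume b: "b \<in> L1loc \<alpha>" "b holomorphic_on upper_half" and "bounded_L2 \<alpha> \<mu> lam (?T b)"
    then obtain S C where S: "bounded_extension \<alpha> \<mu>' lam' (?T b) S C" unfolding bounded_L2_def ext by blast
    have "C * L2_norm \<alpha> \<mu>' f \<le> max C 0 * L2_norm \<alpha> \<mu>' f" for f
      using L2_norm_nonneg[of \<mu>' \<alpha> f] less_imp_le[OF pos(1)] by (intro mult_right_mono) auto
    then have "bounded_extension \<alpha> \<mu>' lam' (?T b) S (max C 0)"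
      using S unfolding bounded_extension_def by (meson order_trans)
    then have "?N b \<le> ennreal (c * max C 0)" using low'[OF b, of "max C 0" S] by (simp add: ext)
    then have "?N b < \<infinity>" by (rule order_le_less_trans) simp
    then show "b \<in> BMOA \<alpha> (D1 \<union> D2) \<nu>" using b by (simp add: BMOA_def BMO_def)
  next
    fix b assume b: "b \<in> L1loc \<alpha>" "b holomorphic_on upper_half" and "b \<in> BMOA \<alpha> (D1 \<union> D2) \<nu>"
    then have "?N b < \<infinity>" by (simp add: BMOA_def BMO_def)
    then obtain B where "B \<ge> 0" "?N b = ennreal B" by (cases "?N b") auto
    then show "bounded_L2 \<alpha> \<mu> lam (?T b)" using upp[OF b, of B] unfolding bounded_L2_def by auto
  qed
  show "\<exists>C>0. \<forall>b \<in> L1loc \<alpha>. b holomorphic_on upper_half \<longrightarrow>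
      op_norm_L2 \<alpha> \<mu> lam (?T b) \<le> ennreal C * ?N b \<and> ?N b \<le> ennreal C * op_norm_L2 \<alpha> \<mu> lam (?T b)"
  proof (intro exI[of _ "max u c"] conjI ballI impI)
    show "max u c > 0" using u by simp
    fix b assume b: "b \<in> L1loc \<alpha>" "b holomorphic_on upper_half"
    show "op_norm_L2 \<alpha> \<mu> lam (?T b) \<le> ennreal (max u c) * ?N b"
    proof (cases "?N b = \<infinity>")
      case True
      have "max u c > 0" using u by simp
      then show ?thesis unfolding True by (simp add: ennreal_mult_top)
    next
      case False
      then obtain B where B: "B \<ge> 0" "?N b = ennreal B" by (cases "?N b") auto
      have "op_norm_L2 \<alpha> \<mu> lam (?T b) \<le> ennreal (u * B)"
        unfolding op_norm_L2_def using upp[OF b B(1)] B u by (intro Inf_lower) auto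
      also have "\<dots> \<le> ennreal (max u c * B)" using B by (intro ennreal_leI mult_right_mono) auto
      also have "\<dots> = ennreal (max u c) * ?N b" unfolding B(2) using u B by (intro ennreal_mult) auto
      finally show ?thesis .
    qed
    have "?N b / ennreal c \<le> op_norm_L2 \<alpha> \<mu> lam (?T b)"
      unfolding op_norm_L2_def
    proof (rule Inf_greatest)
      fix x assume "x \<in> {ennreal C |C. 0 \<le> C \<and> (\<exists>S. bounded_extension \<alpha> \<mu> lam (?T b) S C)}"
      then obtain C S where C: "x = ennreal C" "C \<ge> 0" "bounded_extension \<alpha> \<mu> lam (?T b) S C" by blast
      have "?N b \<le> ennreal (c * C)" by (rule low'[OF b C(2,3)])
      also have "\<dots> = x * ennreal c" using c C by (simp add: ennreal_mult mult.commute)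
      finally have "?N b / ennreal c \<le> x * ennreal c / ennreal c" by (rule divide_right_mono_ennreal)
      then show "?N b / ennreal c \<le> x" using c by (simp add: mult_divide_eq_ennreal)
    qed
    then have "?N b / ennreal c * ennreal c \<le> op_norm_L2 \<alpha> \<mu> lam (?T b) * ennreal c" by (rule mult_right_mono) simp
    then have "?N b \<le> op_norm_L2 \<alpha> \<mu> lam (?T b) * ennreal c" using c by (simp add: ennreal_divide_times)
    also have "\<dots> \<le> op_norm_L2 \<alpha> \<mu> lam (?T b) * ennreal (max u c)" by (intro mult_left_mono ennreal_leI) auto
    finally show "?N b \<le> ennreal (max u c) * op_norm_L2 \<alpha> \<mu> lam (?T b)" by (simp only: mult.commute)
  qed
qed

end

lemma half_plane_of_adjacent:
  assumes "\<alpha> > -1" "adjacent_dyadic D1 D2"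
  obtains C0 where "half_plane \<alpha> D1 D2 C0"
proof -
  obtain C where D: "dyadic_system D1" "dyadic_system D2"
    and C: "\<And>I. is_interval I \<and> bounded I \<and> len I > 0 \<Longrightarrow> \<exists>J\<in>D1 \<union> D2. I \<subseteq> J \<and> len J \<le> C * len I"
    using assms(2) unfolding adjacent_dyadic_def by blast
  have "\<exists>J\<in>D1 \<union> D2. {a..b} \<subseteq> J \<and> len J \<le> max C 1 * (b - a)" if ab: "a < b" for a b
  proof -
    have l: "len {a..b} = b - a" using ab by (simp add: len_def)
    obtain J where J: "J \<in> D1 \<union> D2" "{a..b} \<subseteq> J" "len J \<le> C * (b - a)"
      using C[of "{a..b}"] ab l by (auto simp: is_interval_cc)
    have "C * (b - a) \<le> max C 1 * (b - a)" using ab by (intro mult_right_mono) auto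
    then show ?thesis using J by (intro bexI[of _ J]) auto
  qed
  then have "half_plane \<alpha> D1 D2 (max C 1)"
    using assms(1) D by unfold_locales auto
  then show ?thesis by (rule that)
qed

theorem theorem1p4:
  fixes \<alpha> :: real and D1 D2 D :: "real set set" and \<mu> lam \<nu> :: "complex \<Rightarrow> real"
  assumes "\<alpha> > -1"
    and "adjacent_dyadic D1 D2" and "D = D1 \<union> D2"
    and "\<mu> \<in> B2 \<alpha> D" and "lam \<in> B2 \<alpha> D"
    and "\<nu> = (\<lambda>z. \<mu> z powr (1/2) * lam z powr (-1/2))"
  shows "(\<forall>b \<in> L1loc \<alpha>. b holomorphic_on upper_half \<longrightarrow>
            (bounded_L2 \<alpha> \<mu> lam (commutator b (bergman \<alpha>)) \<longleftrightarrow> b \<in> BMOA \<alpha> D \<nu>) \<and>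
            (bounded_L2 \<alpha> \<mu> lam (commutator b (bergman_pos \<alpha>)) \<longleftrightarrow> b \<in> BMOA \<alpha> D \<nu>)) \<and>
         (\<exists>C>0. \<forall>b \<in> L1loc \<alpha>. b holomorphic_on upper_half \<longrightarrow>
            op_norm_L2 \<alpha> \<mu> lam (commutator b (bergman \<alpha>)) \<le> ennreal C * BMO_norm \<alpha> D \<nu> b \<and>
            BMO_norm \<alpha> D \<nu> b \<le> ennreal C * op_norm_L2 \<alpha> \<mu> lam (commutator b (bergman \<alpha>))) \<and>
         (\<exists>C>0. \<forall>b \<in> L1loc \<alpha>. b holomorphic_on upper_half \<longrightarrow>
            op_norm_L2 \<alpha> \<mu> lam (commutator b (bergman_pos \<alpha>)) \<le> ennreal C * BMO_norm \<alpha> D \<nu> b \<and>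
            BMO_norm \<alpha> D \<nu> b \<le> ennreal C * op_norm_L2 \<alpha> \<mu> lam (commutator b (bergman_pos \<alpha>)))"
proof -
  obtain C0 where "half_plane \<alpha> D1 D2 C0" using half_plane_of_adjacent[OF assms(1,2)] .
  then interpret half_plane \<alpha> D1 D2 C0 .
  note \<mu> = assms(4)[unfolded assms(3)] and lam = assms(5)[unfolded assms(3)]
  note holo = commutator_equivalence[OF bergman_type_bergman slowly_varying_bergman \<mu> lam assms(6)]
  note pos = commutator_equivalence[OF bergman_type_bergman_pos slowly_varying_bergman_pos \<mu> lam assms(6)]
  show ?thesis
    unfolding assms(3) bergman_eq_intop bergman_pos_eq_intop
    using holo pos by blast
qed

end
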